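(* Let $\mu\in Curr(F)$, $\mu\ne 0$. Then the function \[ E_\mu: cv(F)\to \mathbb R,\qquad T\mapsto h_T(\mu) \] is continuous.
   Context: $F$ is a free group of finite rank $k\ge 2$. $cv(F)$ is the set of all minimal, free and discrete isometric actions of $F$ on $\mathbb R$-trees $T$, two trees being equal if there is an $F$-equivariant isometry between them. $cv(F)$ carries the equivariant Gromov–Hausdorff convergence topology, which is known to coincide with the topology of pointwise convergence of translation length functions $g\mapsto \|g\|_T=\inf_{x\in T}d_T(x,gx)$, and with the weak CW-topology coming from edge-lengths of marked metric graphs. $\partial F$ is the hyperbolic boundary of $F$ and $\partial^2F$ the set of pairs of distinct points of $\partial F$, with the translation action of $F$. $\partial T$ and $\partial^2 T$ denote the hyperbolic boundary of $T$ and the set of pairs of distinct points of it. Orbit maps $F\to T$ induce canonical $F$-equivariant homeomorphisms $\partial F\to\partial T$, $\partial^2F\to\partial^2T$, by which these are identified. A geodesic current on $F$ is a positive $F$-invariant Borel measure on $\partial^2F$ that is finite on compact subsets; $Curr(F)$ is the space of all geodesic currents. For $x\neq y$ in $T$, $[x,y]$ is the oriented geodesic segment from $x$ to $y$ and $Cyl_{[x,y]}\subseteq\partial^2F$ is the set of all $(\zeta_1,\zeta_2)$ such that the oriented bi-infinite geodesic in $T$ from $\zeta_1$ to $\zeta_2$ contains $[x,y]$ with agreeing orientation. The geometric entropy of $\mu$ with respect to $T$ is \[ h_T(\mu):=\liminf_{d_T(x,y)\to\infty,\ x,y\in T}\frac{-\log\mu(Cyl_{[x,y]})}{d_T(x,y)},\qquad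 \log 0:=-\infty; \] for $\mu\neq 0$ one has $0\le h_T(\mu)<\infty$. *)

theory Defs
  imports "HOL-Analysis.Analysis" "HOL-Algebra.Group_Action"
begin

section \<open>Free groups and their word metrics\<close>

text \<open>
  A word over \<open>X\<close> is a list of letters \<open>(x, e)\<close> with \<open>x \<in> X\<close>; the letter \<open>(x, True)\<close> stands
  for \<open>x\<close> and \<open>(x, False)\<close> for the inverse of \<open>x\<close>.
\<close>

definition words :: "'f set \<Rightarrow> ('f \<times> bool) list set" where
  "words X = lists (X \<times> UNIV)"

definition word_eval :: "('f, 'b) monoid_scheme \<Rightarrow> ('f \<times> bool) list \<Rightarrow> 'f" where
  "word_eval F w =
     foldr (\<lambda>(x, e) g. (if e then x else inv\<^bsub>F\<^esub> x) \<otimes>\<^bsub>F\<^esub> g) w \<one>\<^bsub>F\<^esub>"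

definition reduced_word :: "('f \<times> bool) list \<Rightarrow> bool" where
  "reduced_word w \<longleftrightarrow> successively (\<lambda>a b. \<not> (fst a = fst b \<and> snd a \<noteq> snd b)) w"

definition free_basis :: "('f, 'b) monoid_scheme \<Rightarrow> 'f set \<Rightarrow> bool" where
  "free_basis F X \<longleftrightarrow>
     X \<subseteq> carrier F \<and>
     (\<forall>g\<in>carrier F. \<exists>!w. w \<in> words X \<and> reduced_word w \<and> word_eval F w = g)"

definition word_length :: "('f, 'b) monoid_scheme \<Rightarrow> 'f set \<Rightarrow> 'f \<Rightarrow> nat" where
  "word_length F X g = (LEAST n. \<exists>w\<in>words X. length w = n \<and> word_eval F w = g)"

definition word_dist :: "('f, 'b) monoid_scheme \<Rightarrow> 'f set \<Rightarrow> 'f \<Rightarrow> 'f \<Rightarrow> real" where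
  "word_dist F X g h = real (word_length F X (inv\<^bsub>F\<^esub> g \<otimes>\<^bsub>F\<^esub> h))"


section \<open>The hyperbolic (Gromov) boundary\<close>

type_synonym 'p bdry_point = "(nat \<Rightarrow> 'p) set"

definition gromov_prod :: "('p \<Rightarrow> 'p \<Rightarrow> real) \<Rightarrow> 'p \<Rightarrow> 'p \<Rightarrow> 'p \<Rightarrow> real" where
  "gromov_prod d b x y = (d b x + d b y - d x y) / 2"

definition conv_to_infinity :: "'p set \<Rightarrow> ('p \<Rightarrow> 'p \<Rightarrow> real) \<Rightarrow> (nat \<Rightarrow> 'p) \<Rightarrow> bool" where
  "conv_to_infinity M d s \<longleftrightarrow>
     range s \<subseteq> M \<and>
     (\<forall>b\<in>M. filterlim (\<lambda>(i, j). gromov_prod d b (s i) (s j)) at_top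
              (sequentially \<times>\<^sub>F sequentially))"

definition bdry_rel :: "'p set \<Rightarrow> ('p \<Rightarrow> 'p \<Rightarrow> real) \<Rightarrow> ((nat \<Rightarrow> 'p) \<times> (nat \<Rightarrow> 'p)) set" where
  "bdry_rel M d = {(s, t). conv_to_infinity M d s \<and> conv_to_infinity M d t \<and>
     (\<forall>b\<in>M. filterlim (\<lambda>(i, j). gromov_prod d b (s i) (t j)) at_top
              (sequentially \<times>\<^sub>F sequentially))}"

definition hyp_boundary :: "'p set \<Rightarrow> ('p \<Rightarrow> 'p \<Rightarrow> real) \<Rightarrow> 'p bdry_point set" where
  "hyp_boundary M d = {s. conv_to_infinity M d s} // bdry_rel M d"

text \<open>
  The usual neighbourhood system: \<open>q\<close> is \<open>r\<close>-close to \<open>p\<close> as seen from the base point \<open>b\<close> if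
  \<open>liminf (s\<^sub>i | t\<^sub>j)\<^sub>b \<ge> r\<close> for some sequences \<open>s\<close> and \<open>t\<close> representing \<open>p\<close> and \<open>q\<close>.
\<close>

definition bdry_nbhd ::
  "'p set \<Rightarrow> ('p \<Rightarrow> 'p \<Rightarrow> real) \<Rightarrow> 'p \<Rightarrow> 'p bdry_point \<Rightarrow> real \<Rightarrow> 'p bdry_point set" where
  "bdry_nbhd M d b p r = {q \<in> hyp_boundary M d. \<exists>s\<in>p. \<exists>t\<in>q.
     ereal r \<le> Liminf (sequentially \<times>\<^sub>F sequentially)
                 (\<lambda>(i, j). ereal (gromov_prod d b (s i) (t j)))}"

definition bdry_open :: "'p set \<Rightarrow> ('p \<Rightarrow> 'p \<Rightarrow> real) \<Rightarrow> 'p bdry_point set \<Rightarrow> bool" where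
  "bdry_open M d V \<longleftrightarrow> V \<subseteq> hyp_boundary M d \<and>
     (\<forall>p\<in>V. \<forall>b\<in>M. \<exists>r. bdry_nbhd M d b p r \<subseteq> V)"

definition bdry_topology :: "'p set \<Rightarrow> ('p \<Rightarrow> 'p \<Rightarrow> real) \<Rightarrow> 'p bdry_point topology" where
  "bdry_topology M d = topology (bdry_open M d)"

lemma bdry_nbhd_antimono: "r \<le> r' \<Longrightarrow> bdry_nbhd M d b p r' \<subseteq> bdry_nbhd M d b p r"
  unfolding bdry_nbhd_def using order_trans[of "ereal r" "ereal r'"] by fastforce

lemma istopology_bdry_open: "istopology (bdry_open M d)"
  unfolding istopology_def
proof (intro conjI allI impI)
  fix S T assume S: "bdry_open M d S" and T: "bdry_open M d T"
  show "bdry_open M d (S \<inter> T)"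
    unfolding bdry_open_def
  proof (intro conjI ballI)
    show "S \<inter> T \<subseteq> hyp_boundary M d" using S by (auto simp: bdry_open_def)
    fix p b assume "p \<in> S \<inter> T" "b \<in> M"
    then obtain r r' where "bdry_nbhd M d b p r \<subseteq> S" "bdry_nbhd M d b p r' \<subseteq> T"
      using S T by (auto simp: bdry_open_def) meson
    then have "bdry_nbhd M d b p (max r r') \<subseteq> S \<inter> T"
      using bdry_nbhd_antimono[of r "max r r'" M d b p]
        bdry_nbhd_antimono[of r' "max r r'" M d b p] by auto
    then show "\<exists>r. bdry_nbhd M d b p r \<subseteq> S \<inter> T" by blast
  qed
next
  fix \<K> assume "\<forall>K\<in>\<K>. bdry_open M d K"
  then show "bdry_open M d (\<Union>\<K>)"
    unfolding bdry_open_def by (meson UnionE Union_least Union_upper subset_trans)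
qed

lemma openin_bdry_topology: "openin (bdry_topology M d) V \<longleftrightarrow> bdry_open M d V"
  by (simp add: bdry_topology_def istopology_bdry_open)


section \<open>Geodesic currents\<close>

definition free_bdry :: "('f, 'b) monoid_scheme \<Rightarrow> 'f set \<Rightarrow> 'f bdry_point topology" where
  "free_bdry F X = bdry_topology (carrier F) (word_dist F X)"

definition free_bdry2 ::
  "('f, 'b) monoid_scheme \<Rightarrow> 'f set \<Rightarrow> ('f bdry_point \<times> 'f bdry_point) topology" where
  "free_bdry2 F X =
     subtopology (prod_topology (free_bdry F X) (free_bdry F X)) {(p, q). p \<noteq> q}"

text \<open>
  Left translation by \<open>g\<close> maps the class of a sequence \<open>s\<close> to the class of \<open>\<lambda>i. g \<otimes> s i\<close>.
  Being an isometry, it maps classes bijectively onto classes.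
\<close>

definition bdry_translate :: "('f, 'b) monoid_scheme \<Rightarrow> 'f \<Rightarrow> 'f bdry_point \<Rightarrow> 'f bdry_point" where
  "bdry_translate F g p = (\<lambda>s i. g \<otimes>\<^bsub>F\<^esub> s i) ` p"

definition geodesic_currents ::
  "('f, 'b) monoid_scheme \<Rightarrow> 'f set \<Rightarrow> ('f bdry_point \<times> 'f bdry_point) measure set" where
  "geodesic_currents F X = {\<mu>.
     sets \<mu> = sets (sigma (topspace (free_bdry2 F X)) {U. openin (free_bdry2 F X) U}) \<and>
     (\<forall>g\<in>carrier F. \<forall>A\<in>sets \<mu>.
        emeasure \<mu> (map_prod (bdry_translate F g) (bdry_translate F g) ` A) = emeasure \<mu> A) \<and>
     (\<forall>K. compactin (free_bdry2 F X) K \<longrightarrow> emeasure \<mu> K < \<infinity>)}"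


section \<open>Actions on real trees\<close>

text \<open>
  An action of a group with elements of type \<open>'f\<close> on a metric space whose points have type \<open>'a\<close>.
  The functions \<open>tdist\<close> and \<open>act\<close> are meaningful only on \<open>pts\<close>;
  outside, \<open>tdist\<close> is arbitrary, and \<open>group_action\<close> makes \<open>act T g\<close> \<open>undefined\<close>.
\<close>

record ('f, 'a) tree_action =
  pts :: "'a set"
  tdist :: "'a \<Rightarrow> 'a \<Rightarrow> real"
  act :: "'f \<Rightarrow> 'a \<Rightarrow> 'a"

definition geodesic_space :: "'a set \<Rightarrow> ('a \<Rightarrow> 'a \<Rightarrow> real) \<Rightarrow> bool" where
  "geodesic_space M d \<longleftrightarrow> (\<forall>x\<in>M. \<forall>y\<in>M. \<exists>c. c 0 = x \<and> c (d x y) = y \<and> c ` {0..d x y} \<subseteq> M \<and>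
     (\<forall>s\<in>{0..d x y}. \<forall>t\<in>{0..d x y}. d (c s) (c t) = \<bar>s - t\<bar>))"

text \<open>Real trees as the geodesic metric spaces that are \<open>0\<close>-hyperbolic (four-point condition).\<close>

definition real_tree :: "'a set \<Rightarrow> ('a \<Rightarrow> 'a \<Rightarrow> real) \<Rightarrow> bool" where
  "real_tree M d \<longleftrightarrow> Metric_space M d \<and> M \<noteq> {} \<and> geodesic_space M d \<and>
     (\<forall>x\<in>M. \<forall>y\<in>M. \<forall>z\<in>M. \<forall>w\<in>M. d x y + d z w \<le> max (d x z + d y w) (d x w + d y z))"

definition subtree :: "'a set \<Rightarrow> ('a \<Rightarrow> 'a \<Rightarrow> real) \<Rightarrow> 'a set \<Rightarrow> bool" where
  "subtree M d S \<longleftrightarrow> S \<subseteq> M \<and> S \<noteq> {} \<and>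
     (\<forall>x\<in>S. \<forall>y\<in>S. \<forall>z\<in>M. d x z + d z y = d x y \<longrightarrow> z \<in> S)"

definition isometric_action :: "('f, 'b) monoid_scheme \<Rightarrow> ('f, 'a) tree_action \<Rightarrow> bool" where
  "isometric_action F T \<longleftrightarrow> group_action F (pts T) (act T) \<and>
     (\<forall>g\<in>carrier F. \<forall>x\<in>pts T. \<forall>y\<in>pts T. tdist T (act T g x) (act T g y) = tdist T x y)"

definition free_action :: "('f, 'b) monoid_scheme \<Rightarrow> ('f, 'a) tree_action \<Rightarrow> bool" where
  "free_action F T \<longleftrightarrow> (\<forall>g\<in>carrier F. \<forall>x\<in>pts T. act T g x = x \<longrightarrow> g = \<one>\<^bsub>F\<^esub>)"

definition discrete_action :: "('f, 'b) monoid_scheme \<Rightarrow> ('f, 'a) tree_action \<Rightarrow> bool" where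
  "discrete_action F T \<longleftrightarrow> (\<forall>x\<in>pts T.
     subtopology (Metric_space.mtopology (pts T) (tdist T)) (orbit F (act T) x) =
     discrete_topology (orbit F (act T) x))"

definition minimal_action :: "('f, 'b) monoid_scheme \<Rightarrow> ('f, 'a) tree_action \<Rightarrow> bool" where
  "minimal_action F T \<longleftrightarrow> (\<forall>S. subtree (pts T) (tdist T) S \<and>
     (\<forall>g\<in>carrier F. act T g ` S \<subseteq> S) \<longrightarrow> S = pts T)"

definition cv_trees :: "('f, 'b) monoid_scheme \<Rightarrow> ('f, 'a) tree_action set" where
  "cv_trees F = {T. real_tree (pts T) (tdist T) \<and> isometric_action F T \<and>
     free_action F T \<and> discrete_action F T \<and> minimal_action F T}"


section \<open>The space \<open>cv(F)\<close>\<close>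

definition tree_iso ::
  "('f, 'b) monoid_scheme \<Rightarrow> (('f, 'a) tree_action \<times> ('f, 'a) tree_action) set" where
  "tree_iso F = {(T, T'). T \<in> cv_trees F \<and> T' \<in> cv_trees F \<and>
     (\<exists>\<phi>. bij_betw \<phi> (pts T) (pts T') \<and>
        (\<forall>x\<in>pts T. \<forall>y\<in>pts T. tdist T' (\<phi> x) (\<phi> y) = tdist T x y) \<and>
        (\<forall>g\<in>carrier F. \<forall>x\<in>pts T. \<phi> (act T g x) = act T' g (\<phi> x)))}"

text \<open>
  The point type \<open>'a\<close> plays the role of the universe from which the trees are taken. Every
  minimal tree of a finitely generated group has at most continuum many points, so for \<open>'a\<close> of at
  least that cardinality (such as \<open>real\<close>) every equivariant isometry class is represented.
\<close>

definition cv :: "('f, 'b) monoid_scheme \<Rightarrow> ('f, 'a) tree_action set set" where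
  "cv F = cv_trees F // tree_iso F"

definition tree_class ::
  "('f, 'b) monoid_scheme \<Rightarrow> ('f, 'a) tree_action \<Rightarrow> ('f, 'a) tree_action set" where
  "tree_class F T = tree_iso F `` {T}"

text \<open>
  Basic open sets of the equivariant Gromov-Hausdorff topology: the trees containing an
  approximate copy, up to \<open>\<epsilon>\<close> and with respect to the elements of \<open>P\<close>, of the finite subset \<open>K\<close>
  of \<open>T\<close>.
\<close>

definition gh_nbhd ::
  "('f, 'b) monoid_scheme \<Rightarrow> ('f, 'a) tree_action \<Rightarrow> 'a set \<Rightarrow> 'f set \<Rightarrow> real
     \<Rightarrow> ('f, 'a) tree_action set set" where
  "gh_nbhd F T K P \<epsilon> = {C \<in> cv F. \<exists>T'\<in>C. \<exists>\<phi>\<in>K \<rightarrow> pts T'. \<forall>x\<in>K. \<forall>y\<in>K. \<forall>g\<in>P.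
     \<bar>tdist T' (\<phi> x) (act T' g (\<phi> y)) - tdist T x (act T g y)\<bar> < \<epsilon>}"

definition cv_topology :: "('f, 'b) monoid_scheme \<Rightarrow> ('f, 'a) tree_action set topology" where
  "cv_topology F = topology_generated_by {gh_nbhd F T K P \<epsilon> | T K P \<epsilon>.
     T \<in> cv_trees F \<and> finite K \<and> K \<subseteq> pts T \<and> finite P \<and> P \<subseteq> carrier F \<and> 0 < \<epsilon>}"


section \<open>Cylinders and geometric entropy\<close>

text \<open>
  The identification of the boundary of \<open>F\<close> with the boundary of \<open>T\<close> induced by the orbit maps
  \<open>g \<mapsto> g x\<close>.
\<close>

definition bdry_identification ::
  "('f, 'a) tree_action \<Rightarrow> 'f bdry_point \<Rightarrow> 'a bdry_point" where
  "bdry_identification T p =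
     bdry_rel (pts T) (tdist T) `` {(\<lambda>i. act T (s i) x) | s x. s \<in> p \<and> x \<in> pts T}"

definition geodesic_line ::
  "'a set \<Rightarrow> ('a \<Rightarrow> 'a \<Rightarrow> real) \<Rightarrow> (real \<Rightarrow> 'a) \<Rightarrow> 'a bdry_point \<Rightarrow> 'a bdry_point \<Rightarrow> bool" where
  "geodesic_line M d \<gamma> \<xi> \<eta> \<longleftrightarrow> range \<gamma> \<subseteq> M \<and> (\<forall>s t. d (\<gamma> s) (\<gamma> t) = \<bar>s - t\<bar>) \<and>
     (\<lambda>n. \<gamma> (- real n)) \<in> \<xi> \<and> (\<lambda>n. \<gamma> (real n)) \<in> \<eta>"

definition cyl ::
  "('f, 'b) monoid_scheme \<Rightarrow> 'f set \<Rightarrow> ('f, 'a) tree_action \<Rightarrow> 'a \<Rightarrow> 'a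
     \<Rightarrow> ('f bdry_point \<times> 'f bdry_point) set" where
  "cyl F X T x y = {(p, q) \<in> topspace (free_bdry2 F X). \<exists>\<gamma> s t.
     geodesic_line (pts T) (tdist T) \<gamma> (bdry_identification T p) (bdry_identification T q) \<and>
     s \<le> t \<and> \<gamma> s = x \<and> \<gamma> t = y}"

definition log_measure :: "ennreal \<Rightarrow> ereal" where
  "log_measure m =
     (if m = 0 then -\<infinity> else if m = \<infinity> then \<infinity> else ereal (ln (enn2real m)))"

definition far_pairs :: "('f, 'a) tree_action \<Rightarrow> ('a \<times> 'a) filter" where
  "far_pairs T = inf (filtercomap (\<lambda>(x, y). tdist T x y) at_top) (principal (pts T \<times> pts T))"

definition geometric_entropy ::
  "('f, 'b) monoid_scheme \<Rightarrow> 'f set \<Rightarrow> ('f bdry_point \<times> 'f bdry_point) measure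
     \<Rightarrow> ('f, 'a) tree_action \<Rightarrow> ereal" where
  "geometric_entropy F X \<mu> T = Liminf (far_pairs T)
     (\<lambda>(x, y). - log_measure (emeasure \<mu> (cyl F X T x y)) / ereal (tdist T x y))"

text \<open>
  The entropy as a real-valued function on \<open>cv(F)\<close>. That it does not depend on the representative
  and is finite for \<open>\<mu> \<noteq> 0\<close> has to be proved.
\<close>

definition entropy_map ::
  "('f, 'b) monoid_scheme \<Rightarrow> 'f set \<Rightarrow> ('f bdry_point \<times> 'f bdry_point) measure
     \<Rightarrow> ('f, 'a) tree_action set \<Rightarrow> real" where
  "entropy_map F X \<mu> C = real_of_ereal (geometric_entropy F X \<mu> (SOME T. T \<in> C))"

end

theory Submission
  imports Defs "HOL-Library.Sublist"
begin

text \<open>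
  A tree \<open>T\<close> in \<open>cv(F)\<close> with a base point \<open>b\<close> is seen through its orbit metric
  \<open>(g, h) \<mapsto> d\<^sub>T(g b, h b)\<close> on \<open>F\<close>, and two facts about orbit metrics give the theorem.

  The first fact (\<open>entropy_compare\<close>) compares entropies: if \<open>d\<^sub>T\<^sub>'(b', g b') \<le> \<kappa> d\<^sub>T(b, g b) + C\<close>
  for all \<open>g\<close>, then \<open>h\<^sub>T \<le> \<kappa> h\<^sub>T\<^sub>'\<close>. The orbit metrics of \<open>T\<close> and \<open>T'\<close> are both quasi-isometric to the
  word metric (\<open>ex_word_length_le_od\<close>, the lemma of Milnor and Svarc), and a quasi-isometry between
  trees distorts Gromov products by a bounded factor and a bounded summand
  (\<open>gromov_prod_quasi_isometry\<close>). A line of \<open>T'\<close> that contains \<open>[x', y']\<close>, with \<open>x'\<close> near \<open>u b'\<close> and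
  \<open>y'\<close> near \<open>v b'\<close>, therefore has the same end points as a line of \<open>T\<close> that contains \<open>[u b, v b]\<close> up to
  two ends of bounded length (\<open>line_iff_through\<close>, \<open>trimmed_cylinder\<close>). So each cylinder of \<open>T'\<close> lies in a
  single cylinder of \<open>T\<close>, whose length is at least the old length divided by \<open>\<kappa>\<close>, up to an additive
  constant; and additive constants do not influence the limit inferior.

  The second fact (\<open>nearby_orbit_metrics\<close>) is that every \<open>\<kappa> > 1\<close> works in both directions for all
  \<open>T'\<close> in a neighbourhood of \<open>T\<close>. Take steps of a large length \<open>\<sigma>\<close> along the geodesic from \<open>b\<close> to
  \<open>g b\<close> and pass from each point to a nearby orbit point. Only finitely many group elements occur as
  quotients of orbit points that are one or two steps apart. If \<open>T'\<close> moves its base point by these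
  elements as far as \<open>T\<close> does, up to an error of 1, then the triangle inequality bounds
  \<open>d\<^sub>T\<^sub>'(b', g b')\<close> from above. It also follows that the orbit points in \<open>T'\<close> form a local geodesic with
  long segments and bounded overlaps, so that \<open>d\<^sub>T\<^sub>'(b', g b')\<close> is bounded from below (\<open>long_chain\<close>).
  The relative errors are of order \<open>1 / \<sigma>\<close>.

  The entropy is a real number for the following reasons. Cylinders have bounded mass
  (\<open>ex_cyl_bound\<close>), since their translates lie in one compact set of pairs of boundary points, so the
  entropy is not negative. As \<open>\<mu> \<noteq> 0\<close>, some compact set has positive mass; it is covered by the
  cylinders that belong to exponentially many pairs of words of length \<open>R\<close>, so that one of these
  cylinders has at least an exponentially small mass (\<open>heavy_cylinders\<close>) and the entropy is finite.
\<close>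

section \<open>Zero-hyperbolic metrics\<close>

text \<open>
  The triangle inequality is the four-point condition with a repeated point. Distinct points may
  have distance 0, and the space may be discrete: instances are trees, word metrics of free groups
  and metrics that are pulled back along orbit maps.
\<close>
locale tree_metric =
  fixes M :: "'p set" and d :: "'p \<Rightarrow> 'p \<Rightarrow> real"
  assumes d_self: "x \<in> M \<Longrightarrow> d x x = 0"
    and d_commute: "x \<in> M \<Longrightarrow> y \<in> M \<Longrightarrow> d x y = d y x"
    and four_point: "x \<in> M \<Longrightarrow> y \<in> M \<Longrightarrow> z \<in> M \<Longrightarrow> w \<in> M \<Longrightarrow>
      d x y + d z w \<le> max (d x z + d y w) (d x w + d y z)"
begin

abbreviation "gp \<equiv> gromov_prod d"

lemma d_triangle: "x \<in> M \<Longrightarrow> y \<in> M \<Longrightarrow> z \<in> M \<Longrightarrow> d x z \<le> d x y + d y z"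
  using four_point[of x z y y] d_self[of y] d_commute[of y z] by simp

lemma d_nonneg: "x \<in> M \<Longrightarrow> y \<in> M \<Longrightarrow> 0 \<le> d x y"
  using d_triangle[of x y x] d_self[of x] d_commute[of x y] by simp

lemma gp_commute: "x \<in> M \<Longrightarrow> y \<in> M \<Longrightarrow> gp b x y = gp b y x"
  by (simp add: gromov_prod_def d_commute)

text \<open>
  The four-point condition as seen from the point \<open>b\<close>: if \<open>x\<close> and \<open>z\<close> have the direction of \<open>y\<close> up to
  some depth, then they have the same direction up to that depth.
\<close>
lemma gp_min:
  assumes "b \<in> M" "x \<in> M" "y \<in> M" "z \<in> M"
  shows "min (gp b x y) (gp b y z) \<le> gp b x z"
proof -
  have "d x z + d b y \<le> max (d x b + d z y) (d x y + d z b)"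
    using four_point[of x z b y] assms by blast
  then show ?thesis
    using d_commute assms unfolding gromov_prod_def by (simp add: min_def max_def split: if_splits)
qed

lemma gp_nonneg: "b \<in> M \<Longrightarrow> x \<in> M \<Longrightarrow> y \<in> M \<Longrightarrow> 0 \<le> gp b x y"
  using d_triangle[of x b y] d_commute[of x b] by (simp add: gromov_prod_def)

lemma gp_le: "b \<in> M \<Longrightarrow> x \<in> M \<Longrightarrow> y \<in> M \<Longrightarrow> gp b x y \<le> d b x"
  using d_triangle[of b x y] by (simp add: gromov_prod_def)

lemma gp_le': "b \<in> M \<Longrightarrow> x \<in> M \<Longrightarrow> y \<in> M \<Longrightarrow> gp b x y \<le> d b y"
  using gp_le[of b y x] gp_commute[of x y b] by simp

lemma gp_sum: "b \<in> M \<Longrightarrow> x \<in> M \<Longrightarrow> y \<in> M \<Longrightarrow> gp b x y + gp x b y = d b x"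
  using d_commute[of x b] by (simp add: gromov_prod_def field_simps)

lemma gp_self: "b \<in> M \<Longrightarrow> x \<in> M \<Longrightarrow> gp b x x = d b x"
  by (simp add: gromov_prod_def d_self)

lemma gp_base:
  assumes "b \<in> M" "c \<in> M" "x \<in> M" "y \<in> M"
  shows "gp b x y \<le> gp c x y + d b c"
  using d_triangle[of b c x] d_triangle[of b c y] assms by (simp add: gromov_prod_def field_simps)

lemma gp_move:
  assumes "b \<in> M" "x \<in> M" "x' \<in> M" "y \<in> M"
  shows "gp b x y \<le> gp b x' y + d x x'"
  using d_triangle[of b x' x] d_triangle[of x' x y] d_commute[of x x'] assms
  by (simp add: gromov_prod_def field_simps)

lemma between_gp: "x \<in> M \<Longrightarrow> y \<in> M \<Longrightarrow> z \<in> M \<Longrightarrow> d x z + d z y = d x y \<longleftrightarrow> gp z x y = 0"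
  using d_commute[of x z] by (simp add: gromov_prod_def)

text \<open>
  As seen from \<open>x\<close>, the points \<open>a\<close> and \<open>a'\<close> lie in the same direction, and \<open>b\<close> in a different one.
\<close>
lemma between_swap_end:
  assumes "a \<in> M" "a' \<in> M" "x \<in> M" "y \<in> M" "b \<in> M"
    and "d a x + d x y + d y b = d a b" and "0 < gp x a a'"
  shows "d a' x + d x y + d y b = d a' b"
proof -
  have 1: "d a x + d x b = d a b" "d x y + d y b = d x b"
    using assms d_triangle[of a x b] d_triangle[of x y b] by auto
  then have "gp x a b = 0" using between_gp assms by auto
  then have "gp x a' b \<le> 0" using gp_min[of x a a' b] assms by auto
  then have "gp x a' b = 0" using gp_nonneg[of x a' b] assms by auto
  then show ?thesis using 1 between_gp[of a' b x] assms by auto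
qed

lemma between_rev:
  assumes "a \<in> M" "x \<in> M" "y \<in> M" "b \<in> M"
    and "d a x + d x y + d y b = d a b"
  shows "d b y + d y x + d x a = d b a"
  using assms d_commute by (metis add.commute add.left_commute)

lemma between_swap_ends:
  assumes "a \<in> M" "a' \<in> M" "x \<in> M" "y \<in> M" "b \<in> M" "b' \<in> M"
    and "d a x + d x y + d y b = d a b" and "0 < gp x a a'" and "0 < gp y b b'"
  shows "d a' x + d x y + d y b' = d a' b'"
  using between_swap_end[of a a' x y b] between_rev[of a' x y b]
    between_swap_end[of b b' y x a'] between_rev[of b' y x a'] assms by auto

text \<open>
  Two segments that overlap in a segment of positive length form a longer segment. If \<open>x\<close> and \<open>y\<close>
  coincided, the path could turn back there.
\<close>
lemma between_chain:
  assumes "a \<in> M" "x \<in> M" "y \<in> M" "b \<in> M" "d a x + d x y = d a y" "d x y + d y b = d x b"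
    and "0 < d x y"
  shows "d a x + d x y + d y b = d a b"
  using four_point[of a y x b] assms d_triangle[of a x b] d_triangle[of x y b]
     d_triangle[of a y b] d_commute[of y x] by (smt (verit))

text \<open>
  The backtracking at \<open>y\<^sub>n\<close> is at most \<open>A\<close>, because a jump is longer than the backtracking at its two
  ends together: seen from \<open>y\<^sub>n\<close>, the whole earlier chain lies in the direction of \<open>y\<^sub>n\<^sub>-\<^sub>1\<close> for a
  distance greater than \<open>A\<close>. So local geodesics are global, with a loss of \<open>2 A\<close> per jump.
\<close>
lemma long_chain:
  fixes y :: "nat \<Rightarrow> 'p"
  assumes y: "\<And>i. i \<le> n \<Longrightarrow> y i \<in> M"
    and jump: "\<And>i. i < n \<Longrightarrow> B \<le> d (y i) (y (Suc i))"
    and overlap: "\<And>i. Suc i < n \<Longrightarrow> gp (y (Suc i)) (y i) (y (Suc (Suc i))) \<le> A"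
    and AB: "0 \<le> A" "2 * A < B"
  shows "real n * (B - 2 * A) \<le> d (y 0) (y n)"
proof -
  have *: "real m * (B - 2 * A) \<le> d (y 0) (y m) \<and>
      (Suc m \<le> n \<longrightarrow> gp (y m) (y 0) (y (Suc m)) \<le> A)" if "m \<le> n" for m
    using that
  proof (induction m)
    case 0
    show ?case using AB y gp_le[of "y 0" "y 0" "y (Suc 0)"] d_self by auto
  next
    case (Suc m)
    have IH: "real m * (B - 2 * A) \<le> d (y 0) (y m)" "gp (y m) (y 0) (y (Suc m)) \<le> A"
      using Suc by auto
    have J: "B \<le> d (y m) (y (Suc m))" and in_M: "y 0 \<in> M" "y m \<in> M" "y (Suc m) \<in> M"
      using jump Suc y by auto
    have "d (y 0) (y (Suc m)) \<ge> d (y 0) (y m) + d (y m) (y (Suc m)) - 2 * A"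
      using IH(2) in_M d_commute[of "y 0" "y m"] by (simp add: gromov_prod_def)
    then have 1: "real (Suc m) * (B - 2 * A) \<le> d (y 0) (y (Suc m))"
      using IH(1) J by (simp add: algebra_simps)
    have "gp (y (Suc m)) (y 0) (y (Suc (Suc m))) \<le> A" if "Suc (Suc m) \<le> n"
    proof -
      have "gp (y (Suc m)) (y m) (y 0) > A"
        using gp_sum[of "y m" "y (Suc m)" "y 0"] IH(2) J AB in_M
          gp_commute[of "y 0" "y (Suc m)" "y m"] by auto
      moreover have "gp (y (Suc m)) (y m) (y (Suc (Suc m))) \<le> A"
        using overlap that by auto
      ultimately show ?thesis
        using gp_min[of "y (Suc m)" "y m" "y 0" "y (Suc (Suc m))"] in_M y that by auto
    qed
    then show ?case using 1 by auto
  qed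
  then show ?thesis by auto
qed

lemma chain_upper:
  fixes y :: "nat \<Rightarrow> 'p"
  assumes y: "\<And>i. i \<le> n \<Longrightarrow> y i \<in> M"
    and jump: "\<And>i. i < n \<Longrightarrow> d (y i) (y (Suc i)) \<le> B"
  shows "d (y 0) (y n) \<le> real n * B"
  using assms
proof (induction n)
  case 0 then show ?case using d_self[of "y 0"] by auto
next
  case (Suc n)
  have "d (y 0) (y n) \<le> real n * B" "d (y n) (y (Suc n)) \<le> B" using Suc by auto
  moreover have "d (y 0) (y (Suc n)) \<le> d (y 0) (y n) + d (y n) (y (Suc n))"
    using d_triangle Suc.prems(1) by auto
  ultimately show ?case by (simp add: algebra_simps)
qed

text \<open>
  Seen from \<open>z\<close>, the chain starts at depth at least \<open>R\<close> in the direction of \<open>b\<close> and ends at a smaller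
  depth. In the jump that leaves the region of depth \<open>R\<close> it has to run back to the point of depth
  \<open>R\<close> on the way to \<open>b\<close>.
\<close>
lemma chain_crosses:
  fixes y :: "nat \<Rightarrow> 'p"
  assumes y: "\<And>i. i \<le> n \<Longrightarrow> y i \<in> M" and z: "z \<in> M" and b: "b \<in> M"
    and "gp z (y 0) b \<ge> R" "gp z (y n) b < R"
  shows "\<exists>i<n. gp z (y i) b \<ge> R \<and> gp z (y (Suc i)) b < R \<and> gp z (y i) (y (Suc i)) < R"
proof -
  have "\<exists>i<n. gp z (y i) b \<ge> R \<and> gp z (y (Suc i)) b < R"
    using assms(4,5)
  proof (induction n)
    case (Suc n)
    then show ?case by (cases "gp z (y n) b \<ge> R") (auto simp: less_Suc_eq)
  qed auto
  then obtain i where i: "i < n" "gp z (y i) b \<ge> R" "gp z (y (Suc i)) b < R" by auto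
  have "min (gp z (y (Suc i)) (y i)) (gp z (y i) b) \<le> gp z (y (Suc i)) b"
    by (intro gp_min) (use i y z b in auto)
  then have "gp z (y i) (y (Suc i)) < R"
    using i gp_commute[of "y i" "y (Suc i)" z] y by auto
  then show ?thesis using i by auto
qed

end

text \<open>
  Points at integer times with distances that are exact up to \<open>D\<close>. Unlike geodesics they also exist
  in word metrics (with \<open>D = 0\<close>) and in orbits.
\<close>
definition coarse_geodesic :: "'p set \<Rightarrow> ('p \<Rightarrow> 'p \<Rightarrow> real) \<Rightarrow> real \<Rightarrow> bool" where
  "coarse_geodesic M d D \<longleftrightarrow> 0 \<le> D \<and> (\<forall>a\<in>M. \<forall>b\<in>M. \<exists>n. \<exists>c. c 0 = a \<and> c n = b \<and> c ` {..n} \<subseteq> M \<and>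
     (\<forall>i\<le>n. \<forall>j\<le>n. \<bar>d (c i) (c j) - \<bar>real i - real j\<bar>\<bar> \<le> D))"

text \<open>
  Bounded cancellation. Let \<open>u\<close> be a point of a coarse geodesic for \<open>d1\<close> from \<open>a\<close> to \<open>b\<close>, and let
  \<open>R\<close> be its \<open>d2\<close>-Gromov product, that is, its distance from the \<open>d2\<close>-segment \<open>[a, b]\<close>. The part of
  the coarse geodesic before \<open>u\<close> and the part after \<open>u\<close> both have to pass the point at which \<open>u\<close>
  branches off that segment. The two passages are close for \<open>d2\<close>, hence for \<open>d1\<close>, hence in time, and
  \<open>u\<close> comes between them; this bounds \<open>R\<close>. For arbitrary \<open>c\<close> the \<open>d1\<close>-Gromov product measures the
  distance of \<open>c\<close> from a point of the coarse geodesic.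
\<close>
lemma gromov_prod_quasi_isometry:
  fixes M :: "'p set"
  assumes M1: "tree_metric M d1" and M2: "tree_metric M d2" and geo: "coarse_geodesic M d1 D"
    and le1: "\<And>x y. x \<in> M \<Longrightarrow> y \<in> M \<Longrightarrow> d2 x y \<le> K * d1 x y + K"
    and le2: "\<And>x y. x \<in> M \<Longrightarrow> y \<in> M \<Longrightarrow> d1 x y \<le> K * d2 x y + K"
  obtains A where "A > 0" "\<And>a b c. a \<in> M \<Longrightarrow> b \<in> M \<Longrightarrow> c \<in> M \<Longrightarrow>
    gromov_prod d2 c a b \<le> A * gromov_prod d1 c a b + A"
proof (cases "M = {}")
  case True
  then show ?thesis using that[of 1] by auto
next
  case False
  interpret m1: tree_metric M d1 by (fact M1)
  interpret m2: tree_metric M d2 by (fact M2)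
  have D: "0 \<le> D" using geo by (simp add: coarse_geodesic_def)
  have K: "K \<ge> 0"
    using False le1 m1.d_self m2.d_self by fastforce
  (* L bounds the jumps for d2, E the time between the two passages and C0 the distance from u to
     the first passage. *)
  define L where "L = K * (1 + D) + K"
  define E where "E = K * (2 * L) + K + D"
  define C0 where "C0 = K * (E + D) + K"
  have L: "L \<ge> 0" unfolding L_def using K D by auto
  have on_chain: "gromov_prod d2 (c k) a b \<le> C0"
    if c: "c 0 = a" "c n = b" "c ` {..n} \<subseteq> M"
      "\<forall>i\<le>n. \<forall>j\<le>n. \<bar>d1 (c i) (c j) - \<bar>real i - real j\<bar>\<bar> \<le> D" and k: "k \<le> n" for c n k and a b
  proof -
    define u where "u = c k"
    define R where "R = m2.gp u a b"
    have cM: "\<And>i. i \<le> n \<Longrightarrow> c i \<in> M" using c(3) by auto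
    have u: "u \<in> M" and a: "a \<in> M" and b: "b \<in> M" using cM k c by (auto simp: u_def)
    have step: "d2 (c i) (c (Suc i)) \<le> L" if "i < n" for i
    proof -
      have "d1 (c i) (c (Suc i)) \<le> 1 + D" using c(4)[rule_format, of i "Suc i"] that by auto
      then have "K * d1 (c i) (c (Suc i)) \<le> K * (1 + D)" using K mult_left_mono by blast
      then show ?thesis unfolding L_def using le1[of "c i" "c (Suc i)"] cM that by auto
    qed
    have C0: "C0 \<ge> 0" unfolding C0_def E_def using K L D by auto
    show ?thesis
    proof (cases "R > 0")
      case False
      then show ?thesis using C0 R_def u_def by auto
    next
      case True
      have self: "m2.gp u u w = 0" if "w \<in> M" for w
        using m2.gp_le[of u u w] m2.gp_nonneg[of u u w] u that m2.d_self by auto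
      have near: "d2 u (c i) \<le> R + L"
        if "i < n" "m2.gp u (c i) (c (Suc i)) < R" for i
      proof -
        have "d2 u (c i) - d2 (c i) (c (Suc i)) \<le> m2.gp u (c i) (c (Suc i))"
          using m2.d_triangle[of u "c (Suc i)" "c i"] m2.d_commute[of "c i" "c (Suc i)"] u cM that
          by (auto simp: gromov_prod_def field_simps)
        then show ?thesis using step[of i] that by auto
      qed
      have near': "d2 u (c (Suc i)) \<le> R + L"
        if "i < n" "m2.gp u (c i) (c (Suc i)) < R" for i
      proof -
        have "d2 u (c (Suc i)) - d2 (c i) (c (Suc i)) \<le> m2.gp u (c i) (c (Suc i))"
          using m2.d_triangle[of u "c i" "c (Suc i)"] m2.d_commute[of "c i" "c (Suc i)"] u cM that
          by (auto simp: gromov_prod_def field_simps)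
        then show ?thesis using step[of i] that by auto
      qed
      have "\<exists>i<k. m2.gp u (c i) b \<ge> R \<and> m2.gp u (c (Suc i)) b < R \<and> m2.gp u (c i) (c (Suc i)) < R"
        by (rule m2.chain_crosses) (use cM k u b c R_def True self in \<open>auto simp: u_def\<close>)
      then obtain i where i: "i < k" "m2.gp u (c i) b \<ge> R" "m2.gp u (c i) (c (Suc i)) < R" by auto
      have "\<exists>l<n - k. m2.gp u (c (n - l)) a \<ge> R \<and> m2.gp u (c (n - Suc l)) a < R
          \<and> m2.gp u (c (n - l)) (c (n - Suc l)) < R"
        by (rule m2.chain_crosses[of "n - k" "\<lambda>l. c (n - l)"])
           (use cM k u a b c R_def True self m2.gp_commute in \<open>auto simp: u_def\<close>)
      then obtain l where l: "l < n - k" "m2.gp u (c (n - l)) a \<ge> R"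
        "m2.gp u (c (n - l)) (c (n - Suc l)) < R" by auto
      define j where "j = n - l"
      have j: "k < j" "j \<le> n" "m2.gp u (c j) a \<ge> R" using l by (auto simp: j_def)
      have "m2.gp u (c (j - 1)) (c (Suc (j - 1))) < R"
        using l m2.gp_commute[of "c (n - l)" "c (n - Suc l)" u] cM by (auto simp: j_def Suc_diff_Suc)
      then have dj: "d2 u (c j) \<le> R + L" using near'[of "j - 1"] j by auto
      have di: "d2 u (c i) \<le> R + L" using near i k by auto
      have ij: "c i \<in> M" "c j \<in> M" using cM i j k by auto
      have "min (m2.gp u (c i) b) (m2.gp u b a) \<le> m2.gp u (c i) a"
        by (intro m2.gp_min) (use ij u a b in auto)
      then have "m2.gp u (c i) a \<ge> R"
        using i m2.gp_commute[of a b u] a b R_def by auto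
      moreover have "min (m2.gp u (c i) a) (m2.gp u a (c j)) \<le> m2.gp u (c i) (c j)"
        by (intro m2.gp_min) (use ij u a b in auto)
      ultimately have "m2.gp u (c i) (c j) \<ge> R" using j m2.gp_commute[of a "c j" u] a ij by auto
      then have "d2 (c i) (c j) \<le> 2 * L" using di dj by (simp add: gromov_prod_def)
      then have "K * d2 (c i) (c j) \<le> K * (2 * L)" using K mult_left_mono by blast
      moreover have "d1 (c i) (c j) \<ge> real j - real i - D"
        using c(4)[rule_format, of i j] i j k by auto
      ultimately have "real j - real i \<le> E" using le2[of "c i" "c j"] ij by (simp add: E_def)
      then have "real k - real i \<le> E" using j by auto
      then have "d1 u (c i) \<le> E + D" using c(4)[rule_format, of k i] i k by (auto simp: u_def)
      then have "K * d1 u (c i) \<le> K * (E + D)" using K mult_left_mono by blast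
      then have "d2 u (c i) \<le> C0" using le1[of u "c i"] u ij by (simp add: C0_def)
      then show ?thesis using i m2.gp_le[of u "c i" b] u b ij by (auto simp: R_def u_def)
    qed
  qed
  define A where "A = C0 + K * (2 + 3 * D) + K + 1"
  have C0: "C0 \<ge> 0" unfolding C0_def E_def using K L D by auto
  have "m2.gp c a b \<le> A * m1.gp c a b + A" if abc: "a \<in> M" "b \<in> M" "c \<in> M" for a b c
  proof -
    obtain n p where p: "p 0 = a" "p n = b" "p ` {..n} \<subseteq> M"
      "\<forall>i\<le>n. \<forall>j\<le>n. \<bar>d1 (p i) (p j) - \<bar>real i - real j\<bar>\<bar> \<le> D"
      using geo abc unfolding coarse_geodesic_def by blast
    (* The point of the chain that is closest to c is reached at the time t, which is rounded down to
       an index. *)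
    define t where "t = m1.gp a b c"
    have t: "0 \<le> t" "t \<le> d1 a b"
      using m1.gp_nonneg m1.gp_le abc by (auto simp: t_def)
    define k where "k = min n (nat \<lfloor>t\<rfloor>)"
    have kn: "k \<le> n" by (auto simp: k_def)
    have dab: "\<bar>d1 a b - real n\<bar> \<le> D" using p(4)[rule_format, of 0 n] p(1,2) by auto
    have kt: "\<bar>real k - t\<bar> \<le> 1 + D" using t dab D unfolding k_def by (auto simp: min_def) linarith+
    have pk: "p k \<in> M" using p(3) kn by auto
    have ak: "d1 a (p k) \<le> real k + D" using p(4)[rule_format, of 0 k] p(1) kn by auto
    have bk: "d1 b (p k) \<le> real n - real k + D" using p(4)[rule_format, of n k] p(2) kn by auto
    have "d1 c (p k) + d1 a b \<le> max (d1 c a + d1 (p k) b) (d1 c b + d1 (p k) a)"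
      by (intro m1.four_point) (use abc pk in auto)
    moreover have "d1 c a + (real n - real k + D) - d1 a b \<le> m1.gp c a b + 1 + 3 * D"
      using dab kt m1.gp_sum[of a c b] m1.gp_commute[of b c a] m1.gp_sum[of c a b] abc m1.d_commute[of c a] unfolding t_def by auto
    moreover have "d1 c b + (real k + D) - d1 a b = real k - t + D + m1.gp c a b"
      using abc m1.d_commute unfolding t_def by (simp add: gromov_prod_def field_simps)
    ultimately have "d1 c (p k) \<le> m1.gp c a b + (2 + 2 * D) + D"
      using ak bk kt m1.d_commute[of "p k" b] m1.d_commute[of "p k" a] abc pk D
      by (simp add: max_def split: if_splits)
    then have "d1 c (p k) \<le> m1.gp c a b + (2 + 3 * D)" by simp
    then have "K * d1 c (p k) \<le> K * (m1.gp c a b + (2 + 3 * D))" using K mult_left_mono by blast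
    then have 1: "d2 c (p k) \<le> K * m1.gp c a b + K * (2 + 3 * D) + K"
      using le1[of c "p k"] abc pk by (simp add: algebra_simps)
    have 2: "m2.gp c a b \<le> C0 + d2 c (p k)"
      using m2.gp_base[of c "p k" a b] on_chain[of p a n b k] p kn abc pk by auto
    have 3: "K * m1.gp c a b \<le> A * m1.gp c a b"
      using m1.gp_nonneg[of c a b] abc K D C0
      by (intro mult_right_mono) (auto simp: A_def algebra_simps)
    have 4: "A = C0 + K * (2 + 3 * D) + K + 1" by (simp add: A_def)
    show ?thesis using 1 2 3 4 by linarith
  qed
  moreover have "A > 0" using K D C0 by (auto simp: A_def intro!: add_nonneg_pos)
  ultimately show ?thesis using that by blast
qed

section \<open>The boundary of a zero-hyperbolic space\<close>

lemma filterlim_at_top_prod_sequentially: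
  fixes f :: "nat \<Rightarrow> nat \<Rightarrow> real"
  shows "filterlim (\<lambda>(i, j). f i j) at_top (sequentially \<times>\<^sub>F sequentially) \<longleftrightarrow>
    (\<forall>r. \<exists>N. \<forall>i\<ge>N. \<forall>j\<ge>N. r \<le> f i j)"
  unfolding filterlim_at_top eventually_prod_sequentially by (simp add: case_prod_unfold) blast

context tree_metric
begin

text \<open>
  Convergence to infinity, equivalence of sequences and closeness of boundary points all say that
  two sequences have a large Gromov product from some index on.
\<close>
definition agree :: "'p \<Rightarrow> real \<Rightarrow> (nat \<Rightarrow> 'p) \<Rightarrow> (nat \<Rightarrow> 'p) \<Rightarrow> bool" where
  "agree b r s t \<longleftrightarrow> (\<exists>N. \<forall>i\<ge>N. \<forall>j\<ge>N. r \<le> gp b (s i) (t j))"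

lemma agree_sym:
  assumes "\<forall>i. s i \<in> M" "\<forall>i. t i \<in> M" "agree b r s t"
  shows "agree b r t s"
proof -
  obtain N where "\<forall>i\<ge>N. \<forall>j\<ge>N. r \<le> gp b (s i) (t j)" using assms(3) by (auto simp: agree_def)
  moreover have "gp b (t i) (s j) = gp b (s j) (t i)" for i j
    using gp_commute[of "t i" "s j" b] assms by auto
  ultimately show ?thesis by (auto simp: agree_def)
qed

lemma agree_mono: "agree b r s t \<Longrightarrow> r' \<le> r \<Longrightarrow> agree b r' s t"
  unfolding agree_def by (meson order_trans)

lemma agree_trans:
  assumes "b \<in> M" "\<forall>i. s i \<in> M" "\<forall>i. t i \<in> M" "\<forall>i. u i \<in> M" "agree b r s t" "agree b r t u"
  shows "agree b r s u"
proof -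
  obtain N N' where N: "\<And>i j. i \<ge> N \<Longrightarrow> j \<ge> N \<Longrightarrow> r \<le> gp b (s i) (t j)"
    "\<And>i j. i \<ge> N' \<Longrightarrow> j \<ge> N' \<Longrightarrow> r \<le> gp b (t i) (u j)"
    using assms(5,6) unfolding agree_def by meson
  have "r \<le> gp b (s i) (u j)" if "i \<ge> max N N'" "j \<ge> max N N'" for i j
    using gp_min[of b "s i" "t (max N N')" "u j"] N(1)[of i "max N N'"] N(2)[of "max N N'" j]
      that assms(1-4) by auto
  then show ?thesis unfolding agree_def by blast
qed

lemma agree_base:
  assumes "b \<in> M" "c \<in> M" "\<forall>i. s i \<in> M" "\<forall>i. t i \<in> M" "agree b r s t"
  shows "agree c (r - d b c) s t"
proof -
  have "gp b (s i) (t j) \<le> gp c (s i) (t j) + d b c" for i j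
    using gp_base[of b c "s i" "t j"] assms by auto
  moreover obtain N where "\<And>i j. i \<ge> N \<Longrightarrow> j \<ge> N \<Longrightarrow> r \<le> gp b (s i) (t j)"
    using assms(5) unfolding agree_def by meson
  ultimately have "\<forall>i\<ge>N. \<forall>j\<ge>N. r - d b c \<le> gp c (s i) (t j)"
    by (smt (verit))
  then show ?thesis unfolding agree_def by blast
qed

lemma conv_iff:
  assumes "b \<in> M"
  shows "conv_to_infinity M d s \<longleftrightarrow> (\<forall>i. s i \<in> M) \<and> (\<forall>r. agree b r s s)"
proof -
  have "agree c r s s" if "\<forall>i. s i \<in> M" "\<forall>r. agree b r s s" "c \<in> M" for c r
    using agree_base[OF assms that(3) that(1) that(1), of "r + d b c"] that(2) by simp
  then show ?thesis
    unfolding conv_to_infinity_def filterlim_at_top_prod_sequentially agree_def[symmetric]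
      image_subset_iff using assms by blast
qed

lemma bdry_rel_iff:
  assumes "b \<in> M"
  shows "(s, t) \<in> bdry_rel M d \<longleftrightarrow>
    conv_to_infinity M d s \<and> conv_to_infinity M d t \<and> (\<forall>r. agree b r s t)"
proof -
  have "agree c r s t" if "conv_to_infinity M d s" "conv_to_infinity M d t" "\<forall>r. agree b r s t" "c \<in> M" for c r
    using agree_base[of b c s t "r + d b c"] that assms unfolding conv_to_infinity_def image_subset_iff by simp
  then show ?thesis
    unfolding bdry_rel_def filterlim_at_top_prod_sequentially agree_def[symmetric] mem_Collect_eq prod.case
    using assms by meson
qed

lemma conv_range: "conv_to_infinity M d s \<Longrightarrow> s i \<in> M"
  by (auto simp: conv_to_infinity_def)

lemma conv_sub: "conv_to_infinity M d s \<Longrightarrow> \<forall>i. s i \<in> M"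
  by (auto simp: conv_to_infinity_def)

lemma conv_agree: "conv_to_infinity M d s \<Longrightarrow> b \<in> M \<Longrightarrow> agree b r s s"
  using conv_iff by blast

lemma equiv_bdry_rel: "equiv {s. conv_to_infinity M d s} (bdry_rel M d)"
proof (cases "M = {}")
  case True
  then have "\<not> conv_to_infinity M d s" for s by (auto simp: conv_to_infinity_def)
  then show ?thesis by (auto simp: bdry_rel_def equiv_def refl_on_def sym_def trans_def)
next
  case False
  then obtain b where b: "b \<in> M" by auto
  show ?thesis
  proof (rule equivI)
    show "bdry_rel M d \<subseteq> {s. conv_to_infinity M d s} \<times> {s. conv_to_infinity M d s}"
      by (auto simp: bdry_rel_def)
    show "refl_on {s. conv_to_infinity M d s} (bdry_rel M d)"
      using conv_iff[OF b] by (simp add: refl_on_def bdry_rel_iff[OF b])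
    show "sym (bdry_rel M d)"
      unfolding sym_def bdry_rel_iff[OF b] by (meson agree_sym conv_sub)
    show "trans (bdry_rel M d)"
      unfolding trans_def bdry_rel_iff[OF b] by (meson agree_trans[OF b] conv_sub)
  qed
qed

lemma bdry_conv: "p \<in> hyp_boundary M d \<Longrightarrow> s \<in> p \<Longrightarrow> conv_to_infinity M d s"
  unfolding hyp_boundary_def using equiv_bdry_rel in_quotient_imp_subset by blast

lemma bdry_range: "p \<in> hyp_boundary M d \<Longrightarrow> s \<in> p \<Longrightarrow> s i \<in> M"
  using bdry_conv conv_range by blast

lemma bdry_sub: "p \<in> hyp_boundary M d \<Longrightarrow> s \<in> p \<Longrightarrow> \<forall>i. s i \<in> M"
  using bdry_conv conv_sub by blast

lemma bdry_nonempty: "p \<in> hyp_boundary M d \<Longrightarrow> \<exists>s. s \<in> p"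
  unfolding hyp_boundary_def using equiv_bdry_rel in_quotient_imp_non_empty by blast

lemma bdry_agree:
  assumes "p \<in> hyp_boundary M d" "s \<in> p" "t \<in> p" "b \<in> M"
  shows "agree b r s t"
proof -
  have "(s, t) \<in> bdry_rel M d"
    using assms in_quotient_imp_in_rel[OF equiv_bdry_rel] unfolding hyp_boundary_def by blast
  then show ?thesis using bdry_rel_iff[OF assms(4)] by blast
qed

lemma bdry_mem:
  assumes "p \<in> hyp_boundary M d" "s \<in> p" "(s, t) \<in> bdry_rel M d"
  shows "t \<in> p"
  using assms in_quotient_imp_closed[OF equiv_bdry_rel] unfolding hyp_boundary_def by blast

lemma bdry_eq:
  assumes "p \<in> hyp_boundary M d" "q \<in> hyp_boundary M d" "s \<in> p" "t \<in> q" "b \<in> M" "\<And>r. agree b r s t"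
  shows "p = q"
proof -
  have "(s, t) \<in> bdry_rel M d"
    unfolding bdry_rel_iff[OF assms(5)] using assms bdry_conv by blast
  then have "t \<in> p" using bdry_mem assms by blast
  then show ?thesis using quotient_disj[OF equiv_bdry_rel, of p q] assms unfolding hyp_boundary_def by blast
qed

lemma bdry_class: "conv_to_infinity M d s \<Longrightarrow> bdry_rel M d `` {s} \<in> hyp_boundary M d \<and> s \<in> bdry_rel M d `` {s}"
  unfolding hyp_boundary_def using equiv_bdry_rel
  by (metis equiv_class_self mem_Collect_eq quotientI)

lemma bdry_class_eq:
  assumes "p \<in> hyp_boundary M d" "s \<in> p"
  shows "p = bdry_rel M d `` {s}"
proof -
  have "p \<inter> bdry_rel M d `` {s} \<noteq> {}" using bdry_class bdry_conv assms by blast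
  moreover have "bdry_rel M d `` {s} \<in> hyp_boundary M d" using bdry_class bdry_conv assms by blast
  ultimately show ?thesis
    using quotient_disj[OF equiv_bdry_rel, of p "bdry_rel M d `` {s}"] assms(1)
    unfolding hyp_boundary_def by auto
qed

text \<open>
  By the three-point inequality, a single late pair of terms with Gromov product at least \<open>r\<close> would
  force all late pairs to have one.
\<close>
lemma not_agree:
  assumes "b \<in> M" "p \<in> hyp_boundary M d" "q \<in> hyp_boundary M d" "s \<in> p" "t \<in> q" "\<not> agree b r s t"
  shows "\<exists>N. \<forall>i\<ge>N. \<forall>j\<ge>N. gp b (s i) (t j) < r"
proof -
  obtain N N' where N: "\<forall>i\<ge>N. \<forall>j\<ge>N. r \<le> gp b (s i) (s j)" "\<forall>i\<ge>N'. \<forall>j\<ge>N'. r \<le> gp b (t i) (t j)"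
    using bdry_agree[OF assms(2,4,4,1), of r] bdry_agree[OF assms(3,5,5,1), of r] unfolding agree_def by meson
  define K where "K = max N N'"
  have "gp b (s i) (t j) < r" if "i \<ge> K" "j \<ge> K" for i j
  proof (rule ccontr)
    assume "\<not> gp b (s i) (t j) < r"
    then have 1: "r \<le> gp b (s i) (t j)" by simp
    have "r \<le> gp b (s i') (t j')" if "i' \<ge> K" "j' \<ge> K" for i' j'
    proof -
      have M: "b \<in> M" "s i \<in> M" "s i' \<in> M" "t j \<in> M" "t j' \<in> M" using assms bdry_range by auto
      have "r \<le> gp b (s i') (s i)" "r \<le> gp b (t j) (t j')"
        using N that \<open>i \<ge> K\<close> \<open>j \<ge> K\<close> by (auto simp: K_def)
      then show ?thesis
        using gp_min[of b "s i'" "s i" "t j"] gp_min[of b "s i'" "t j" "t j'"] 1 M by auto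
    qed
    then show False using assms(6) unfolding agree_def by blast
  qed
  then show ?thesis by blast
qed

text \<open>
  Representatives of the same boundary point agree to every depth, so that any choice of
  representatives decides whether one boundary point is close to another.
\<close>
lemma bdry_nbhd_iff:
  assumes "b \<in> M" "p \<in> hyp_boundary M d" "q \<in> hyp_boundary M d" "s \<in> p" "t \<in> q"
  shows "q \<in> bdry_nbhd M d b p r \<longleftrightarrow> (\<forall>r'<r. agree b r' s t)"
proof -
  have liminf: "ereal r \<le> Liminf (sequentially \<times>\<^sub>F sequentially) (\<lambda>(i, j). ereal (gp b (u i) (v j)))
    \<longleftrightarrow> (\<forall>r'<r. agree b r' u v)" (is "?L = ?R") for u v
  proof
    assume L: ?L
    show ?R
    proof (intro allI impI)
      fix r' assume "r' < r"
      then have "\<forall>\<^sub>F x in sequentially \<times>\<^sub>F sequentially. ereal r' < (\<lambda>(i, j). ereal (gp b (u i) (v j))) x"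
        using L unfolding le_Liminf_iff by auto
      then show "agree b r' u v"
        unfolding eventually_prod_sequentially agree_def by (auto intro: less_imp_le)
    qed
  next
    assume R: ?R
    show ?L
      unfolding le_Liminf_iff
    proof (intro allI impI)
      fix y assume y: "y < ereal r"
      obtain r' where r': "y < ereal r'" "r' < r" using y ereal_dense2[OF y] by auto
      then obtain N where N: "\<forall>i\<ge>N. \<forall>j\<ge>N. r' \<le> gp b (u i) (v j)"
        using R unfolding agree_def by blast
      have "y < ereal (gp b (u i) (v j))" if "i \<ge> N" "j \<ge> N" for i j
        using N that r' by (meson ereal_less_eq(3) less_le_trans)
      then show "\<forall>\<^sub>F x in sequentially \<times>\<^sub>F sequentially. y < (\<lambda>(i, j). ereal (gp b (u i) (v j))) x"
        unfolding eventually_prod_sequentially by auto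
    qed
  qed
  have "\<forall>r'<r. agree b r' s t" if st': "s' \<in> p" "t' \<in> q" "\<forall>r'<r. agree b r' s' t'" for s' t'
  proof (intro allI impI)
    fix r' assume "r' < r"
    have 1: "agree b r' s s'" "agree b r' t' t" "agree b r' s' t'"
      using st' assms bdry_agree[of p s s' b r'] bdry_agree[of q t' t b r'] \<open>r' < r\<close> by blast+
    have 2: "\<forall>i. s i \<in> M" "\<forall>i. s' i \<in> M" "\<forall>i. t i \<in> M" "\<forall>i. t' i \<in> M"
      using bdry_sub assms st' by blast+
    show "agree b r' s t"
      using agree_trans[OF assms(1) 2(1,2,4) 1(1,3)] agree_trans[OF assms(1) 2(1,4,3) _ 1(2)] by blast
  qed
  then show ?thesis unfolding bdry_nbhd_def liminf using assms by blast
qed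

lemma bdry_nbhd_sub: "bdry_nbhd M d b p r \<subseteq> hyp_boundary M d"
  by (auto simp: bdry_nbhd_def)

lemma bdry_nbhd_self: "b \<in> M \<Longrightarrow> p \<in> hyp_boundary M d \<Longrightarrow> p \<in> bdry_nbhd M d b p r"
  using bdry_nbhd_iff[of b p p] bdry_nonempty bdry_agree by blast

text \<open>
  As in an ultrametric space, every point of a neighbourhood is a centre of it; a change of the base
  point costs at most its distance. This makes the basic neighbourhoods open.
\<close>
lemma bdry_nbhd_nested:
  assumes "b \<in> M" "c \<in> M" "p \<in> hyp_boundary M d" "q \<in> bdry_nbhd M d b p r"
  shows "bdry_nbhd M d c q (r + d b c) \<subseteq> bdry_nbhd M d b p r"
proof
  fix q' assume q': "q' \<in> bdry_nbhd M d c q (r + d b c)"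
  have q: "q \<in> hyp_boundary M d" "q' \<in> hyp_boundary M d" using assms q' bdry_nbhd_sub by auto
  obtain s t u where stu: "s \<in> p" "t \<in> q" "u \<in> q'"
    using bdry_nonempty[OF assms(3)] bdry_nonempty[OF q(1)] bdry_nonempty[OF q(2)] by blast
  have 1: "\<forall>r'<r. agree b r' s t"
    using bdry_nbhd_iff[OF assms(1,3) q(1) stu(1,2)] assms(4) by blast
  have 2: "\<forall>r'<r + d b c. agree c r' t u"
    using bdry_nbhd_iff[OF assms(2) q(1,2) stu(2,3)] q' by blast
  have sub: "\<forall>i. s i \<in> M" "\<forall>i. t i \<in> M" "\<forall>i. u i \<in> M"
    using bdry_sub assms q stu by blast+
  have "agree b r' s u" if "r' < r" for r'
  proof -
    have "agree c (r' + d b c) t u" using 2 that by auto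
    then have "agree b r' t u"
      using agree_base[OF assms(2,1) sub(2,3), of "r' + d b c"] d_commute[OF assms(1,2)] by simp
    then show ?thesis using agree_trans[OF assms(1) sub, of r'] 1 that by blast
  qed
  then show "q' \<in> bdry_nbhd M d b p r" using bdry_nbhd_iff[OF assms(1,3) q(2) stu(1,3)] by blast
qed

lemma topspace_bdry [simp]: "topspace (bdry_topology M d) = hyp_boundary M d"
proof -
  have "bdry_open M d (hyp_boundary M d)"
    unfolding bdry_open_def using bdry_nbhd_sub by blast
  then show ?thesis unfolding topspace_def openin_bdry_topology
    by (auto simp: bdry_open_def)
qed

lemma openin_bdry_nbhd:
  assumes "b \<in> M" "p \<in> hyp_boundary M d"
  shows "openin (bdry_topology M d) (bdry_nbhd M d b p r)"
  unfolding openin_bdry_topology bdry_open_def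
  using bdry_nbhd_sub bdry_nbhd_nested[OF assms(1) _ assms(2)] by blast

text \<open>
  The pairs of boundary points that separate before depth \<open>r\<close> as seen from \<open>b\<close>, written as the
  complement of a union of open squares.
\<close>
definition apart :: "'p \<Rightarrow> real \<Rightarrow> ('p bdry_point \<times> 'p bdry_point) set" where
  "apart b r = hyp_boundary M d \<times> hyp_boundary M d -
     (\<Union>p\<in>hyp_boundary M d. bdry_nbhd M d b p r \<times> bdry_nbhd M d b p r)"

lemma apart_iff:
  assumes "b \<in> M" "p \<in> hyp_boundary M d" "q \<in> hyp_boundary M d" "s \<in> p" "t \<in> q"
  shows "(p, q) \<in> apart b r \<longleftrightarrow> \<not> (\<forall>r'<r. agree b r' s t)"
proof
  assume "(p, q) \<in> apart b r"
  then have "\<not> (p \<in> bdry_nbhd M d b p r \<and> q \<in> bdry_nbhd M d b p r)"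
    using assms unfolding apart_def by blast
  then show "\<not> (\<forall>r'<r. agree b r' s t)"
    using bdry_nbhd_iff[of b p q s t r] bdry_nbhd_self assms by blast
next
  assume n: "\<not> (\<forall>r'<r. agree b r' s t)"
  have False if c: "c \<in> hyp_boundary M d" "p \<in> bdry_nbhd M d b c r" "q \<in> bdry_nbhd M d b c r" for c
  proof -
    obtain u where u: "u \<in> c" using bdry_nonempty[OF c(1)] by blast
    have 1: "\<forall>r'<r. agree b r' u s"
      using bdry_nbhd_iff[OF assms(1) c(1) assms(2) u assms(4)] c(2) by blast
    have 2: "\<forall>r'<r. agree b r' u t"
      using bdry_nbhd_iff[OF assms(1) c(1) assms(3) u assms(5)] c(3) by blast
    have sub: "\<forall>i. s i \<in> M" "\<forall>i. u i \<in> M" "\<forall>i. t i \<in> M"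
      using bdry_sub assms c u by blast+
    have "agree b r' s t" if "r' < r" for r'
      using agree_trans[OF assms(1) sub, of r'] agree_sym[OF sub(2,1)] 1 2 that by blast
    then show False using n by blast
  qed
  then show "(p, q) \<in> apart b r" unfolding apart_def using assms by blast
qed

lemma apart_distinct:
  assumes "b \<in> M" "(p, q) \<in> apart b r"
  shows "p \<noteq> q"
proof
  assume "p = q"
  have p: "p \<in> hyp_boundary M d" using assms(2) unfolding apart_def by blast
  obtain s where s: "s \<in> p" using bdry_nonempty[OF p] by blast
  then have "\<forall>r'<r. agree b r' s s" using bdry_agree[OF p s s assms(1)] by blast
  then show False using apart_iff[OF assms(1) p p s s] assms(2) \<open>p = q\<close> by blast
qed

lemma closedin_apart:
  assumes "b \<in> M"
  shows "closedin (prod_topology (bdry_topology M d) (bdry_topology M d)) (apart b r)"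
  unfolding apart_def
proof (rule closedin_diff)
  show "closedin (prod_topology (bdry_topology M d) (bdry_topology M d)) (hyp_boundary M d \<times> hyp_boundary M d)"
    using closedin_topspace[of "prod_topology (bdry_topology M d) (bdry_topology M d)"] by simp
  show "openin (prod_topology (bdry_topology M d) (bdry_topology M d))
      (\<Union>p\<in>hyp_boundary M d. bdry_nbhd M d b p r \<times> bdry_nbhd M d b p r)"
  proof (rule openin_Union)
    fix U assume "U \<in> (\<lambda>p. bdry_nbhd M d b p r \<times> bdry_nbhd M d b p r) ` hyp_boundary M d"
    then obtain p where "p \<in> hyp_boundary M d" "U = bdry_nbhd M d b p r \<times> bdry_nbhd M d b p r" by blast
    then show "openin (prod_topology (bdry_topology M d) (bdry_topology M d)) U"
      using openin_bdry_nbhd[OF assms] by (simp add: openin_prod_Times_iff)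
  qed
qed

text \<open>
  From some index on, the segments \<open>[s\<^sub>i, t\<^sub>j]\<close> contain \<open>[x, y]\<close> with agreeing orientation.
\<close>
definition through :: "'p \<Rightarrow> 'p \<Rightarrow> (nat \<Rightarrow> 'p) \<Rightarrow> (nat \<Rightarrow> 'p) \<Rightarrow> bool" where
  "through x y s t \<longleftrightarrow> (\<exists>N. \<forall>i\<ge>N. \<forall>j\<ge>N. d (s i) x + d x y + d y (t j) = d (s i) (t j))"

lemma through_agree:
  assumes "x \<in> M" "y \<in> M" "\<forall>i. s i \<in> M" "\<forall>i. t i \<in> M" "\<forall>i. s' i \<in> M" "\<forall>i. t' i \<in> M"
    and "through x y s t" "agree x r s s'" "agree y r t t'" "0 < r"
  shows "through x y s' t'"
proof -
  obtain N where N: "\<And>i j. i \<ge> N \<Longrightarrow> j \<ge> N \<Longrightarrow> d (s i) x + d x y + d y (t j) = d (s i) (t j)"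
    using assms(7) unfolding through_def by meson
  obtain N1 where N1: "\<And>i j. i \<ge> N1 \<Longrightarrow> j \<ge> N1 \<Longrightarrow> r \<le> gp x (s i) (s' j)"
    using assms(8) unfolding agree_def by meson
  obtain N2 where N2: "\<And>i j. i \<ge> N2 \<Longrightarrow> j \<ge> N2 \<Longrightarrow> r \<le> gp y (t i) (t' j)"
    using assms(9) unfolding agree_def by meson
  define K where "K = max N (max N1 N2)"
  have "d (s' i) x + d x y + d y (t' j) = d (s' i) (t' j)" if "i \<ge> K" "j \<ge> K" for i j
  proof (rule between_swap_ends)
    show "d (s K) x + d x y + d y (t K) = d (s K) (t K)" by (rule N) (auto simp: K_def)
    show "0 < gp x (s K) (s' i)" "0 < gp y (t K) (t' j)"
      using N1[of K i] N2[of K j] assms(10) that unfolding K_def by linarith+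
  qed (use assms in blast)+
  then show ?thesis unfolding through_def by blast
qed

end

locale R_tree =
  fixes M :: "'p set" and d :: "'p \<Rightarrow> 'p \<Rightarrow> real"
  assumes real_tree: "real_tree M d"

sublocale R_tree \<subseteq> tree_metric M d
proof
  interpret Metric_space M d using real_tree by (simp add: real_tree_def)
  show "d x x = 0" if "x \<in> M" for x using that by simp
  show "d x y = d y x" for x y by (rule commute)
  show "d x y + d z w \<le> max (d x z + d y w) (d x w + d y z)"
    if "x \<in> M" "y \<in> M" "z \<in> M" "w \<in> M" for x y z w
    using real_tree that by (simp add: real_tree_def)
qed

context R_tree
begin

lemma d_eq_0: "x \<in> M \<Longrightarrow> y \<in> M \<Longrightarrow> d x y = 0 \<Longrightarrow> x = y"
  using real_tree Metric_space.zero unfolding real_tree_def by metis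

lemma geodesic:
  assumes "x \<in> M" "y \<in> M"
  shows "\<exists>c. c 0 = x \<and> c (d x y) = y \<and> c ` {0..d x y} \<subseteq> M \<and>
     (\<forall>s\<in>{0..d x y}. \<forall>t\<in>{0..d x y}. d (c s) (c t) = \<bar>s - t\<bar>)"
  using real_tree assms unfolding real_tree_def geodesic_space_def by meson

lemma point_on_segment:
  assumes "x \<in> M" "y \<in> M" "0 \<le> r" "r \<le> d x y"
  obtains z where "z \<in> M" "d x z = r" "d z y = d x y - r"
proof -
  from geodesic[OF assms(1,2)] obtain c where c': "c 0 = x \<and> c (d x y) = y \<and> c ` {0..d x y} \<subseteq> M \<and>
     (\<forall>s\<in>{0..d x y}. \<forall>t\<in>{0..d x y}. d (c s) (c t) = \<bar>s - t\<bar>)" by (rule exE)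
  note c = c'[THEN conjunct1] c'[THEN conjunct2, THEN conjunct1]
    c'[THEN conjunct2, THEN conjunct2, THEN conjunct1] c'[THEN conjunct2, THEN conjunct2, THEN conjunct2]
  have "c r \<in> M" using c(3) assms(3,4) by (simp add: image_subset_iff)
  moreover have "d (c 0) (c r) = r" "d (c r) (c (d x y)) = d x y - r"
    using c(4)[rule_format, of 0 r] c(4)[rule_format, of r "d x y"] assms(3,4) by simp_all
  ultimately show ?thesis using that[of "c r"] unfolding c(1,2) by blast
qed

text \<open>
  The point at distance \<open>r\<close> from \<open>x\<close> on the segments \<open>[x, a\<^sub>i]\<close> with large \<open>i\<close>.
\<close>
definition on_ray :: "'p \<Rightarrow> (nat \<Rightarrow> 'p) \<Rightarrow> real \<Rightarrow> 'p \<Rightarrow> bool" where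
  "on_ray x a r z \<longleftrightarrow> z \<in> M \<and> d x z = r \<and> (\<exists>N. \<forall>i\<ge>N. gp x z (a i) = r)"

lemma gp_eq_between: "x \<in> M \<Longrightarrow> z \<in> M \<Longrightarrow> y \<in> M \<Longrightarrow> gp x z y = d x z \<longleftrightarrow> d x z + d z y = d x y"
  by (auto simp: gromov_prod_def)

text \<open>
  The segments \<open>[x, a\<^sub>i]\<close> and \<open>[x, a\<^sub>j]\<close> have an initial part of length \<open>(a\<^sub>i | a\<^sub>j)\<^sub>x\<close> in common, so
  that their initial parts of length \<open>r\<close> do not change any more for large indices.
\<close>
lemma on_ray_exists:
  assumes "x \<in> M" "conv_to_infinity M d a" "0 \<le> r"
  shows "\<exists>z. on_ray x a r z"
proof -
  obtain N where N: "\<And>i j. i \<ge> N \<Longrightarrow> j \<ge> N \<Longrightarrow> r \<le> gp x (a i) (a j)"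
    using conv_agree[OF assms(2,1), of r] unfolding agree_def by meson
  have aM: "a i \<in> M" for i using assms conv_range by auto
  have "r \<le> d x (a N)" using N[of N N] gp_le[of x "a N" "a N"] assms aM by auto
  then obtain z where z: "z \<in> M" "d x z = r" "d z (a N) = d x (a N) - r"
    using point_on_segment assms aM by blast
  have "gp x z (a i) = r" if "i \<ge> N" for i
  proof -
    have "gp x z (a N) = r" using z by (simp add: gromov_prod_def)
    then have "gp x z (a i) \<ge> r" using gp_min[of x z "a N" "a i"] N[of N i] that assms aM z by auto
    moreover have "gp x z (a i) \<le> r" using gp_le[of x z "a i"] z assms aM by auto
    ultimately show ?thesis by simp
  qed
  then show ?thesis using z unfolding on_ray_def by blast
qed

lemma on_ray_dist:
  assumes "x \<in> M" "\<forall>i. a i \<in> M" "on_ray x a r z" "on_ray x a r' z'"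
  shows "gp x z z' = min r r'" "d z z' = \<bar>r - r'\<bar>"
proof -
  have z: "z \<in> M" "z' \<in> M" "d x z = r" "d x z' = r'" using assms unfolding on_ray_def by auto
  obtain N N' where "\<forall>i\<ge>N. gp x z (a i) = r" "\<forall>i\<ge>N'. gp x z' (a i) = r'"
    using assms(3,4) unfolding on_ray_def by meson
  then have i: "gp x z (a (max N N')) = r" "gp x z' (a (max N N')) = r'" by auto
  have aM: "a i \<in> M" for i using assms by auto
  have "gp x z z' \<ge> min r r'"
    using gp_min[of x z "a (max N N')" z'] i gp_commute[of z' "a (max N N')" x] z aM assms by auto
  moreover have "gp x z z' \<le> min r r'" using gp_le[of x z z'] gp_le'[of x z z'] z assms by auto
  ultimately show 1: "gp x z z' = min r r'" by auto
  show "d z z' = \<bar>r - r'\<bar>"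
    using 1 z unfolding gromov_prod_def by (auto simp: min_def split: if_splits)
qed

lemma on_ray_unique:
  assumes "x \<in> M" "\<forall>i. a i \<in> M" "on_ray x a r z" "on_ray x a r z'"
  shows "z = z'"
  using on_ray_dist(2)[OF assms] d_eq_0 assms unfolding on_ray_def by auto

definition ray :: "'p \<Rightarrow> (nat \<Rightarrow> 'p) \<Rightarrow> real \<Rightarrow> 'p" where
  "ray x a r = (SOME z. on_ray x a r z)"

lemma on_ray_ray: "x \<in> M \<Longrightarrow> conv_to_infinity M d a \<Longrightarrow> 0 \<le> r \<Longrightarrow> on_ray x a r (ray x a r)"
  unfolding ray_def using on_ray_exists by (rule someI_ex)

lemma ray_rel:
  assumes "x \<in> M" "conv_to_infinity M d a"
  shows "(a, \<lambda>n. ray x a (real n)) \<in> bdry_rel M d"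
proof -
  define \<rho> where "\<rho> n = ray x a (real n)" for n
  have on: "on_ray x a (real n) (\<rho> n)" for n using on_ray_ray assms by (simp add: \<rho>_def)
  have \<rho>M: "\<rho> n \<in> M" for n using on[of n] by (simp add: on_ray_def)
  have aM: "a n \<in> M" for n using assms conv_range by auto
  have "agree x r \<rho> \<rho>" for r
  proof -
    have "r \<le> gp x (\<rho> i) (\<rho> j)" if "i \<ge> nat \<lceil>r\<rceil>" "j \<ge> nat \<lceil>r\<rceil>" for i j
      using on_ray_dist(1)[OF assms(1) conv_sub[OF assms(2)] on[of i] on[of j]] that by linarith
    then show ?thesis unfolding agree_def by blast
  qed
  then have 1: "conv_to_infinity M d \<rho>" using conv_iff[OF assms(1)] \<rho>M by auto
  have "agree x r a \<rho>" for r
  proof -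
    obtain N where N: "\<And>i j. i \<ge> N \<Longrightarrow> j \<ge> N \<Longrightarrow> r \<le> gp x (a i) (a j)"
      using conv_agree[OF assms(2,1), of r] unfolding agree_def by meson
    have "r \<le> gp x (a i) (\<rho> j)" if "i \<ge> max N (nat \<lceil>r\<rceil>)" "j \<ge> max N (nat \<lceil>r\<rceil>)" for i j
    proof -
      obtain N' where "\<forall>k\<ge>N'. gp x (\<rho> j) (a k) = real j" using on[of j] unfolding on_ray_def by blast
      then have "gp x (\<rho> j) (a (max N N')) = real j" by auto
      moreover have "r \<le> real j" using that by linarith
      ultimately show ?thesis using gp_min[of x "a i" "a (max N N')" "\<rho> j"] N[of i "max N N'"] that
          gp_commute[of "\<rho> j" "a (max N N')" x] assms aM \<rho>M by auto
    qed
    then show ?thesis unfolding agree_def by blast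
  qed
  then show ?thesis using 1 assms bdry_rel_iff[OF assms(1)] unfolding \<rho>_def by blast
qed

text \<open>
  The rays from \<open>x\<close> to the ends \<open>a\<close> and \<open>b\<close> leave \<open>x\<close> in the directions of late terms \<open>a\<^sub>k\<close> and \<open>b\<^sub>k\<close>,
  which are different.
\<close>
lemma ray_opposite:
  assumes "x \<in> M" "conv_to_infinity M d a" "conv_to_infinity M d b" "0 \<le> r" "0 \<le> r'"
    and th: "through x y a b" and y: "y \<in> M"
  shows "d (ray x a r) (ray x b r') = r + r'"
proof -
  define z z' where "z = ray x a r" and "z' = ray x b r'"
  have z: "on_ray x a r z" "on_ray x b r' z'" using on_ray_ray assms by (auto simp: z_def z'_def)
  then have zM: "z \<in> M" "z' \<in> M" "d x z = r" "d x z' = r'" unfolding on_ray_def by auto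
  show ?thesis
  proof (cases "r = 0 \<or> r' = 0")
    case True
    then have "z = x \<or> z' = x" using zM d_eq_0 assms by blast
    then show ?thesis
      using zM True d_self[OF assms(1)] d_commute[OF zM(1) assms(1)]
      unfolding z_def[symmetric] z'_def[symmetric] by auto
  next
    case False
    have rr: "0 < r" "0 < r'" using False assms(4,5) by auto
    obtain N where N: "\<forall>i\<ge>N. gp x z (a i) = r" using z(1) unfolding on_ray_def by blast
    obtain N' where N': "\<forall>i\<ge>N'. gp x z' (b i) = r'" using z(2) unfolding on_ray_def by blast
    obtain N'' where N'': "\<forall>i\<ge>N''. \<forall>j\<ge>N''. d (a i) x + d x y + d y (b j) = d (a i) (b j)"
      using th unfolding through_def by (rule exE)
    define k where "k = max N (max N' N'')"
    have kN: "k \<ge> N" "k \<ge> N'" "k \<ge> N''" by (auto simp: k_def)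
    have aM: "a k \<in> M" and bM: "b k \<in> M" using assms(2,3) conv_range by auto
    have k: "gp x (a k) z = r" "gp x (b k) z' = r'"
      using N[rule_format, OF kN(1)] N'[rule_format, OF kN(2)]
        gp_commute[OF zM(1) aM] gp_commute[OF zM(2) bM] by simp_all
    have "d (a k) x + d x y + d y (b k) = d (a k) (b k)"
      using N'' kN(3) by blast
    then have "d (a k) x + d x x + d x (b k) = d (a k) (b k)"
      using d_triangle[OF assms(1) y bM] d_triangle[OF aM assms(1) bM] d_self[OF assms(1)] by linarith
    then have "d z x + d x x + d x z' = d z z'"
      using between_swap_ends[OF aM zM(1) assms(1,1) bM zM(2)] k rr by simp
    then show ?thesis using zM(3,4) d_self[OF assms(1)] d_commute[OF assms(1) zM(1)]
      unfolding z_def[symmetric] z'_def[symmetric] by linarith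
  qed
qed

text \<open>
  A line and a pair of sequences with the same ends have arbitrarily large Gromov products, which
  transfers the containment of \<open>[x, y]\<close> from the one to the other. Conversely, the two rays from \<open>x\<close>
  to the ends form a line, and the second ray passes through \<open>y\<close>. This is what reduces statements
  about cylinders to inequalities between Gromov products.
\<close>
lemma line_iff_through:
  assumes x: "x \<in> M" and y: "y \<in> M" and p: "\<xi> \<in> hyp_boundary M d" "\<eta> \<in> hyp_boundary M d" "a \<in> \<xi>" "b \<in> \<eta>"
  shows "(\<exists>\<gamma> s t. geodesic_line M d \<gamma> \<xi> \<eta> \<and> s \<le> t \<and> \<gamma> s = x \<and> \<gamma> t = y) \<longleftrightarrow> through x y a b"
proof
  assume "\<exists>\<gamma> s t. geodesic_line M d \<gamma> \<xi> \<eta> \<and> s \<le> t \<and> \<gamma> s = x \<and> \<gamma> t = y"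
  then obtain \<gamma> s t where g: "range \<gamma> \<subseteq> M" "\<And>s t. d (\<gamma> s) (\<gamma> t) = \<bar>s - t\<bar>"
     "(\<lambda>n. \<gamma> (- real n)) \<in> \<xi>" "(\<lambda>n. \<gamma> (real n)) \<in> \<eta>" and st: "s \<le> t" "\<gamma> s = x" "\<gamma> t = y"
    unfolding geodesic_line_def by blast
  have "d (\<gamma> (- real i)) x + d x y + d y (\<gamma> (real j)) = d (\<gamma> (- real i)) (\<gamma> (real j))"
    if "i \<ge> nat \<lceil>\<bar>s\<bar> + \<bar>t\<bar>\<rceil>" "j \<ge> nat \<lceil>\<bar>s\<bar> + \<bar>t\<bar>\<rceil>" for i j
    using that st(1) unfolding st(2,3)[symmetric] g(2) by linarith
  then have "through x y (\<lambda>n. \<gamma> (- real n)) (\<lambda>n. \<gamma> (real n))" unfolding through_def by blast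
  then show "through x y a b"
    by (rule through_agree[OF x y bdry_sub[OF p(1) g(3)] bdry_sub[OF p(2) g(4)]
          bdry_sub[OF p(1,3)] bdry_sub[OF p(2,4)] _ bdry_agree[OF p(1) g(3) p(3) x, of 1]
          bdry_agree[OF p(2) g(4) p(4) y]]) simp
next
  assume th: "through x y a b"
  have conv: "conv_to_infinity M d a" "conv_to_infinity M d b" using p bdry_conv by auto
  define \<gamma> where "\<gamma> r = (if r \<le> 0 then ray x a (- r) else ray x b r)" for r
  have on: "on_ray x a r (ray x a r)" "on_ray x b r (ray x b r)" if "0 \<le> r" for r
    using on_ray_ray x conv that by auto
  have x0: "ray x a 0 = x" "ray x b 0 = x"
    using on[of 0] d_eq_0[OF x, of "ray x a 0"] d_eq_0[OF x, of "ray x b 0"]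
    unfolding on_ray_def by auto
  have \<gamma>M: "range \<gamma> \<subseteq> M" using on unfolding \<gamma>_def on_ray_def by auto
  have opp: "d (ray x a r) (ray x b r') = r + r'" if "0 \<le> r" "0 \<le> r'" for r r'
    using ray_opposite x conv th y that by auto
  have iso: "d (\<gamma> s) (\<gamma> t) = \<bar>s - t\<bar>" for s t
  proof -
    have 1: "d (ray x a (- s)) (ray x a (- t)) = \<bar>s - t\<bar>" if "s \<le> 0" "t \<le> 0"
      using on_ray_dist(2)[OF x conv_sub[OF conv(1)] on(1) on(1), of "- s" "- t"] that by auto
    have 2: "d (ray x b s) (ray x b t) = \<bar>s - t\<bar>" if "0 \<le> s" "0 \<le> t"
      using on_ray_dist(2)[OF x conv_sub[OF conv(2)] on(2) on(2), of s t] that by auto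
    have 3: "d (ray x b s) (ray x a (- t)) = \<bar>s - t\<bar>" if "0 \<le> s" "t \<le> 0"
      using opp[of "-t" s] d_commute[of "ray x b s" "ray x a (-t)"] on[of s] on[of "- t"] that
      unfolding on_ray_def by auto
    have 4: "d (ray x a (- s)) (ray x b t) = \<bar>s - t\<bar>" if "s \<le> 0" "0 \<le> t"
      using opp[of "-s" t] that by auto
    show ?thesis using 1 2 3 4 unfolding \<gamma>_def by auto
  qed
  have "(\<lambda>n. \<gamma> (- real n)) = (\<lambda>n. ray x a (real n))" by (auto simp: \<gamma>_def)
  then have g1: "(\<lambda>n. \<gamma> (- real n)) \<in> \<xi>" using ray_rel[OF x conv(1)] bdry_mem p by auto
  have "\<gamma> (real n) = ray x b (real n)" for n using x0 by (cases "n = 0") (auto simp: \<gamma>_def)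
  then have "(\<lambda>n. \<gamma> (real n)) = (\<lambda>n. ray x b (real n))" by auto
  then have g2: "(\<lambda>n. \<gamma> (real n)) \<in> \<eta>" using ray_rel[OF x conv(2)] bdry_mem p by auto
  have line: "geodesic_line M d \<gamma> \<xi> \<eta>" using \<gamma>M iso g1 g2 by (simp add: geodesic_line_def)
  have dxy: "0 \<le> d x y" using d_nonneg x y by auto
  have "on_ray x b (d x y) y"
  proof -
    obtain N where N: "\<And>i j. i \<ge> N \<Longrightarrow> j \<ge> N \<Longrightarrow> d (a i) x + d x y + d y (b j) = d (a i) (b j)"
      using th unfolding through_def by blast
    have "gp x y (b j) = d x y" if "j \<ge> N" for j
    proof -
      have aM: "a N \<in> M" and bM: "b j \<in> M" using conv conv_range by auto
      have "d (a N) x + d x y + d y (b j) = d (a N) (b j)" using N that by blast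
      then have "d x y + d y (b j) = d x (b j)"
        using d_triangle[OF aM x bM] d_triangle[OF x y bM] by linarith
      then show ?thesis using gp_eq_between[OF x y bM] by blast
    qed
    then show ?thesis using y unfolding on_ray_def by blast
  qed
  then have "ray x b (d x y) = y"
    using on_ray_unique[OF x conv_sub[OF conv(2)] on(2)[OF dxy]] by auto
  then have "\<gamma> (d x y) = y" using dxy x0 d_eq_0[OF x y] by (cases "d x y = 0") (auto simp: \<gamma>_def)
  moreover have "\<gamma> 0 = x" using x0 by (auto simp: \<gamma>_def)
  ultimately show "\<exists>\<gamma> s t. geodesic_line M d \<gamma> \<xi> \<eta> \<and> s \<le> t \<and> \<gamma> s = x \<and> \<gamma> t = y"
    using line dxy by blast
qed

end

section \<open>The word metric of a free group\<close>

locale free_group = group F for F :: "('f, 'b) monoid_scheme" (structure) +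
  fixes X :: "'f set"
  assumes basis: "free_basis F X" and finite_basis: "finite X"
begin

lemma basis_carrier: "x \<in> X \<Longrightarrow> x \<in> carrier F"
  using basis by (auto simp: free_basis_def)

lemma word_eval_Nil [simp]: "word_eval F [] = \<one>"
  by (simp add: word_eval_def)

lemma word_eval_Cons [simp]:
  "word_eval F ((x, e) # w) = (if e then x else inv x) \<otimes> word_eval F w"
  by (simp add: word_eval_def)

lemma words_Nil [simp]: "[] \<in> words X"
  by (simp add: words_def)

lemma words_Cons [simp]: "(x, e) # w \<in> words X \<longleftrightarrow> x \<in> X \<and> w \<in> words X"
  by (auto simp: words_def)

lemma words_append [simp]: "u @ v \<in> words X \<longleftrightarrow> u \<in> words X \<and> v \<in> words X"
  by (auto simp: words_def)

lemma word_eval_closed [simp]: "w \<in> words X \<Longrightarrow> word_eval F w \<in> carrier F"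
proof (induction w)
  case (Cons a w)
  then show ?case using basis_carrier by (cases a) auto
qed simp

lemma word_eval_append:
  "u \<in> words X \<Longrightarrow> v \<in> words X \<Longrightarrow> word_eval F (u @ v) = word_eval F u \<otimes> word_eval F v"
proof (induction u)
  case (Cons a u)
  then show ?case using basis_carrier by (cases a) (auto simp: m_assoc)
qed simp

definition inv_word :: "('f \<times> bool) list \<Rightarrow> ('f \<times> bool) list" where
  "inv_word w = rev (map (\<lambda>(x, e). (x, \<not> e)) w)"

lemma inv_word_words: "w \<in> words X \<Longrightarrow> inv_word w \<in> words X"
  by (auto simp: inv_word_def words_def)

lemma word_eval_inv: "w \<in> words X \<Longrightarrow> word_eval F (inv_word w) = inv (word_eval F w)"
proof (induction w)
  case Nil then show ?case by (simp add: inv_word_def)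
next
  case (Cons a w)
  obtain x e where a: "a = (x, e)" by (cases a)
  have x: "x \<in> carrier F" "x \<in> X" "w \<in> words X" using Cons basis_carrier a by auto
  have "inv_word (a # w) = inv_word w @ [(x, \<not> e)]" by (simp add: inv_word_def a)
  then have "word_eval F (inv_word (a # w)) = inv (word_eval F w) \<otimes> (if e then inv x else x)"
    using x Cons by (simp add: word_eval_append inv_word_words)
  then show ?case using x by (simp add: a inv_mult_group)
qed

lemma reduce_word:
  "w \<in> words X \<Longrightarrow> \<exists>w'. w' \<in> words X \<and> reduced_word w' \<and> word_eval F w' = word_eval F w
     \<and> length w' \<le> length w"
proof (induction w)
  case Nil then show ?case by (auto simp: reduced_word_def)
next
  case (Cons a w)
  obtain x e where a: "a = (x, e)" by (cases a)
  have x: "x \<in> carrier F" "x \<in> X" "w \<in> words X" using Cons.prems basis_carrier a by auto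
  obtain w' where w': "w' \<in> words X" "reduced_word w'" "word_eval F w' = word_eval F w"
    "length w' \<le> length w" using Cons.IH x by blast
  show ?case
  proof (cases "\<exists>v. w' = (x, \<not> e) # v")
    case True
    then obtain v where v: "w' = (x, \<not> e) # v" by blast
    have vw: "v \<in> words X" "reduced_word v" using w' v by (auto simp: reduced_word_def successively_Cons)
    have "word_eval F (a # w) = word_eval F v"
      using w'(3)[symmetric] x vw by (simp add: a v m_assoc[symmetric])
    then show ?thesis using vw w'(4) v by (intro exI[of _ v]) auto
  next
    case False
    have "w' = [] \<or> \<not> (fst a = fst (hd w') \<and> snd a \<noteq> snd (hd w'))"
      using False a by (cases w') auto
    then have "reduced_word (a # w')" using w' by (auto simp: reduced_word_def successively_Cons)
    then show ?thesis using w' x by (intro exI[of _ "a # w'"]) (auto simp: a)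
  qed
qed

definition nf :: "'f \<Rightarrow> ('f \<times> bool) list" where
  "nf g = (THE w. w \<in> words X \<and> reduced_word w \<and> word_eval F w = g)"

lemma nf:
  assumes "g \<in> carrier F"
  shows "nf g \<in> words X" "reduced_word (nf g)" "word_eval F (nf g) = g"
  using theI'[of "\<lambda>w. w \<in> words X \<and> reduced_word w \<and> word_eval F w = g"] assms basis
  unfolding free_basis_def nf_def by auto

lemma nf_eval: "w \<in> words X \<Longrightarrow> reduced_word w \<Longrightarrow> nf (word_eval F w) = w"
  using nf[of "word_eval F w"] word_eval_closed[of w] basis unfolding free_basis_def by metis

lemma nf_one: "nf \<one> = []"
  using nf_eval[of "[]"] by (simp add: reduced_word_def)

lemma word_length_nf:
  assumes "g \<in> carrier F"
  shows "word_length F X g = length (nf g)"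
  unfolding word_length_def
proof (rule Least_equality)
  show "\<exists>w\<in>words X. length w = length (nf g) \<and> word_eval F w = g" using nf[OF assms] by blast
  fix n assume "\<exists>w\<in>words X. length w = n \<and> word_eval F w = g"
  then obtain w where "w \<in> words X" "length w = n" "word_eval F w = g" by blast
  then show "length (nf g) \<le> n" using reduce_word[of w] nf_eval by metis
qed

abbreviation "lcp g h \<equiv> length (longest_common_prefix (nf g) (nf h))"

text \<open>
  Cancellation in \<open>g\<^sup>-\<^sup>1 h\<close> consumes exactly the longest common prefix of the two reduced words: after
  it the letters differ, so that the remaining word is reduced.
\<close>
lemma word_dist_nf:
  assumes "g \<in> carrier F" "h \<in> carrier F"
  shows "word_dist F X g h = real (length (nf g)) + real (length (nf h)) - 2 * real (lcp g h)"
proof -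
  define p where "p = longest_common_prefix (nf g) (nf h)"
  obtain u v where u: "nf g = p @ u" and v: "nf h = p @ v"
    using longest_common_prefix_prefix1 longest_common_prefix_prefix2 unfolding p_def prefix_def by blast
  have hd: "hd u \<noteq> hd v" if "u \<noteq> []" "v \<noteq> []"
  proof
    assume "hd u = hd v"
    then have "prefix (p @ [hd u]) (nf g)" "prefix (p @ [hd u]) (nf h)"
      using that unfolding u v by (simp_all add: prefix_def) (metis list.collapse)+
    then have "prefix (p @ [hd u]) p" unfolding p_def using longest_common_prefix_max_prefix by blast
    then show False by (simp add: prefix_def)
  qed
  have w: "p \<in> words X" "u \<in> words X" "v \<in> words X"
    using nf(1)[OF assms(1)] nf(1)[OF assms(2)] unfolding u v words_append by blast+
  have ru: "reduced_word u" "reduced_word v"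
    using nf(2)[OF assms(1)] nf(2)[OF assms(2)] u v by (auto simp: reduced_word_def successively_append_iff)
  have "reduced_word (inv_word u)"
    using ru(1) unfolding reduced_word_def inv_word_def
    by (simp add: successively_map case_prod_unfold) (auto elim!: successively_mono)
  moreover have "last (inv_word u) = (fst (hd u), \<not> snd (hd u))" if "u \<noteq> []"
    using that by (cases u) (auto simp: inv_word_def split: prod.splits)
  ultimately have red: "reduced_word (inv_word u @ v)"
    using ru hd unfolding reduced_word_def successively_append_iff
    by (auto simp: inv_word_def prod_eq_iff)
  have "inv g \<otimes> h = word_eval F (inv_word u @ v)"
  proof -
    have g: "g = word_eval F p \<otimes> word_eval F u" and h: "h = word_eval F p \<otimes> word_eval F v"
      using nf(3) assms u v word_eval_append w by metis+
    have "inv g \<otimes> h = inv (word_eval F u) \<otimes> (inv (word_eval F p) \<otimes> (word_eval F p \<otimes> word_eval F v))"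
      using w by (simp add: g h inv_mult_group m_assoc)
    also have "\<dots> = inv (word_eval F u) \<otimes> word_eval F v"
      using w by (simp add: m_assoc[symmetric])
    finally show ?thesis using w by (simp add: word_eval_append inv_word_words word_eval_inv)
  qed
  then have "nf (inv g \<otimes> h) = inv_word u @ v" using nf_eval red w inv_word_words by auto
  then have "word_dist F X g h = real (length u) + real (length v)"
    using assms by (simp add: word_dist_def word_length_nf inv_word_def)
  moreover have "length (nf g) = length p + length u" "length (nf h) = length p + length v"
    using u v by simp_all
  ultimately show ?thesis unfolding p_def[symmetric] by simp
qed

text \<open>
  Two prefixes of the same word are comparable, and the shorter of the two common prefixes is a
  prefix of all three words.
\<close>
lemma lcp_min: "min (lcp g k) (lcp k h) \<le> lcp g h"
proof -
  define p q where "p = longest_common_prefix (nf g) (nf k)" and "q = longest_common_prefix (nf k) (nf h)"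
  have pq: "prefix p (nf g)" "prefix p (nf k)" "prefix q (nf k)" "prefix q (nf h)"
    unfolding p_def q_def by (simp_all add: longest_common_prefix_prefix1 longest_common_prefix_prefix2)
  then have "prefix p q \<or> prefix q p" using prefix_same_cases by blast
  then show ?thesis
  proof
    assume "prefix p q"
    then have "prefix p (nf h)" using pq prefix_order.trans by blast
    then have "prefix p (longest_common_prefix (nf g) (nf h))"
      using pq longest_common_prefix_max_prefix by blast
    then show ?thesis using prefix_length_le unfolding p_def by fastforce
  next
    assume "prefix q p"
    then have "prefix q (nf g)" using pq prefix_order.trans by blast
    then have "prefix q (longest_common_prefix (nf g) (nf h))"
      using pq longest_common_prefix_max_prefix by blast
    then show ?thesis using prefix_length_le unfolding q_def by fastforce
  qed
qed

lemma lcp_commute: "lcp g h = lcp h g"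
proof -
  have "lcp g h \<le> lcp h g" for g h
    by (intro prefix_length_le longest_common_prefix_max_prefix
        longest_common_prefix_prefix1 longest_common_prefix_prefix2)
  then show ?thesis by (simp add: le_antisym)
qed

lemma lcp_self: "lcp g g = length (nf g)"
  by (intro arg_cong[of _ _ length] prefix_order.antisym longest_common_prefix_prefix1
      longest_common_prefix_max_prefix) auto

lemma word_dist_translate:
  assumes "k \<in> carrier F" "g \<in> carrier F" "h \<in> carrier F"
  shows "word_dist F X (k \<otimes> g) (k \<otimes> h) = word_dist F X g h"
proof -
  have "inv (k \<otimes> g) \<otimes> (k \<otimes> h) = inv g \<otimes> (inv k \<otimes> k \<otimes> h)"
    using assms by (simp only: inv_mult_group m_assoc inv_closed m_closed)
  then show ?thesis using assms by (simp add: word_dist_def)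
qed

text \<open>
  By invariance \<open>w\<close> may be moved to \<open>\<one>\<close>, where Gromov products are lengths of common prefixes.
\<close>
lemma word_dist_four_point:
  assumes "x \<in> carrier F" "y \<in> carrier F" "z \<in> carrier F" "w \<in> carrier F"
  shows "word_dist F X x y + word_dist F X z w \<le>
    max (word_dist F X x z + word_dist F X y w) (word_dist F X x w + word_dist F X y z)"
proof -
  define t where "t g = inv w \<otimes> g" for g
  have t: "t g \<in> carrier F" if "g \<in> carrier F" for g using that assms by (simp add: t_def)
  have tw: "t w = \<one>" using assms by (simp add: t_def)
  have dist: "word_dist F X g h = real (length (nf (t g))) + real (length (nf (t h))) - 2 * real (lcp (t g) (t h))"
    if "g \<in> carrier F" "h \<in> carrier F" for g h
    using word_dist_translate[of "inv w" g h] word_dist_nf[OF t t, OF that] assms that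
    by (simp add: t_def)
  have lcp1: "lcp g \<one> = 0" for g
    using longest_common_prefix_prefix2[of "nf g" "[]"] by (simp add: nf_one)
  show ?thesis
    using lcp_min[of "t x" "t z" "t y"] lcp_commute[of "t z" "t y"]
    by (simp add: dist assms tw lcp1 nf_one min_def max_def split: if_splits)
qed

sublocale wd: tree_metric "carrier F" "word_dist F X"
proof
  show "word_dist F X x x = 0" if "x \<in> carrier F" for x
    using that by (simp add: word_dist_nf lcp_self)
  show "word_dist F X x y = word_dist F X y x" if "x \<in> carrier F" "y \<in> carrier F" for x y
    using that by (simp add: word_dist_nf lcp_commute)
qed (rule word_dist_four_point)

lemma word_dist_one: "g \<in> carrier F \<Longrightarrow> word_dist F X \<one> g = real (length (nf g))"
  by (simp add: word_dist_def word_length_nf)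

lemma gp_one: "g \<in> carrier F \<Longrightarrow> h \<in> carrier F \<Longrightarrow> wd.gp \<one> g h = real (lcp g h)"
  using word_dist_one[of g] word_dist_one[of h] word_dist_nf[of g h] by (simp add: gromov_prod_def)

lemma gp_one_self: "g \<in> carrier F \<Longrightarrow> wd.gp \<one> g g = real (length (nf g))"
  by (simp add: gp_one lcp_self)

definition pre :: "nat \<Rightarrow> 'f \<Rightarrow> 'f" where
  "pre n g = word_eval F (take n (nf g))"

lemma take_nf:
  assumes "g \<in> carrier F"
  shows "take n (nf g) \<in> words X" "reduced_word (take n (nf g))"
proof -
  have "take n (nf g) @ drop n (nf g) \<in> words X" "reduced_word (take n (nf g) @ drop n (nf g))"
    using nf assms by auto
  then show "take n (nf g) \<in> words X" "reduced_word (take n (nf g))"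
    unfolding words_append reduced_word_def successively_append_iff by auto
qed

lemma pre_closed: "g \<in> carrier F \<Longrightarrow> pre n g \<in> carrier F"
  by (simp add: pre_def take_nf)

lemma nf_pre: "g \<in> carrier F \<Longrightarrow> nf (pre n g) = take n (nf g)"
  by (simp add: pre_def nf_eval take_nf)

lemma longest_common_prefix_take:
  "longest_common_prefix (take m w) (take n w) = take (min m n) w"
proof -
  have "longest_common_prefix (take m w) (take n w) = take m w \<or>
        longest_common_prefix (take m w) (take n w) = take n w"
  proof (cases "m \<le> n")
    case True
    then have "prefix (take m w) (take n w)"
      by (metis min.absorb1 take_is_prefix take_take)
    then show ?thesis
      by (meson longest_common_prefix_max_prefix longest_common_prefix_prefix1 prefix_order.dual_order.eq_iff)
  next
    case False
    then have "prefix (take n w) (take m w)"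
      by (metis linorder_le_cases min.absorb1 take_is_prefix take_take)
    then show ?thesis
      by (meson longest_common_prefix_max_prefix longest_common_prefix_prefix2 prefix_order.dual_order.eq_iff)
  qed
  moreover have "prefix (longest_common_prefix (take m w) (take n w)) (take m w)"
    "prefix (longest_common_prefix (take m w) (take n w)) (take n w)"
    by (simp_all add: longest_common_prefix_prefix1 longest_common_prefix_prefix2)
  ultimately show ?thesis
    by (smt (verit, ccfv_threshold) linorder_le_cases min.absorb1 min.absorb2 prefix_order.eq_iff
      take_is_prefix take_take)
qed

lemma lcp_pre:
  assumes "g \<in> carrier F"
  shows "lcp (pre m g) (pre n g) = min (length (nf g)) (min m n)"
  using assms by (simp add: nf_pre longest_common_prefix_take)

lemma gp_pre:
  assumes "g \<in> carrier F" "n \<le> length (nf g)"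
  shows "wd.gp \<one> g (pre n g) = real n"
proof -
  have "pre (length (nf g)) g = g" using assms nf by (simp add: pre_def)
  then have "lcp g (pre n g) = n" using lcp_pre[of g "length (nf g)" n] assms by simp
  then show ?thesis using assms pre_closed by (simp add: gp_one)
qed

lemma coarse_geodesic_word: "coarse_geodesic (carrier F) (word_dist F X) 0"
  unfolding coarse_geodesic_def
proof (intro conjI ballI)
  fix a b assume ab: "a \<in> carrier F" "b \<in> carrier F"
  define g where "g = inv a \<otimes> b"
  have g: "g \<in> carrier F" using ab by (simp add: g_def)
  define c where "c i = a \<otimes> pre i g" for i
  have "c 0 = a" using ab by (simp add: c_def pre_def)
  moreover have "c (length (nf g)) = b"
    using ab nf(3)[OF g] by (simp add: c_def pre_def) (simp add: g_def m_assoc[symmetric])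
  moreover have "c ` {..length (nf g)} \<subseteq> carrier F" using ab g pre_closed by (auto simp: c_def)
  moreover have "\<bar>word_dist F X (c i) (c j) - \<bar>real i - real j\<bar>\<bar> \<le> 0"
    if "i \<le> length (nf g)" "j \<le> length (nf g)" for i j
  proof -
    have "word_dist F X (c i) (c j) = word_dist F X (pre i g) (pre j g)"
      using word_dist_translate ab g pre_closed by (simp add: c_def)
    then show ?thesis using that g pre_closed
      by (simp add: word_dist_nf lcp_pre) (simp add: nf_pre min_def)
  qed
  ultimately show "\<exists>n c. c 0 = a \<and> c n = b \<and> c ` {..n} \<subseteq> carrier F \<and>
     (\<forall>i\<le>n. \<forall>j\<le>n. \<bar>word_dist F X (c i) (c j) - \<bar>real i - real j\<bar>\<bar> \<le> 0)" by blast
qed simp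

lemma finite_word_ball: "finite {g \<in> carrier F. length (nf g) \<le> n}"
proof -
  have "finite {w. set w \<subseteq> X \<times> (UNIV :: bool set) \<and> length w \<le> n}"
    using finite_basis by (intro finite_lists_length_le) auto
  then have "finite (word_eval F ` {w. set w \<subseteq> X \<times> (UNIV :: bool set) \<and> length w \<le> n})" by simp
  moreover have "{g \<in> carrier F. length (nf g) \<le> n}
      \<subseteq> word_eval F ` {w. set w \<subseteq> X \<times> (UNIV :: bool set) \<and> length w \<le> n}"
  proof
    fix g assume g: "g \<in> {g \<in> carrier F. length (nf g) \<le> n}"
    then have "nf g \<in> {w. set w \<subseteq> X \<times> (UNIV :: bool set) \<and> length w \<le> n}" "g = word_eval F (nf g)"
      using nf[of g] by (auto simp: words_def)
    then show "g \<in> word_eval F ` {w. set w \<subseteq> X \<times> (UNIV :: bool set) \<and> length w \<le> n}" by blast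
  qed
  ultimately show ?thesis using finite_subset by blast
qed

section \<open>Compactness of the boundary of a free group\<close>

abbreviation "bdry \<equiv> hyp_boundary (carrier F) (word_dist F X)"
abbreviation "wconv \<equiv> conv_to_infinity (carrier F) (word_dist F X)"
abbreviation "wrel \<equiv> bdry_rel (carrier F) (word_dist F X)"
abbreviation "wnbhd \<equiv> bdry_nbhd (carrier F) (word_dist F X)"

text \<open>
  The boundary points whose infinite reduced words begin with the reduced word of \<open>u\<close>.
\<close>
definition shadow :: "'f \<Rightarrow> 'f bdry_point set" where
  "shadow u = {p \<in> bdry. \<forall>s\<in>p. wd.agree \<one> (real (length (nf u))) s (\<lambda>_. u)}"

lemma shadow_exists:
  assumes p: "p \<in> bdry"
  obtains u where "u \<in> carrier F" "length (nf u) = n" "p \<in> shadow u"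
proof -
  obtain s where s: "s \<in> p" using wd.bdry_nonempty[OF p] by blast
  have sF: "\<forall>i. s i \<in> carrier F" using wd.bdry_sub[OF p s] .
  obtain N where N: "\<forall>i\<ge>N. \<forall>j\<ge>N. real n \<le> wd.gp \<one> (s i) (s j)"
    using wd.bdry_agree[OF p s s one_closed, of "real n"] unfolding wd.agree_def by blast
  define u where "u = pre n (s N)"
  have len: "n \<le> length (nf (s N))" using N[rule_format, of N N] gp_one_self sF by simp
  have u: "u \<in> carrier F" "length (nf u) = n"
    using sF len by (auto simp: u_def pre_closed nf_pre)
  have gp: "wd.gp \<one> (s N) u = real n" using gp_pre len sF by (simp add: u_def)
  have "real n \<le> wd.gp \<one> (s i) u" if "i \<ge> N" for i
    using wd.gp_min[OF one_closed, of "s i" "s N" u] N[rule_format, of i N] that gp sF u(1) by simp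
  then have "wd.agree \<one> (real n) s (\<lambda>_. u)" unfolding wd.agree_def by blast
  moreover have "\<forall>i::nat. u \<in> carrier F" using u(1) by simp
  ultimately have "wd.agree \<one> (real n) t (\<lambda>_. u)" if "t \<in> p" for t
    by (intro wd.agree_trans[OF one_closed wd.bdry_sub[OF p that] sF _ wd.bdry_agree[OF p that s one_closed]])
  then have "p \<in> shadow u" using p u by (simp add: shadow_def)
  then show ?thesis using that u by blast
qed

lemma agree_const: "wd.agree \<one> r (\<lambda>_. u) (\<lambda>_. v) \<longleftrightarrow> r \<le> wd.gp \<one> u v"
  unfolding wd.agree_def by blast

text \<open>
  Koenig's argument: if an open cover of the boundary had no finite subcover, then there would be an
  infinite reduced word none of whose prefixes has a finitely covered shadow. But the shadows of the
  prefixes shrink to a boundary point.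
\<close>
lemma compact_space_free_bdry: "compact_space (free_bdry F X)"
  unfolding compact_space_alt free_bdry_def
proof (intro allI impI, elim conjE)
  fix \<U> assume op: "\<forall>U\<in>\<U>. openin (bdry_topology (carrier F) (word_dist F X)) U"
    and cov: "topspace (bdry_topology (carrier F) (word_dist F X)) \<subseteq> \<Union>\<U>"
  define bad where "bad u \<longleftrightarrow> \<not> (\<exists>\<F>. finite \<F> \<and> \<F> \<subseteq> \<U> \<and> shadow u \<subseteq> \<Union>\<F>)" for u
  have step: "\<exists>u'. (u' \<in> carrier F \<and> length (nf u') = Suc n \<and> bad u') \<and> real n \<le> wd.gp \<one> u u'"
    if u: "u \<in> carrier F \<and> length (nf u) = n \<and> bad u" for u n
  proof (rule ccontr)
    assume no: "\<not> ?thesis"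
    define S where "S = {u' \<in> carrier F. length (nf u') = Suc n \<and> real n \<le> wd.gp \<one> u u'}"
    have "S \<subseteq> {g \<in> carrier F. length (nf g) \<le> Suc n}" by (auto simp: S_def)
    then have "finite S" using finite_word_ball finite_subset by blast
    have "\<forall>u'\<in>S. \<exists>\<F>. finite \<F> \<and> \<F> \<subseteq> \<U> \<and> shadow u' \<subseteq> \<Union>\<F>"
      using no unfolding S_def bad_def by blast
    then obtain f where f: "\<forall>u'\<in>S. finite (f u') \<and> f u' \<subseteq> \<U> \<and> shadow u' \<subseteq> \<Union>(f u')"
      by (rule bchoice[THEN exE])
    have "shadow u \<subseteq> \<Union>(\<Union>(f ` S))"
    proof
      fix p assume p: "p \<in> shadow u"
      then have pb: "p \<in> bdry" by (simp add: shadow_def)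
      obtain u' where u': "u' \<in> carrier F" "length (nf u') = Suc n" "p \<in> shadow u'"
        using shadow_exists[OF pb] by blast
      obtain s where s: "s \<in> p" using wd.bdry_nonempty[OF pb] by blast
      have sF: "\<forall>i. s i \<in> carrier F" using wd.bdry_sub[OF pb s] .
      have uF: "\<forall>i::nat. u \<in> carrier F" "\<forall>i::nat. u' \<in> carrier F" using u u' by simp_all
      have "wd.agree \<one> (real n) s (\<lambda>_. u)"
        using p s u unfolding shadow_def by blast
      then have su: "wd.agree \<one> (real n) (\<lambda>_. u) s" by (rule wd.agree_sym[OF sF uF(1)])
      have "wd.agree \<one> (real (Suc n)) s (\<lambda>_. u')"
        using u'(2,3) s unfolding shadow_def by fastforce
      then have su': "wd.agree \<one> (real n) s (\<lambda>_. u')" by (rule wd.agree_mono) simp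
      have "wd.agree \<one> (real n) (\<lambda>_. u) (\<lambda>_. u')"
        by (rule wd.agree_trans[OF one_closed uF(1) sF uF(2) su su'])
      then have "u' \<in> S" using u' agree_const by (simp add: S_def)
      then have "p \<in> \<Union>(f u')" using f[rule_format, of u'] u'(3) by blast
      then show "p \<in> \<Union>(\<Union>(f ` S))" using \<open>u' \<in> S\<close> by blast
    qed
    moreover have "finite (\<Union>(f ` S))"
      using f \<open>finite S\<close> by (intro finite_UN_I) simp_all
    moreover have "\<Union>(f ` S) \<subseteq> \<U>" using f by (intro UN_least) simp
    ultimately show False using u unfolding bad_def by blast
  qed
  have shadow_one: "shadow \<one> = bdry"
  proof -
    have "wd.agree \<one> 0 s (\<lambda>_. \<one>)" if "p \<in> bdry" "s \<in> p" for p s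
      unfolding wd.agree_def using wd.gp_nonneg[OF one_closed _ one_closed] wd.bdry_sub[OF that] by blast
    then show ?thesis by (auto simp: shadow_def nf_one)
  qed
  have "\<not> bad \<one>"
  proof
    assume "bad \<one>"
    then have "\<exists>u. \<forall>n. (u n \<in> carrier F \<and> length (nf (u n)) = n \<and> bad (u n)) \<and> real n \<le> wd.gp \<one> (u n) (u (Suc n))"
      by (intro dependent_nat_choice step) (auto simp: nf_one intro!: exI[of _ \<one>])
    then obtain u where u: "\<And>n. u n \<in> carrier F" "\<And>n. length (nf (u n)) = n" "\<And>n. bad (u n)"
        "\<And>n. real n \<le> wd.gp \<one> (u n) (u (Suc n))" by blast
    have gp: "real n \<le> wd.gp \<one> (u n) (u (n + k))" for n k
    proof (induction k)
      case 0 then show ?case using gp_one_self u by simp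
    next
      case (Suc k)
      have "min (wd.gp \<one> (u n) (u (n + k))) (wd.gp \<one> (u (n + k)) (u (Suc (n + k)))) \<le> wd.gp \<one> (u n) (u (Suc (n + k)))"
        using wd.gp_min[OF one_closed u(1) u(1) u(1)] .
      then show ?case using Suc u(4)[of "n + k"] by auto
    qed
    have gp': "real n \<le> wd.gp \<one> (u i) (u j)" if "i \<ge> n" "j \<ge> n" for n i j
      using wd.gp_min[OF one_closed u(1)[of i] u(1)[of n] u(1)[of j]] gp[of n "i - n"] gp[of n "j - n"] that
        wd.gp_commute[OF u(1)[of i] u(1)[of n]] by auto
    have "wd.agree \<one> r u u" for r
    proof -
      have "r \<le> wd.gp \<one> (u i) (u j)" if "i \<ge> nat \<lceil>r\<rceil>" "j \<ge> nat \<lceil>r\<rceil>" for i j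
        using gp'[OF that] real_nat_ceiling_ge[of r] by linarith
      then show ?thesis unfolding wd.agree_def by blast
    qed
    then have "wconv u" using wd.conv_iff[OF one_closed] u by blast
    then obtain p where p: "p \<in> bdry" "u \<in> p" using wd.bdry_class by blast
    then obtain U where U: "U \<in> \<U>" "p \<in> U" using cov by auto
    then have "bdry_open (carrier F) (word_dist F X) U" using op openin_bdry_topology by blast
    then obtain r where r: "wnbhd \<one> p r \<subseteq> U"
      using U(2) unfolding bdry_open_def by blast
    define n where "n = nat \<lceil>r\<rceil>"
    have n: "r \<le> real n" by (simp add: n_def real_nat_ceiling_ge)
    have "shadow (u n) \<subseteq> U"
    proof
      fix q assume q: "q \<in> shadow (u n)"
      then have qb: "q \<in> bdry" by (simp add: shadow_def)
      obtain t where t: "t \<in> q" using wd.bdry_nonempty[OF qb] by blast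
      have tF: "\<forall>i. t i \<in> carrier F" using wd.bdry_sub[OF qb t] .
      have uF: "\<forall>i. u i \<in> carrier F" "\<forall>i::nat. u n \<in> carrier F" using u by auto
      have 1: "wd.agree \<one> (real n) t (\<lambda>_. u n)" using q t u(2) by (simp add: shadow_def)
      have 2: "wd.agree \<one> (real n) u (\<lambda>_. u n)" unfolding wd.agree_def using gp'[of n _ n] by blast
      have 3: "wd.agree \<one> (real n) u t"
        by (rule wd.agree_trans[OF one_closed uF(1,2) tF 2 wd.agree_sym[OF tF uF(2) 1]])
      have "\<forall>r'<r. wd.agree \<one> r' u t" using wd.agree_mono[OF 3] n by simp
      then show "q \<in> U" using wd.bdry_nbhd_iff[OF one_closed p(1) qb p(2) t] r by blast
    qed
    then have "shadow (u n) \<subseteq> \<Union>{U}" by simp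
    then show False using u(3)[of n] U(1) unfolding bad_def by blast
  qed
  then show "\<exists>\<F>. finite \<F> \<and> \<F> \<subseteq> \<U> \<and> topspace (bdry_topology (carrier F) (word_dist F X)) \<subseteq> \<Union>\<F>"
    unfolding bad_def shadow_one wd.topspace_bdry not_not .
qed

lemma topspace_free_bdry2: "topspace (free_bdry2 F X) = {(p, q). p \<in> bdry \<and> q \<in> bdry \<and> p \<noteq> q}"
  by (auto simp: free_bdry2_def free_bdry_def)

text \<open>
  The diagonal is missing from the space of pairs of distinct points, and pairs that separate before
  a fixed depth stay away from it.
\<close>
lemma compactin_apart: "compactin (free_bdry2 F X) (wd.apart \<one> r)"
proof -
  have "compact_space (prod_topology (free_bdry F X) (free_bdry F X))"
    using compact_space_free_bdry by (simp add: compact_space_prod_topology)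
  then have "compactin (prod_topology (free_bdry F X) (free_bdry F X)) (wd.apart \<one> r)"
    using wd.closedin_apart[OF one_closed] closedin_compact_space unfolding free_bdry_def by blast
  moreover have "wd.apart \<one> r \<subseteq> {(p, q). p \<noteq> q}" using wd.apart_distinct[OF one_closed] by auto
  ultimately show ?thesis unfolding free_bdry2_def by (simp add: compactin_subtopology)
qed

lemma closedin_apart2: "closedin (free_bdry2 F X) (wd.apart \<one> r)"
proof -
  have "wd.apart \<one> r = wd.apart \<one> r \<inter> {(p, q). p \<noteq> q}" using wd.apart_distinct[OF one_closed] by auto
  then show ?thesis using wd.closedin_apart[OF one_closed, of r]
    unfolding free_bdry2_def free_bdry_def closedin_subtopology by blast
qed

lemma topspace_free_bdry2_Union: "topspace (free_bdry2 F X) = (\<Union>n. wd.apart \<one> (real n))"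
proof
  show "topspace (free_bdry2 F X) \<subseteq> (\<Union>n. wd.apart \<one> (real n))"
  proof
    fix z assume "z \<in> topspace (free_bdry2 F X)"
    then obtain p q where z: "z = (p, q)" and p: "p \<in> bdry" and q: "q \<in> bdry" and ne: "p \<noteq> q"
      unfolding topspace_free_bdry2 by blast
    obtain s where s: "s \<in> p" using wd.bdry_nonempty[OF p] by blast
    obtain t where t: "t \<in> q" using wd.bdry_nonempty[OF q] by blast
    obtain r where r: "\<not> wd.agree \<one> r s t" using wd.bdry_eq[OF p q s t one_closed] ne by blast
    have "r < real (nat \<lceil>r\<rceil> + 1)" by linarith
    then have "z \<in> wd.apart \<one> (real (nat \<lceil>r\<rceil> + 1))"
      using wd.apart_iff[OF one_closed p q s t] r z by blast
    then show "z \<in> (\<Union>n. wd.apart \<one> (real n))" by blast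
  qed
  show "(\<Union>n. wd.apart \<one> (real n)) \<subseteq> topspace (free_bdry2 F X)"
    using closedin_subset[OF closedin_apart2] by blast
qed

end

section \<open>Orbits in a tree\<close>

text \<open>
  A chain cannot bypass a point of the segment between its ends: one of its jumps crosses the point.
\<close>
lemma (in tree_metric) chain_meets:
  fixes y :: "nat \<Rightarrow> 'p"
  assumes "\<And>i. i \<le> Suc n \<Longrightarrow> y i \<in> M" "z \<in> M" "gp z (y 0) (y (Suc n)) = 0"
  shows "\<exists>i\<le>n. gp z (y i) (y (Suc i)) = 0"
  using assms(1,3)
proof (induction n)
  case 0 then show ?case by auto
next
  case (Suc n)
  have M: "y 0 \<in> M" "y (Suc n) \<in> M" "y (Suc (Suc n)) \<in> M" using Suc.prems(1) by auto
  have "min (gp z (y 0) (y (Suc n))) (gp z (y (Suc n)) (y (Suc (Suc n)))) \<le> 0"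
    using gp_min[OF assms(2) M] Suc.prems(2) by simp
  then have "gp z (y 0) (y (Suc n)) = 0 \<or> gp z (y (Suc n)) (y (Suc (Suc n))) = 0"
    using gp_nonneg[OF assms(2) M(1,2)] gp_nonneg[OF assms(2) M(2,3)] by linarith
  then show ?case
  proof
    assume "gp z (y 0) (y (Suc n)) = 0"
    then obtain i where "i \<le> n" "gp z (y i) (y (Suc i)) = 0"
      using Suc.IH Suc.prems(1) by (meson le_SucI)
    then show ?thesis by (meson le_SucI)
  qed blast
qed

text \<open>
  The base point \<open>b\<close> makes the group an orbit in the tree. Gromov products are written \<open>R.gp\<close> in the
  tree, \<open>om.gp\<close> for the orbit metric \<open>od\<close> on the group and \<open>wd.gp\<close> for the word metric.
\<close>
locale tree_with_action = free_group F X for F :: "('f, 'b) monoid_scheme" (structure) and X +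
  fixes T :: "('f, 'a) tree_action" and b :: 'a
  assumes cv: "T \<in> cv_trees F" and b: "b \<in> pts T"
begin

sublocale R: R_tree "pts T" "tdist T"
  using cv by unfold_locales (simp add: cv_trees_def)

sublocale action: group_action F "pts T" "act T"
  using cv by (simp add: cv_trees_def isometric_action_def)

lemma act_closed: "g \<in> carrier F \<Longrightarrow> x \<in> pts T \<Longrightarrow> act T g x \<in> pts T"
  using action.element_image by blast

lemma act_one: "x \<in> pts T \<Longrightarrow> act T \<one> x = x"
  using action.id_eq_one by (metis restrict_apply')

lemma act_mult: "g \<in> carrier F \<Longrightarrow> h \<in> carrier F \<Longrightarrow> x \<in> pts T \<Longrightarrow> act T (g \<otimes> h) x = act T g (act T h x)"
  using action.composition_rule by blast

lemma act_isometry: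
  "g \<in> carrier F \<Longrightarrow> x \<in> pts T \<Longrightarrow> y \<in> pts T \<Longrightarrow> tdist T (act T g x) (act T g y) = tdist T x y"
  using cv by (simp add: cv_trees_def isometric_action_def)

lemma act_free: "g \<in> carrier F \<Longrightarrow> x \<in> pts T \<Longrightarrow> act T g x = x \<Longrightarrow> g = \<one>"
  using cv unfolding cv_trees_def free_action_def by blast

lemma act_inv: "g \<in> carrier F \<Longrightarrow> x \<in> pts T \<Longrightarrow> act T (inv g) (act T g x) = x"
  using act_mult[of "inv g" g x] act_one by simp

lemma act_inv': "g \<in> carrier F \<Longrightarrow> x \<in> pts T \<Longrightarrow> act T g (act T (inv g) x) = x"
  using act_mult[of g "inv g" x] act_one by simp

lemma act_gp:
  "g \<in> carrier F \<Longrightarrow> x \<in> pts T \<Longrightarrow> y \<in> pts T \<Longrightarrow> z \<in> pts T \<Longrightarrow>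
    R.gp (act T g z) (act T g x) (act T g y) = R.gp z x y"
  by (simp add: gromov_prod_def act_isometry)

abbreviation orb :: "'f \<Rightarrow> 'a" where
  "orb g \<equiv> act T g b"

lemma orb_closed: "g \<in> carrier F \<Longrightarrow> orb g \<in> pts T"
  by (simp add: act_closed b)

definition od :: "'f \<Rightarrow> 'f \<Rightarrow> real" where
  "od g h = tdist T (orb g) (orb h)"

sublocale om: tree_metric "carrier F" od
proof
  show "od x x = 0" if "x \<in> carrier F" for x
    using that R.d_self orb_closed by (simp add: od_def)
  show "od x y = od y x" if "x \<in> carrier F" "y \<in> carrier F" for x y
    using that R.d_commute orb_closed by (simp add: od_def)
  show "od x y + od z w \<le> max (od x z + od y w) (od x w + od y z)"
    if "x \<in> carrier F" "y \<in> carrier F" "z \<in> carrier F" "w \<in> carrier F" for x y z w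
    unfolding od_def using that by (intro R.four_point orb_closed)
qed

lemma gp_od: "gromov_prod od c g h = R.gp (orb c) (orb g) (orb h)"
  by (simp add: gromov_prod_def od_def)

lemma od_translate:
  "k \<in> carrier F \<Longrightarrow> g \<in> carrier F \<Longrightarrow> h \<in> carrier F \<Longrightarrow> od (k \<otimes> g) (k \<otimes> h) = od g h"
  by (simp add: od_def act_mult act_isometry orb_closed b)

lemma od_inv:
  assumes "g \<in> carrier F" "h \<in> carrier F"
  shows "od \<one> (inv g \<otimes> h) = od g h"
  using od_translate[of "inv g" g h] assms by simp

lemma ex_od_le_word_length: "\<exists>L>0. \<forall>g\<in>carrier F. od \<one> g \<le> L * real (length (nf g))"
proof -
  have "finite ((\<lambda>x. od \<one> x) ` X)" using finite_basis by simp
  then obtain L0 where "\<forall>y\<in>(\<lambda>x. od \<one> x) ` X. y \<le> L0" using bdd_above_finite bdd_above_def by metis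
  then have L0: "\<And>x. x \<in> X \<Longrightarrow> od \<one> x \<le> L0" by blast
  define L where "L = max 1 L0"
  have L: "L > 0" "\<And>x. x \<in> X \<Longrightarrow> od \<one> x \<le> L" using L0 unfolding L_def by fastforce+
  have letter: "od \<one> (if e then x else inv x) \<le> L" if "x \<in> X" for x e
    using L(2)[OF that] od_inv[of x \<one>] om.d_commute[of x \<one>] basis_carrier[OF that] by simp
  have "od \<one> (word_eval F w) \<le> L * real (length w)" if "w \<in> words X" for w
    using that
  proof (induction w)
    case Nil then show ?case using om.d_self by simp
  next
    case (Cons a w)
    obtain x e where a: "a = (x, e)" by (cases a)
    define y where "y = (if e then x else inv x)"
    have x: "x \<in> X" "w \<in> words X" using Cons.prems a by auto
    have y: "y \<in> carrier F" using basis_carrier x by (simp add: y_def)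
    have v: "word_eval F w \<in> carrier F" using x by simp
    have "od \<one> (y \<otimes> word_eval F w) \<le> od \<one> y + od y (y \<otimes> word_eval F w)"
      using om.d_triangle[OF one_closed y] y v by simp
    moreover have "od y (y \<otimes> word_eval F w) = od \<one> (word_eval F w)"
      using od_translate[OF y one_closed v] y by simp
    moreover have "od \<one> y \<le> L" using letter x by (simp add: y_def)
    ultimately show ?case using Cons.IH x by (simp add: a y_def[symmetric] algebra_simps)
  qed
  then have "od \<one> g \<le> L * real (length (nf g))" if "g \<in> carrier F" for g
    using nf[OF that] by metis
  then show ?thesis using L(1) by blast
qed

section \<open>Cocompactness\<close>

text \<open>
  The union of all segments between orbit points is an invariant subtree, hence everything.
\<close>
lemma point_in_hull:
  assumes "z \<in> pts T"
  shows "\<exists>g\<in>carrier F. \<exists>h\<in>carrier F. R.gp z (orb g) (orb h) = 0"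
proof -
  define H where "H = {z \<in> pts T. \<exists>g\<in>carrier F. \<exists>h\<in>carrier F. R.gp z (orb g) (orb h) = 0}"
  (* Seen from z, a point x of the hull lies in the direction of an orbit point: x is on a segment
     between two orbit points, and if z separated x from both of them, it would be x itself. *)
  have end_pos: "\<exists>k\<in>carrier F. z = x \<or> 0 < R.gp z (orb k) x"
    if x: "x \<in> H" and z: "z \<in> pts T" for x z
  proof -
    obtain g h where gh: "g \<in> carrier F" "h \<in> carrier F" "R.gp x (orb g) (orb h) = 0" and xT: "x \<in> pts T"
      using x unfolding H_def by blast
    have o: "orb g \<in> pts T" "orb h \<in> pts T" using gh orb_closed by auto
    show ?thesis
    proof (cases "0 < R.gp z (orb g) x \<or> 0 < R.gp z (orb h) x")
      case False
      then have "R.gp z (orb g) x = 0" "R.gp z (orb h) x = 0"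
        using R.gp_nonneg[OF z o(1) xT] R.gp_nonneg[OF z o(2) xT] by linarith+
      then have "tdist T (orb g) z + tdist T z x = tdist T (orb g) x"
          "tdist T (orb h) z + tdist T z x = tdist T (orb h) x"
          "tdist T (orb g) x + tdist T x (orb h) = tdist T (orb g) (orb h)"
        using gh(3) R.between_gp[OF o(1) xT z] R.between_gp[OF o(2) xT z] R.between_gp[OF o xT] by auto
      then have "tdist T z x \<le> 0"
        using R.d_triangle[OF o(1) z o(2)] R.d_commute[OF z o(2)] R.d_commute[OF xT o(2)] by linarith
      then have "z = x" using R.d_eq_0[OF z xT] R.d_nonneg[OF z xT] by linarith
      then show ?thesis using gh by blast
    qed (use gh in blast)
  qed
  have "b \<in> H"
    using b R.gp_self[OF b b] R.d_self[OF b] one_closed act_one[OF b] unfolding H_def by force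
  moreover have "z \<in> H" if xy: "x \<in> H" "y \<in> H" "z \<in> pts T" "tdist T x z + tdist T z y = tdist T x y" for x y z
  proof (cases "z = x \<or> z = y")
    case False
    have xyT: "x \<in> pts T" "y \<in> pts T" using xy by (auto simp: H_def)
    obtain k where k: "k \<in> carrier F" "0 < R.gp z (orb k) x" using end_pos[OF xy(1,3)] False by blast
    obtain l where l: "l \<in> carrier F" "0 < R.gp z (orb l) y" using end_pos[OF xy(2,3)] False by blast
    have o: "orb k \<in> pts T" "orb l \<in> pts T" using k l orb_closed by auto
    have "R.gp z x y = 0" using R.between_gp[OF xyT xy(3)] xy(4) by blast
    then have "R.gp z (orb k) y \<le> 0"
      using R.gp_min[OF xy(3) xyT(1) o(1) xyT(2)] R.gp_commute[OF xyT(1) o(1), of z] k by linarith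
    then have "R.gp z (orb k) (orb l) \<le> 0"
      using R.gp_min[OF xy(3) o xyT(2)] l by linarith
    then have "R.gp z (orb k) (orb l) = 0" using R.gp_nonneg[OF xy(3) o] by linarith
    then show ?thesis using xy(3) k l unfolding H_def by blast
  qed (use xy in blast)
  ultimately have "subtree (pts T) (tdist T) H"
    unfolding subtree_def H_def by blast
  moreover have "act T g ` H \<subseteq> H" if g: "g \<in> carrier F" for g
  proof
    fix z assume "z \<in> act T g ` H"
    then obtain x where x: "x \<in> H" "z = act T g x" by blast
    obtain k l where kl: "k \<in> carrier F" "l \<in> carrier F" "R.gp x (orb k) (orb l) = 0" "x \<in> pts T"
      using x unfolding H_def by blast
    have "R.gp z (orb (g \<otimes> k)) (orb (g \<otimes> l)) = 0"
      using act_gp[OF g orb_closed[OF kl(1)] orb_closed[OF kl(2)] kl(4)] kl g b x act_mult by simp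
    then show "z \<in> H" using x kl g act_closed unfolding H_def by blast
  qed
  ultimately have "H = pts T"
    using cv unfolding cv_trees_def minimal_action_def by blast
  then show ?thesis using assms unfolding H_def by blast
qed

text \<open>
  Connect two orbit points with the given point between them by the chain of the prefixes of a
  word; one of its jumps crosses the point.
\<close>
lemma point_on_short_segment:
  assumes z: "z \<in> pts T"
  shows "\<exists>g\<in>carrier F. \<exists>h\<in>carrier F. length (nf h) \<le> 1 \<and> R.gp z (orb g) (orb (g \<otimes> h)) = 0"
proof -
  obtain g h where gh: "g \<in> carrier F" "h \<in> carrier F" "R.gp z (orb g) (orb h) = 0"
    using point_in_hull[OF z] by blast
  obtain n c where c: "c 0 = g" "c n = h" "c ` {..n} \<subseteq> carrier F"
    "\<forall>i\<le>n. \<forall>j\<le>n. \<bar>word_dist F X (c i) (c j) - \<bar>real i - real j\<bar>\<bar> \<le> 0"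
    using coarse_geodesic_word gh(1,2) unfolding coarse_geodesic_def by blast
  show ?thesis
  proof (cases n)
    case 0
    then show ?thesis using gh c nf_one one_closed by (intro bexI[of _ g] bexI[of _ "\<one>"]) auto
  next
    case (Suc m)
    have cF: "c i \<in> carrier F" if "i \<le> n" for i using c(3) that by blast
    have "\<exists>i\<le>m. R.gp z (orb (c i)) (orb (c (Suc i))) = 0"
      by (rule R.chain_meets[of m "\<lambda>i. orb (c i)"]) (use cF orb_closed Suc z gh c in auto)
    then obtain i where i: "i \<le> m" "R.gp z (orb (c i)) (orb (c (Suc i))) = 0" by blast
    have ci: "c i \<in> carrier F" "c (Suc i) \<in> carrier F" using cF i Suc by auto
    have "word_dist F X (c i) (c (Suc i)) \<le> 1" using c(4)[rule_format, of i "Suc i"] i Suc by auto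
    then have "length (nf (inv (c i) \<otimes> c (Suc i))) \<le> 1"
      using ci by (simp add: word_dist_def word_length_nf)
    moreover have "c i \<otimes> (inv (c i) \<otimes> c (Suc i)) = c (Suc i)" using ci by (simp add: m_assoc[symmetric])
    ultimately show ?thesis using i(2) ci
      by (intro bexI[of _ "c i"] bexI[of _ "inv (c i) \<otimes> c (Suc i)"]) auto
  qed
qed

text \<open>
  Finite nets with small mesh and the one-point net \<open>{b}\<close> are both used. The base point is included
  so that chains along a geodesic between orbit points can start with the orbit point itself.
\<close>
definition net :: "real \<Rightarrow> 'a set \<Rightarrow> bool" where
  "net \<eta> N \<longleftrightarrow> N \<subseteq> pts T \<and> b \<in> N \<and> 0 \<le> \<eta> \<and> (\<forall>z\<in>pts T. \<exists>g\<in>carrier F. \<exists>y\<in>N. tdist T z (act T g y) \<le> \<eta>)"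

lemma ex_net_base: "\<exists>D. net D {b}"
proof -
  obtain L where L: "L > 0" "\<forall>g\<in>carrier F. od \<one> g \<le> L * real (length (nf g))"
    using ex_od_le_word_length by blast
  have "\<exists>g\<in>carrier F. tdist T z (orb g) \<le> L" if z: "z \<in> pts T" for z
  proof -
    obtain g h where gh: "g \<in> carrier F" "h \<in> carrier F" "length (nf h) \<le> 1"
      "R.gp z (orb g) (orb (g \<otimes> h)) = 0"
      using point_on_short_segment[OF z] by blast
    have o: "orb g \<in> pts T" "orb (g \<otimes> h) \<in> pts T" using gh orb_closed by auto
    have "tdist T z (orb g) \<le> tdist T (orb g) (orb (g \<otimes> h))"
      using gh(4) R.d_nonneg[OF z o(2)] R.between_gp[OF o z] R.d_commute[OF z o(1)] by linarith
    also have "\<dots> = od \<one> h" using od_translate[OF gh(1) one_closed gh(2)] gh(1) by (simp add: od_def)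
    also have "\<dots> \<le> L * real (length (nf h))" using L gh by blast
    also have "\<dots> \<le> L * 1" using L(1) gh(3) by (intro mult_left_mono) auto
    finally show ?thesis using gh by auto
  qed
  then have "net L {b}" using b L(1) unfolding net_def by simp
  then show ?thesis by blast
qed

text \<open>
  Follow the geodesic from \<open>u b\<close> to \<open>v b\<close> with steps of length \<open>\<sigma>\<close>, and replace each point by a
  nearby translate of a point of the net.
\<close>
lemma net_path:
  assumes net: "net \<eta> N" and uv: "u \<in> carrier F" "v \<in> carrier F" and \<sigma>: "0 < \<sigma>"
  defines "m \<equiv> nat \<lfloor>od u v / \<sigma>\<rfloor>"
  shows "\<exists>k y. k 0 = u \<and> y 0 = b \<and> (\<forall>i\<le>m. k i \<in> carrier F \<and> y i \<in> N) \<and>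
    (\<forall>i\<le>m. \<forall>j\<le>m. \<bar>tdist T (act T (k i) (y i)) (act T (k j) (y j)) - \<sigma> * \<bar>real i - real j\<bar>\<bar> \<le> 2 * \<eta>) \<and>
    (\<forall>i\<le>m. \<bar>tdist T (act T (k i) (y i)) (orb v) - (od u v - \<sigma> * real i)\<bar> \<le> \<eta>)"
proof -
  have o: "orb u \<in> pts T" "orb v \<in> pts T" using uv orb_closed by auto
  define l where "l = od u v"
  have l: "0 \<le> l" "l = tdist T (orb u) (orb v)" using R.d_nonneg[OF o] by (auto simp: l_def od_def)
  from R.geodesic[OF o, folded l(2)] obtain c where c: "c 0 = orb u \<and> c l = orb v \<and> c ` {0..l} \<subseteq> pts T \<and>
     (\<forall>s\<in>{0..l}. \<forall>t\<in>{0..l}. tdist T (c s) (c t) = \<bar>s - t\<bar>)" by (rule exE)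
  define z where "z i = c (\<sigma> * real i)" for i :: nat
  have t: "\<sigma> * real i \<in> {0..l}" if "i \<le> m" for i
  proof -
    have "real i \<le> real_of_int \<lfloor>l / \<sigma>\<rfloor>"
      using that l(1) \<sigma> unfolding m_def l_def[symmetric] by (simp add: le_nat_iff)
    then have "real i \<le> l / \<sigma>" by linarith
    then show ?thesis using \<sigma> by (simp add: field_simps)
  qed
  have z: "z i \<in> pts T" if "i \<le> m" for i using c t[OF that] unfolding z_def by blast
  have zz: "tdist T (z i) (z j) = \<sigma> * \<bar>real i - real j\<bar>" if "i \<le> m" "j \<le> m" for i j
  proof -
    have "tdist T (z i) (z j) = \<bar>\<sigma> * real i - \<sigma> * real j\<bar>"
      using c t[OF that(1)] t[OF that(2)] unfolding z_def by blast
    also have "\<dots> = \<bar>\<sigma> * (real i - real j)\<bar>" by (simp add: algebra_simps)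
    finally show ?thesis using \<sigma> by (simp add: abs_mult)
  qed
  have zv: "tdist T (z i) (orb v) = l - \<sigma> * real i" if "i \<le> m" for i
  proof -
    have "l \<in> {0..l}" using l(1) by simp
    then have "tdist T (z i) (c l) = \<bar>\<sigma> * real i - l\<bar>"
      using c t[OF that] unfolding z_def by blast
    moreover have "c l = orb v" using c by blast
    ultimately show ?thesis using t[OF that] by simp
  qed
  have near: "\<forall>w\<in>pts T. \<exists>g y. g \<in> carrier F \<and> y \<in> N \<and> tdist T w (act T g y) \<le> \<eta>"
    using net unfolding net_def by blast
  from bchoice[OF near] obtain fg where
    "\<forall>w\<in>pts T. \<exists>y. fg w \<in> carrier F \<and> y \<in> N \<and> tdist T w (act T (fg w) y) \<le> \<eta>" by (rule exE)
  from bchoice[OF this] obtain fy where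
    f: "\<forall>w\<in>pts T. fg w \<in> carrier F \<and> fy w \<in> N \<and> tdist T w (act T (fg w) (fy w)) \<le> \<eta>" by (rule exE)
  define k y where "k i = (if i = 0 then u else fg (z i))" and "y i = (if i = 0 then b else fy (z i))" for i
  have z0: "z 0 = orb u" using c by (simp add: z_def)
  have ky: "k i \<in> carrier F" "y i \<in> N" "tdist T (z i) (act T (k i) (y i)) \<le> \<eta>" if "i \<le> m" for i
  proof -
    have "k i \<in> carrier F \<and> y i \<in> N \<and> tdist T (z i) (act T (k i) (y i)) \<le> \<eta>"
    proof (cases "i = 0")
      case True
      then show ?thesis using uv(1) net z0 R.d_self[OF o(1)] by (simp add: k_def y_def net_def)
    next
      case False
      then show ?thesis using bspec[OF f z[OF that]] by (simp add: k_def y_def)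
    qed
    then show "k i \<in> carrier F" "y i \<in> N" "tdist T (z i) (act T (k i) (y i)) \<le> \<eta>" by blast+
  qed
  have w: "act T (k i) (y i) \<in> pts T" if "i \<le> m" for i
    using ky[OF that] net act_closed unfolding net_def by blast
  have 1: "\<bar>tdist T (act T (k i) (y i)) (act T (k j) (y j)) - \<sigma> * \<bar>real i - real j\<bar>\<bar> \<le> 2 * \<eta>"
    if i: "i \<le> m" and j: "j \<le> m" for i j
    using R.d_triangle[OF w[OF i] z[OF i] w[OF j]] R.d_triangle[OF z[OF i] z[OF j] w[OF j]]
      R.d_triangle[OF z[OF i] w[OF i] z[OF j]] R.d_triangle[OF w[OF i] w[OF j] z[OF j]]
      R.d_commute[OF w[OF i] z[OF i]] R.d_commute[OF w[OF j] z[OF j]] ky(3)[OF i] ky(3)[OF j] zz[OF i j]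
    by linarith
  have 2: "\<bar>tdist T (act T (k i) (y i)) (orb v) - (l - \<sigma> * real i)\<bar> \<le> \<eta>" if i: "i \<le> m" for i
    using R.d_triangle[OF w[OF i] z[OF i] o(2)] R.d_triangle[OF z[OF i] w[OF i] o(2)]
      R.d_commute[OF w[OF i] z[OF i]] ky(3)[OF i] zv[OF i] by linarith
  have "k 0 = u" "y 0 = b" by (simp_all add: k_def y_def)
  then show ?thesis using ky 1 2 unfolding l_def by blast
qed

text \<open>
  Unit steps with the net \<open>{b}\<close>. The remainder of the geodesic, which is shorter than 1, is covered by
  one more step.
\<close>
lemma ex_coarse_geodesic_od: "\<exists>D. coarse_geodesic (carrier F) od D"
proof -
  obtain D where D: "net D {b}" using ex_net_base by blast
  have D0: "0 \<le> D" using D by (simp add: net_def)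
  have "coarse_geodesic (carrier F) od (2 * D + 1)"
    unfolding coarse_geodesic_def
  proof (intro conjI ballI)
    fix u v assume uv: "u \<in> carrier F" "v \<in> carrier F"
    define m where "m = nat \<lfloor>od u v / 1\<rfloor>"
    obtain k y where k: "k 0 = u" "\<forall>i\<le>m. k i \<in> carrier F \<and> y i \<in> {b}"
      "\<forall>i\<le>m. \<forall>j\<le>m. \<bar>tdist T (act T (k i) (y i)) (act T (k j) (y j)) - 1 * \<bar>real i - real j\<bar>\<bar> \<le> 2 * D"
      "\<forall>i\<le>m. \<bar>tdist T (act T (k i) (y i)) (orb v) - (od u v - 1 * real i)\<bar> \<le> D"
      using net_path[OF D uv zero_less_one] unfolding m_def by blast
    have k3: "\<bar>od (k i) (k j) - \<bar>real i - real j\<bar>\<bar> \<le> 2 * D" if "i \<le> m" "j \<le> m" for i j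
      using k(2,3) that unfolding od_def by fastforce
    have k4: "\<bar>od (k i) v - (od u v - real i)\<bar> \<le> D" if "i \<le> m" for i
      using k(2,4) that unfolding od_def by fastforce
    have m: "\<bar>od u v - (real m + 1)\<bar> \<le> 1"
      using om.d_nonneg[OF uv] unfolding m_def by linarith
    define c where "c i = (if i \<le> m then k i else v)" for i
    have kv: "\<bar>od (k i) v - \<bar>real i - (real m + 1)\<bar>\<bar> \<le> 2 * D + 1" if "i \<le> m" for i
      using k4[OF that] m that D0 by linarith
    have vk: "od v (k i) = od (k i) v" if "i \<le> m" for i using om.d_commute uv k(2) that by blast
    have vv: "od v v = 0" using om.d_self uv by blast
    have "\<bar>od (c i) (c j) - \<bar>real i - real j\<bar>\<bar> \<le> 2 * D + 1" if ij: "i \<le> Suc m" "j \<le> Suc m" for i j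
    proof -
      consider "i \<le> m" "j \<le> m" | "i \<le> m" "j = Suc m" | "i = Suc m" "j \<le> m" | "i = Suc m" "j = Suc m"
        using ij by linarith
      then show ?thesis
      proof cases
        case 1 then show ?thesis using k3[of i j] by (simp add: c_def)
      next
        case 2 then show ?thesis using kv[of i] by (simp add: c_def)
      next
        case 3 then show ?thesis using kv[of j] vk[of j] by (simp add: c_def abs_minus_commute)
      next
        case 4 then show ?thesis using vv D0 by (simp add: c_def)
      qed
    qed
    moreover have "c 0 = u" "c (Suc m) = v" using k by (auto simp: c_def)
    moreover have "c ` {..Suc m} \<subseteq> carrier F" using k(2) uv by (auto simp: c_def)
    ultimately show "\<exists>n c. c 0 = u \<and> c n = v \<and> c ` {..n} \<subseteq> carrier F \<and>
       (\<forall>i\<le>n. \<forall>j\<le>n. \<bar>od (c i) (c j) - \<bar>real i - real j\<bar>\<bar> \<le> 2 * D + 1)" by blast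
  qed (use D0 in simp)
  then show ?thesis by blast
qed

section \<open>Proper discontinuity and quasi-isometry\<close>

text \<open>
  Discreteness isolates \<open>z\<close> in its orbit, and by freeness only \<open>\<one>\<close> fixes \<open>z\<close>.
\<close>
lemma point_separated:
  assumes z: "z \<in> pts T"
  shows "\<exists>r>0. \<forall>g\<in>carrier F. g \<noteq> \<one> \<longrightarrow> r \<le> tdist T z (act T g z)"
proof -
  interpret Met: Metric_space "pts T" "tdist T" using R.real_tree by (simp add: real_tree_def)
  have "subtopology Met.mtopology (orbit F (act T) z) = discrete_topology (orbit F (act T) z)"
    using cv z unfolding cv_trees_def discrete_action_def by blast
  moreover have zO: "z \<in> orbit F (act T) z" using act_one[OF z] one_closed unfolding orbit_def by force
  ultimately have "openin (subtopology Met.mtopology (orbit F (act T) z)) {z}" by simp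
  then obtain U where U: "openin Met.mtopology U" "{z} = U \<inter> orbit F (act T) z"
    unfolding openin_subtopology by blast
  then obtain r where r: "r > 0" "Met.mball z r \<subseteq> U"
    unfolding Met.openin_mtopology by blast
  have "r \<le> tdist T z (act T g z)" if g: "g \<in> carrier F" "g \<noteq> \<one>" for g
  proof (rule ccontr)
    assume "\<not> ?thesis"
    then have "act T g z \<in> Met.mball z r" using z act_closed g by (simp add: Met.in_mball)
    moreover have "act T g z \<in> orbit F (act T) z" using g unfolding orbit_def by blast
    ultimately have "act T g z = z" using r U by blast
    then show False using act_free g z by blast
  qed
  then show ?thesis using r by blast
qed

lemma segment_point_unique:
  assumes "x \<in> pts T" "y \<in> pts T" "z \<in> pts T" "z' \<in> pts T" "R.gp z x y = 0" "R.gp z' x y = 0"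
    "tdist T x z = tdist T x z'"
  shows "z = z'"
proof -
  have "tdist T x z + tdist T z y = tdist T x y" "tdist T x z' + tdist T z' y = tdist T x y"
    using R.between_gp assms by blast+
  then have "R.gp x z y = tdist T x z" "R.gp x y z' = tdist T x z"
    using assms R.d_commute[of z' y] unfolding gromov_prod_def by (auto simp: field_simps)
  then have "tdist T x z \<le> R.gp x z z'" using R.gp_min[of x z y z'] assms by auto
  then have "tdist T z z' \<le> 0" using assms(7) unfolding gromov_prod_def by (simp add: field_simps)
  then show ?thesis using R.d_eq_0 R.d_nonneg assms by (metis order_antisym)
qed

lemma short_segment_param:
  assumes h: "h \<in> carrier F"
  obtains c where "c ` {0..od \<one> h} \<subseteq> pts T"
    "\<forall>s\<in>{0..od \<one> h}. \<forall>t\<in>{0..od \<one> h}. tdist T (c s) (c t) = \<bar>s - t\<bar>"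
    "\<forall>z\<in>pts T. R.gp z b (orb h) = 0 \<longrightarrow> (\<exists>t\<in>{0..od \<one> h}. z = c t)"
proof -
  define l where "l = od \<one> h"
  have o: "b \<in> pts T" "orb h \<in> pts T" using b h orb_closed by auto
  have l: "l = tdist T b (orb h)" using act_one b by (simp add: l_def od_def)
  from R.geodesic[OF o, folded l] obtain c where c: "c 0 = b \<and> c l = orb h \<and> c ` {0..l} \<subseteq> pts T \<and>
     (\<forall>s\<in>{0..l}. \<forall>t\<in>{0..l}. tdist T (c s) (c t) = \<bar>s - t\<bar>)" by (rule exE)
  have l0: "0 \<le> l" using R.d_nonneg o l by simp
  have "\<exists>t\<in>{0..l}. z = c t" if z: "z \<in> pts T" "R.gp z b (orb h) = 0" for z
  proof -
    define t where "t = tdist T b z"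
    have "t + tdist T z (orb h) = l" using R.between_gp[OF o z(1)] z(2) l by (simp add: t_def)
    then have t: "t \<in> {0..l}" using R.d_nonneg[OF z(1) o(2)] R.d_nonneg[OF o(1) z(1)] by (auto simp: t_def)
    have ct: "c t \<in> pts T" using c t by blast
    have "0 \<in> {0..l}" "l \<in> {0..l}" using l0 by simp_all
    then have d1: "tdist T (c 0) (c t) = \<bar>0 - t\<bar>" "tdist T (c t) (c l) = \<bar>t - l\<bar>"
      using c t by blast+
    then have d2: "tdist T b (c t) = t" "tdist T (c t) (orb h) = l - t"
      using d1 t unfolding c[THEN conjunct1] c[THEN conjunct2, THEN conjunct1] by simp_all
    then have "R.gp (c t) b (orb h) = 0" using R.between_gp[OF o ct] l by simp
    moreover have "tdist T b z = tdist T b (c t)" by (rule trans[OF t_def[symmetric] d2(1)[symmetric]])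
    ultimately have "z = c t" by (rule segment_point_unique[OF o z(1) ct z(2)])
    then show ?thesis using t by blast
  qed
  then have "\<forall>z\<in>pts T. R.gp z b (orb h) = 0 \<longrightarrow> (\<exists>t\<in>{0..l}. z = c t)" by blast
  then show ?thesis
    by (rule that[of c, folded l_def, rotated 2]) (use c in blast)+
qed

lemma move_to_base_segment:
  assumes z: "z \<in> pts T"
  obtains g h where "g \<in> carrier F" "h \<in> carrier F" "length (nf h) \<le> 1" "R.gp (act T (inv g) z) b (orb h) = 0"
proof -
  obtain g h where gh: "g \<in> carrier F" "h \<in> carrier F" "length (nf h) \<le> 1"
    "R.gp z (orb g) (orb (g \<otimes> h)) = 0" using point_on_short_segment[OF z] by blast
  have "R.gp (act T (inv g) z) (act T (inv g) (orb g)) (act T (inv g) (orb (g \<otimes> h))) = 0"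
    using act_gp[OF inv_closed[OF gh(1)] orb_closed orb_closed z] gh by simp
  then have "R.gp (act T (inv g) z) b (orb h) = 0"
    using act_inv[OF gh(1) b] act_inv[OF gh(1) orb_closed[OF gh(2)]] act_mult[OF gh(1,2) b] by simp
  then show ?thesis using that gh by blast
qed

text \<open>
  The displacement of \<open>z\<close> by a group element is a 2-Lipschitz function of \<open>z\<close>, so the separation of
  one point carries over to a neighbourhood with half the constant. Finitely many segments, which
  are compact, meet all orbits.
\<close>
lemma uniformly_separated:
  "\<exists>\<rho>>0. \<forall>z\<in>pts T. \<forall>g\<in>carrier F. g \<noteq> \<one> \<longrightarrow> \<rho> \<le> tdist T z (act T g z)"
proof -
  define sep where "sep \<rho> z \<longleftrightarrow> (\<forall>g\<in>carrier F. g \<noteq> \<one> \<longrightarrow> \<rho> \<le> tdist T z (act T g z))" for \<rho> z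
  define S where "S = {h \<in> carrier F. length (nf h) \<le> 1}"
  have "\<exists>\<rho>>0. \<forall>z\<in>pts T. R.gp z b (orb h) = 0 \<longrightarrow> sep \<rho> z" if h: "h \<in> S" for h
  proof -
    have hF: "h \<in> carrier F" using h by (simp add: S_def)
    define l where "l = od \<one> h"
    obtain c where c: "c ` {0..l} \<subseteq> pts T" "\<forall>s\<in>{0..l}. \<forall>t\<in>{0..l}. tdist T (c s) (c t) = \<bar>s - t\<bar>"
       "\<forall>z\<in>pts T. R.gp z b (orb h) = 0 \<longrightarrow> (\<exists>t\<in>{0..l}. z = c t)"
      using short_segment_param[OF hF] unfolding l_def by blast
    have "\<forall>t\<in>{0..l}. \<exists>r>0. sep r (c t)"
      using point_separated c(1) unfolding sep_def by blast
    from bchoice[OF this] obtain r where r: "\<forall>t\<in>{0..l}. 0 < r t \<and> sep (r t) (c t)" by (rule exE)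
    have cover: "{0..l} \<subseteq> (\<Union>t\<in>{0..l}. ball t (r t / 4))" using r by auto
    obtain C where C: "C \<subseteq> {0..l}" "finite C" "{0..l} \<subseteq> (\<Union>t\<in>C. ball t (r t / 4))"
      by (rule compactE_image[OF compact_Icc open_ball cover])
    define \<rho> where "\<rho> = Min (insert 1 (r ` C)) / 2"
    have \<rho>: "\<rho> > 0" using C r unfolding \<rho>_def by (subst half_gt_zero_iff, subst Min_gr_iff) auto
    have \<rho>t: "\<rho> \<le> r t / 2" if "t \<in> C" for t
      unfolding \<rho>_def using C(2) that by (intro divide_right_mono Min_le) auto
    have "sep \<rho> (c s)" if s: "s \<in> {0..l}" for s
      unfolding sep_def
    proof (intro ballI impI)
      fix g assume g: "g \<in> carrier F" "g \<noteq> \<one>"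
      obtain t where t: "t \<in> C" "s \<in> ball t (r t / 4)" using C(3) s by blast
      have tl: "t \<in> {0..l}" using t C by blast
      have P: "c s \<in> pts T" "c t \<in> pts T" "act T g (c s) \<in> pts T" "act T g (c t) \<in> pts T"
        using c(1) s tl g act_closed by blast+
      have "tdist T (c t) (c s) = \<bar>t - s\<bar>" using c(2) s tl by blast
      then have d: "tdist T (c t) (c s) < r t / 4" using t(2) by (simp add: dist_real_def)
      have "r t \<le> tdist T (c t) (act T g (c t))" using r tl g unfolding sep_def by blast
      moreover have "tdist T (act T g (c s)) (act T g (c t)) = tdist T (c t) (c s)"
        using act_isometry[OF g(1) P(1,2)] R.d_commute[OF P(1,2)] by simp
      ultimately have "r t \<le> tdist T (c s) (act T g (c s)) + r t / 2"
        using R.d_triangle[OF P(2,1,4)] R.d_triangle[OF P(1,3,4)] d by linarith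
      then show "\<rho> \<le> tdist T (c s) (act T g (c s))" using \<rho>t[OF t(1)] by linarith
    qed
    then have "\<forall>z\<in>pts T. R.gp z b (orb h) = 0 \<longrightarrow> sep \<rho> z" using c(3) by blast
    then show ?thesis using \<rho> by blast
  qed
  then have "\<forall>h\<in>S. \<exists>\<rho>>0. \<forall>z\<in>pts T. R.gp z b (orb h) = 0 \<longrightarrow> sep \<rho> z" by blast
  from bchoice[OF this] obtain \<rho>s where
    \<rho>s': "\<forall>h\<in>S. 0 < \<rho>s h \<and> (\<forall>z\<in>pts T. R.gp z b (orb h) = 0 \<longrightarrow> sep (\<rho>s h) z)" by (rule exE)
  note \<rho>s = bspec[OF \<rho>s']
  define \<rho> where "\<rho> = Min (insert 1 (\<rho>s ` S))"
  have fin: "finite S" unfolding S_def by (rule finite_word_ball)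
  have \<rho>: "\<rho> > 0" using fin \<rho>s unfolding \<rho>_def by (subst Min_gr_iff) auto
  have "\<rho> \<le> tdist T z (act T k z)" if z: "z \<in> pts T" and k: "k \<in> carrier F" "k \<noteq> \<one>" for z k
  proof -
    obtain g h where gh: "g \<in> carrier F" "h \<in> carrier F" "length (nf h) \<le> 1" "R.gp (act T (inv g) z) b (orb h) = 0"
      using move_to_base_segment[OF z] by blast
    define y where "y = act T (inv g) z"
    have y: "y \<in> pts T" using act_closed gh z by (simp add: y_def)
    have hS: "h \<in> S" using gh by (simp add: S_def)
    have sepy: "sep (\<rho>s h) y" using \<rho>s[OF hS] gh(4) y unfolding y_def by blast
    define k' where "k' = inv g \<otimes> k \<otimes> g"
    have k': "k' \<in> carrier F" using k gh by (simp add: k'_def)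
    have "k = \<one>" if "k' = \<one>"
    proof -
      have "g \<otimes> k' \<otimes> inv g = k" using k gh by (simp add: k'_def m_assoc) (simp add: m_assoc[symmetric])
      then show ?thesis using that gh by simp
    qed
    then have "\<rho>s h \<le> tdist T y (act T k' y)" using sepy k' k unfolding sep_def by blast
    also have "act T k' y = act T (inv g) (act T k z)"
      using gh k z y by (simp add: k'_def act_mult y_def act_inv' act_closed)
    then have "tdist T y (act T k' y) = tdist T z (act T k z)"
      using act_isometry[OF inv_closed[OF gh(1)] z act_closed[OF k(1) z]] by (simp add: y_def)
    finally have "\<rho>s h \<le> tdist T z (act T k z)" .
    moreover have "\<rho> \<le> \<rho>s h" unfolding \<rho>_def using fin hS by (intro Min_le) auto
    ultimately show ?thesis by linarith
  qed
  then show ?thesis using \<rho> by blast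
qed

lemma ex_finite_net:
  assumes \<eta>: "0 < \<eta>"
  shows "\<exists>N. finite N \<and> net \<eta> N"
proof -
  define S where "S = {h \<in> carrier F. length (nf h) \<le> 1}"
  have fin: "finite S" unfolding S_def by (rule finite_word_ball)
  have "\<exists>N. finite N \<and> N \<subseteq> pts T \<and> (\<forall>z\<in>pts T. R.gp z b (orb h) = 0 \<longrightarrow> (\<exists>y\<in>N. tdist T z y \<le> \<eta>))"
    if h: "h \<in> S" for h
  proof -
    have hF: "h \<in> carrier F" using h by (simp add: S_def)
    define l where "l = od \<one> h"
    obtain c where c: "c ` {0..l} \<subseteq> pts T" "\<forall>s\<in>{0..l}. \<forall>t\<in>{0..l}. tdist T (c s) (c t) = \<bar>s - t\<bar>"
       "\<forall>z\<in>pts T. R.gp z b (orb h) = 0 \<longrightarrow> (\<exists>t\<in>{0..l}. z = c t)"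
      using short_segment_param[OF hF] unfolding l_def by blast
    define I where "I = (\<lambda>i. \<eta> * real i) ` {..nat \<lfloor>l / \<eta>\<rfloor>} \<inter> {0..l}"
    have I: "finite (c ` I)" "c ` I \<subseteq> pts T" using c(1) unfolding I_def by auto
    have near: "\<exists>y\<in>c ` I. tdist T z y \<le> \<eta>" if z: "z \<in> pts T" "R.gp z b (orb h) = 0" for z
    proof -
      obtain t where t: "t \<in> {0..l}" "z = c t" using c(3) z by blast
      define i where "i = nat \<lfloor>t / \<eta>\<rfloor>"
      have "0 \<le> t / \<eta>" using t \<eta> by simp
      then have "real i \<le> t / \<eta>" "t / \<eta> \<le> real i + 1" unfolding i_def by linarith+
      then have i: "\<eta> * real i \<le> t" "t \<le> \<eta> * real i + \<eta>" using \<eta> by (simp_all add: field_simps)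
      have "i \<le> nat \<lfloor>l / \<eta>\<rfloor>" unfolding i_def using t \<eta> by (intro nat_mono floor_mono divide_right_mono) auto
      then have iI: "\<eta> * real i \<in> I" using i(1) t \<eta> unfolding I_def by auto
      then have "tdist T z (c (\<eta> * real i)) = \<bar>t - \<eta> * real i\<bar>" using c(2) t unfolding I_def by blast
      then have "tdist T z (c (\<eta> * real i)) \<le> \<eta>" using i by linarith
      then show ?thesis using iI by blast
    qed
    show ?thesis by (intro exI[of _ "c ` I"] conjI ballI impI I near)
  qed
  then have "\<forall>h\<in>S. \<exists>N. finite N \<and> N \<subseteq> pts T \<and> (\<forall>z\<in>pts T. R.gp z b (orb h) = 0 \<longrightarrow> (\<exists>y\<in>N. tdist T z y \<le> \<eta>))"
    by blast
  from bchoice[OF this] obtain f where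
    f': "\<forall>h\<in>S. finite (f h) \<and> f h \<subseteq> pts T \<and> (\<forall>z\<in>pts T. R.gp z b (orb h) = 0 \<longrightarrow> (\<exists>y\<in>f h. tdist T z y \<le> \<eta>))"
    by (rule exE)
  note f = bspec[OF f']
  define N where "N = insert b (\<Union>(f ` S))"
  have "\<exists>g\<in>carrier F. \<exists>y\<in>N. tdist T z (act T g y) \<le> \<eta>" if z: "z \<in> pts T" for z
  proof -
    obtain g h where gh: "g \<in> carrier F" "h \<in> carrier F" "length (nf h) \<le> 1" "R.gp (act T (inv g) z) b (orb h) = 0"
      using move_to_base_segment[OF z] by blast
    have hS: "h \<in> S" using gh by (simp add: S_def)
    have z': "act T (inv g) z \<in> pts T" using act_closed gh z by simp
    note fh = f[OF hS, THEN conjunct2, THEN conjunct1] f[OF hS, THEN conjunct2, THEN conjunct2]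
    obtain y where y: "y \<in> f h" "tdist T (act T (inv g) z) y \<le> \<eta>"
      using bspec[OF fh(2) z'] gh(4) by blast
    have yT: "y \<in> pts T" using fh(1) y by blast
    have "tdist T z (act T g y) = tdist T (act T (inv g) z) y"
      using act_isometry[OF gh(1) z' yT] act_inv'[OF gh(1) z] by simp
    then have "tdist T z (act T g y) \<le> \<eta>" using y(2) by simp
    moreover have "y \<in> N" using y(1) hS unfolding N_def by blast
    ultimately show ?thesis using gh(1) by blast
  qed
  moreover have "finite N" using fin f' unfolding N_def by simp
  moreover have "N \<subseteq> pts T"
  proof -
    have "f h \<subseteq> pts T" if "h \<in> S" for h by (rule f[OF that, THEN conjunct2, THEN conjunct1])
    then show ?thesis using b unfolding N_def by blast
  qed
  moreover have "b \<in> N" by (simp add: N_def)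
  ultimately show ?thesis using \<eta> unfolding net_def by (meson less_imp_le)
qed

text \<open>
  The lemma of Milnor and Svarc. Consecutive points of a chain along a geodesic from \<open>b\<close> to \<open>g b\<close>
  differ by one of finitely many group elements, because a translate of a point of the finite net is
  determined by its position up to the separation constant. So the word length grows by a bounded
  amount with each step.
\<close>
lemma ex_word_length_le_od: "\<exists>K>0. \<forall>g\<in>carrier F. real (length (nf g)) \<le> K * od \<one> g + K"
proof -
  obtain \<rho> where \<rho>: "\<rho> > 0" "\<forall>z\<in>pts T. \<forall>g\<in>carrier F. g \<noteq> \<one> \<longrightarrow> \<rho> \<le> tdist T z (act T g z)"
    using uniformly_separated by blast
  (* Two translates of a net point within 3 \<eta> of the same point are within 6 \<eta> < \<rho> of each other,
     hence equal. *)
  define \<eta> where "\<eta> = \<rho> / 8"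
  have \<eta>: "0 < \<eta>" "6 * \<eta> < \<rho>" using \<rho> by (auto simp: \<eta>_def)
  obtain N where N: "finite N" "net \<eta> N" using ex_finite_net[OF \<eta>(1)] by blast
  have NT: "N \<subseteq> pts T" "b \<in> N" using N by (auto simp: net_def)
  define P where "P y y' = {k \<in> carrier F. tdist T y (act T k y') \<le> 3 * \<eta>}" for y y'
  have fin1: "finite (P y y')" if y: "y \<in> N" "y' \<in> N" for y y'
  proof -
    have yT: "y \<in> pts T" "y' \<in> pts T" using y NT by auto
    have "k = k'" if k: "k \<in> P y y'" "k' \<in> P y y'" for k k'
    proof -
      have kF: "k \<in> carrier F" "k' \<in> carrier F" using k by (auto simp: P_def)
      have A: "act T k y' \<in> pts T" "act T k' y' \<in> pts T" using kF yT act_closed by auto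
      have "tdist T (act T k y') (act T k' y') \<le> 6 * \<eta>"
        using R.d_triangle[OF A(1) yT(1) A(2)] R.d_commute[OF A(1) yT(1)] k by (auto simp: P_def)
      moreover have "tdist T (act T k y') (act T k' y') = tdist T y' (act T (inv k \<otimes> k') y')"
        using act_isometry[OF inv_closed[OF kF(1)] A] kF yT by (simp add: act_inv act_mult)
      ultimately have "tdist T y' (act T (inv k \<otimes> k') y') < \<rho>" using \<eta>(2) by linarith
      moreover have "inv k \<otimes> k' \<in> carrier F" using kF by simp
      ultimately have "inv k \<otimes> k' = \<one>" using \<rho>(2) yT(2) by (meson not_le)
      then have "k \<otimes> (inv k \<otimes> k') = k" using kF by simp
      then show "k = k'" using kF by (simp add: m_assoc[symmetric])
    qed
    then show ?thesis
    proof (cases "P y y' = {}")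
      case False
      then obtain k where "k \<in> P y y'" by blast
      then have "P y y' \<subseteq> {k}" using \<open>\<And>k k'. k \<in> P y y' \<Longrightarrow> k' \<in> P y y' \<Longrightarrow> k = k'\<close> by blast
      then show ?thesis by (rule finite_subset) simp
    qed simp
  qed
  define S where "S = (\<Union>y\<in>N. \<Union>y'\<in>N. P y y')"
  have "finite S" unfolding S_def using N(1) fin1 by blast
  then have "finite ((\<lambda>k. real (length (nf k))) ` S)" by simp
  then obtain W0 where "\<forall>x\<in>(\<lambda>k. real (length (nf k))) ` S. x \<le> W0"
    using bdd_above_finite bdd_above_def by metis
  then have W0: "\<And>k. k \<in> S \<Longrightarrow> real (length (nf k)) \<le> W0" by blast
  define W where "W = max 1 W0"
  have W: "W \<ge> 1" "\<And>k. k \<in> S \<Longrightarrow> real (length (nf k)) \<le> W" using W0 unfolding W_def by fastforce+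
  have step: "word_dist F X u v \<le> W" if uv: "u \<in> carrier F" "v \<in> carrier F" "y \<in> N" "y' \<in> N"
     "tdist T (act T u y) (act T v y') \<le> 3 * \<eta>" for u v y y'
  proof -
    have yT: "y \<in> pts T" "y' \<in> pts T" using uv NT by auto
    have "tdist T y (act T (inv u \<otimes> v) y') = tdist T (act T u y) (act T v y')"
      using act_isometry[OF inv_closed[OF uv(1)] act_closed[OF uv(1) yT(1)] act_closed[OF uv(2) yT(2)]] uv yT
      by (simp add: act_inv act_mult)
    then have "inv u \<otimes> v \<in> P y y'" using uv by (simp add: P_def)
    then have "inv u \<otimes> v \<in> S" using uv unfolding S_def by blast
    then show ?thesis using W(2) uv by (simp add: word_dist_def word_length_nf)
  qed
  define K where "K = max W (W / \<eta>)"
  have "real (length (nf g)) \<le> K * od \<one> g + K" if g: "g \<in> carrier F" for g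
  proof -
    define m where "m = nat \<lfloor>od \<one> g / \<eta>\<rfloor>"
    obtain k y where k: "k 0 = \<one>" "\<forall>i\<le>m. k i \<in> carrier F \<and> y i \<in> N"
      "\<forall>i\<le>m. \<forall>j\<le>m. \<bar>tdist T (act T (k i) (y i)) (act T (k j) (y j)) - \<eta> * \<bar>real i - real j\<bar>\<bar> \<le> 2 * \<eta>"
      "\<forall>i\<le>m. \<bar>tdist T (act T (k i) (y i)) (orb g) - (od \<one> g - \<eta> * real i)\<bar> \<le> \<eta>"
      using net_path[OF N(2) one_closed g \<eta>(1)] unfolding m_def by blast
    have od0: "0 \<le> od \<one> g" using om.d_nonneg g by blast
    then have m: "real m \<le> od \<one> g / \<eta>" "od \<one> g / \<eta> \<le> real m + 1"
      using \<eta>(1) unfolding m_def by (simp_all add: of_nat_floor)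
    have m': "od \<one> g \<le> \<eta> * real m + \<eta>" using m(2) \<eta>(1) by (simp add: field_simps)
    have "word_dist F X (k i) (k (Suc i)) \<le> W" if "i < m" for i
    proof (rule step)
      show "tdist T (act T (k i) (y i)) (act T (k (Suc i)) (y (Suc i))) \<le> 3 * \<eta>"
        using k(3)[rule_format, of i "Suc i"] that by auto
    qed (use k(2) that in auto)
    then have 1: "word_dist F X (k 0) (k m) \<le> real m * W"
      using wd.chain_upper[of m k W] k(2) by blast
    have "tdist T (act T (k m) (y m)) (act T g b) \<le> 3 * \<eta>"
      using k(4)[rule_format, of m] m' by linarith
    then have 2: "word_dist F X (k m) g \<le> W" using step k(2) g NT(2) by blast
    have "word_dist F X \<one> g \<le> real m * W + W"
      using wd.d_triangle[OF one_closed _ g, of "k m"] 1 2 k(1,2) by auto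
    also have "\<dots> \<le> od \<one> g / \<eta> * W + W"
      using m(1) W(1) by (intro add_mono mult_right_mono) linarith+
    also have "\<dots> = (W / \<eta>) * od \<one> g + W" by simp
    also have "\<dots> \<le> K * od \<one> g + K" unfolding K_def using od0 by (intro add_mono mult_right_mono) auto
    finally show ?thesis using word_dist_one[OF g] by simp
  qed
  moreover have "K > 0" using W(1) unfolding K_def by auto
  ultimately show ?thesis by blast
qed

lemma finite_od_ball: "finite {g \<in> carrier F. od \<one> g \<le> r}"
proof -
  obtain K where K: "K > 0" "\<forall>g\<in>carrier F. real (length (nf g)) \<le> K * od \<one> g + K"
    using ex_word_length_le_od by blast
  have "{g \<in> carrier F. od \<one> g \<le> r} \<subseteq> {g \<in> carrier F. length (nf g) \<le> nat \<lceil>K * r + K\<rceil>}"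
  proof safe
    fix g assume g: "g \<in> carrier F" "od \<one> g \<le> r"
    then have "K * od \<one> g \<le> K * r" using K(1) by simp
    then have "real (length (nf g)) \<le> K * r + K" using K(2)[rule_format, OF g(1)] by linarith
    then show "length (nf g) \<le> nat \<lceil>K * r + K\<rceil>" by linarith
  qed
  then show ?thesis using finite_word_ball finite_subset by blast
qed

text \<open>
  Word metric and orbit metric are quasi-isometric, and both have coarse geodesics.
\<close>
lemma gp_comparable:
  "\<exists>K>0. \<forall>g\<in>carrier F. \<forall>h\<in>carrier F. \<forall>k\<in>carrier F.
    wd.gp k g h \<le> K * om.gp k g h + K \<and> om.gp k g h \<le> K * wd.gp k g h + K"
proof -
  obtain L where L: "L > 0" "\<forall>g\<in>carrier F. od \<one> g \<le> L * real (length (nf g))"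
    using ex_od_le_word_length by blast
  obtain K where K: "K > 0" "\<forall>g\<in>carrier F. real (length (nf g)) \<le> K * od \<one> g + K"
    using ex_word_length_le_od by blast
  define C where "C = max L K"
  have wd: "word_dist F X g h = real (length (nf (inv g \<otimes> h)))" if "g \<in> carrier F" "h \<in> carrier F" for g h
    using that by (simp add: word_dist_def word_length_nf)
  have 1: "od g h \<le> C * word_dist F X g h + C" if gh: "g \<in> carrier F" "h \<in> carrier F" for g h
  proof -
    have "od g h \<le> L * word_dist F X g h" using L(2) od_inv[OF gh] wd[OF gh] gh by (metis inv_closed m_closed)
    also have "\<dots> \<le> C * word_dist F X g h"
      using wd.d_nonneg[OF gh] unfolding C_def by (intro mult_right_mono) auto
    finally show ?thesis using L(1) unfolding C_def by linarith
  qed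
  have 2: "word_dist F X g h \<le> C * od g h + C" if gh: "g \<in> carrier F" "h \<in> carrier F" for g h
  proof -
    have "word_dist F X g h \<le> K * od g h + K" using K(2) od_inv[OF gh] wd[OF gh] gh by (metis inv_closed m_closed)
    also have "\<dots> \<le> C * od g h + C"
      using om.d_nonneg[OF gh] unfolding C_def by (intro add_mono mult_right_mono) auto
    finally show ?thesis .
  qed
  obtain D where D: "coarse_geodesic (carrier F) od D" using ex_coarse_geodesic_od by blast
  obtain A where A: "A > 0" "\<And>a b c. a \<in> carrier F \<Longrightarrow> b \<in> carrier F \<Longrightarrow> c \<in> carrier F \<Longrightarrow> wd.gp c a b \<le> A * om.gp c a b + A"
    using gromov_prod_quasi_isometry[OF om.tree_metric_axioms wd.tree_metric_axioms D 2 1] by blast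
  obtain B where B: "B > 0" "\<And>a b c. a \<in> carrier F \<Longrightarrow> b \<in> carrier F \<Longrightarrow> c \<in> carrier F \<Longrightarrow> om.gp c a b \<le> B * wd.gp c a b + B"
    using gromov_prod_quasi_isometry[OF wd.tree_metric_axioms om.tree_metric_axioms coarse_geodesic_word 1 2] by blast
  show ?thesis
  proof (intro exI[of _ "max A B"] conjI ballI)
    show "max A B > 0" using A(1) by simp
    fix g h k assume ghk: "g \<in> carrier F" "h \<in> carrier F" "k \<in> carrier F"
    have "A * om.gp k g h + A \<le> max A B * om.gp k g h + max A B"
      using om.gp_nonneg[OF ghk(3,1,2)] by (intro add_mono mult_right_mono) auto
    then show "wd.gp k g h \<le> max A B * om.gp k g h + max A B" using A(2)[OF ghk] by linarith
    have "B * wd.gp k g h + B \<le> max A B * wd.gp k g h + max A B"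
      using wd.gp_nonneg[OF ghk(3,1,2)] by (intro add_mono mult_right_mono) auto
    then show "om.gp k g h \<le> max A B * wd.gp k g h + max A B" using B(2)[OF ghk] by linarith
  qed
qed

end

context tree_metric
begin

text \<open>
  The point \<open>a\<close> branches off the segment \<open>[e, f]\<close> within distance \<open>c\<close> of \<open>e\<close>, and \<open>t\<close> within distance
  \<open>c\<close> of \<open>f\<close>. So \<open>[a, f]\<close> and \<open>[e, t]\<close> contain \<open>[x, y]\<close>, which has positive length, and can be joined.
\<close>
lemma trimmed_segment:
  assumes M: "e \<in> M" "f \<in> M" "x \<in> M" "y \<in> M" "a \<in> M" "t \<in> M"
    and x: "d e x = c" "d x f = d e f - c" and y: "d e y = d e f - c" "d y f = c"
    and xy: "d x y = d e f - 2 * c" "0 < d x y"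
    and a: "gp e a f \<le> c" and t: "gp f e t \<le> c"
  shows "d a x + d x y + d y t = d a t"
proof -
  have "gp f a e = d e f - gp e a f"
    using gp_sum[OF M(1,2,5)] gp_commute[OF M(5,2), of e] gp_commute[OF M(5,1), of f] by simp
  then have 1: "d e f - c \<le> gp f a e" using a by simp
  have 2: "gp f e x = d e f - c"
    using x d_commute[OF M(2,1)] d_commute[OF M(2,3)] by (simp add: gromov_prod_def)
  have "d e f - c \<le> gp f a x" using gp_min[OF M(2,5,1,3)] 1 2 by simp
  then have "d a x + d x f \<le> d a f"
    using x d_commute[OF M(2,3)] d_commute[OF M(2,5)] by (simp add: gromov_prod_def field_simps)
  then have ax: "d a x + d x y = d a y"
    using d_triangle[OF M(5,4,2)] d_triangle[OF M(5,3,4)] x y xy by linarith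
  have "gp e t f = d e f - gp f e t"
    using gp_sum[OF M(1,2,6)] gp_commute[OF M(2,6), of e] by simp
  then have 3: "d e f - c \<le> gp e t f" using t by simp
  have 4: "gp e f y = d e f - c"
    using y d_commute[OF M(2,4)] by (simp add: gromov_prod_def)
  have "d e f - c \<le> gp e t y" using gp_min[OF M(1,6,2,4)] 3 4 by simp
  then have "d e y + d y t \<le> d e t"
    using y d_commute[OF M(4,6)] by (simp add: gromov_prod_def field_simps)
  then have "d x y + d y t = d x t"
    using d_triangle[OF M(1,3,6)] d_triangle[OF M(3,4,6)] x y xy by linarith
  then show ?thesis using between_chain[OF M(5,3,4,6) ax] xy by simp
qed

end

context free_group
begin

section \<open>Translating boundary points\<close>

lemma bdry_rel_translate:
  assumes g: "g \<in> carrier F" and st: "(s, t) \<in> wrel"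
  shows "((\<lambda>i. g \<otimes> s i), (\<lambda>i. g \<otimes> t i)) \<in> wrel"
proof -
  have gp: "wd.gp g (g \<otimes> x) (g \<otimes> y) = wd.gp \<one> x y" if "x \<in> carrier F" "y \<in> carrier F" for x y
    using word_dist_translate[OF g one_closed] word_dist_translate[OF g that] that g
    by (simp add: gromov_prod_def)
  have agree: "wd.agree g r (\<lambda>i. g \<otimes> u i) (\<lambda>i. g \<otimes> v i) \<longleftrightarrow> wd.agree \<one> r u v"
    if "\<forall>i. u i \<in> carrier F" "\<forall>i. v i \<in> carrier F" for u v r
    using gp that unfolding wd.agree_def by simp
  have conv: "wconv (\<lambda>i. g \<otimes> u i)"
    if u: "wconv u" for u
  proof -
    have uF: "\<forall>i. u i \<in> carrier F" by (rule wd.conv_sub[OF u])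
    show ?thesis
      unfolding wd.conv_iff[OF g] agree[OF uF uF]
      using uF g wd.conv_agree[OF u one_closed] by simp
  qed
  have c: "wconv s" "wconv t"
    "\<forall>r. wd.agree \<one> r s t" using st unfolding wd.bdry_rel_iff[OF one_closed] by blast+
  show ?thesis
    unfolding wd.bdry_rel_iff[OF g] agree[OF wd.conv_sub[OF c(1)] wd.conv_sub[OF c(2)]]
    using conv[OF c(1)] conv[OF c(2)] c(3) by blast
qed

text \<open>
  Translation by \<open>g\<close> and by its inverse are isometries, so the image of the class of a sequence is the
  whole class of the translated sequence.
\<close>
lemma bdry_translate_closed:
  assumes g: "g \<in> carrier F" and p: "p \<in> bdry"
  shows "bdry_translate F g p \<in> bdry"
proof -
  obtain s where s: "s \<in> p" using wd.bdry_nonempty[OF p] by blast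
  have ps: "p = wrel `` {s}" by (rule wd.bdry_class_eq[OF p s])
  have sc: "wconv s" by (rule wd.bdry_conv[OF p s])
  have "bdry_translate F g p = wrel `` {\<lambda>i. g \<otimes> s i}"
  proof (intro equalityI subsetI)
    fix u assume "u \<in> bdry_translate F g p"
    then obtain t where t: "t \<in> p" "u = (\<lambda>i. g \<otimes> t i)" unfolding bdry_translate_def by blast
    then have "(s, t) \<in> wrel" using ps by blast
    from bdry_rel_translate[OF g this] show "u \<in> wrel `` {\<lambda>i. g \<otimes> s i}"
      using t(2) by blast
  next
    fix u assume u: "u \<in> wrel `` {\<lambda>i. g \<otimes> s i}"
    then have rel: "((\<lambda>i. g \<otimes> s i), u) \<in> wrel" by blast
    then have "wconv u" unfolding wd.bdry_rel_iff[OF one_closed] by blast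
    then have uF: "\<forall>i. u i \<in> carrier F" by (rule wd.conv_sub)
    have sF: "\<forall>i. s i \<in> carrier F" by (rule wd.conv_sub[OF sc])
    have "(\<lambda>i. inv g \<otimes> (g \<otimes> s i)) = s" using sF g by (simp add: m_assoc[symmetric])
    then have "(s, \<lambda>i. inv g \<otimes> u i) \<in> wrel"
      using bdry_rel_translate[OF inv_closed[OF g] rel] by simp
    then have mem: "(\<lambda>i. inv g \<otimes> u i) \<in> p" unfolding ps by blast
    have "u = (\<lambda>i. g \<otimes> (inv g \<otimes> u i))" using uF g by (simp add: m_assoc[symmetric])
    then show "u \<in> bdry_translate F g p" unfolding bdry_translate_def by (rule image_eqI[OF _ mem])
  qed
  moreover have "wconv (\<lambda>i. g \<otimes> s i)"
    using bdry_rel_translate[OF g, of s s] wd.bdry_rel_iff[OF one_closed] sc wd.conv_agree[OF sc one_closed] by blast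
  ultimately show ?thesis using wd.bdry_class by simp
qed

lemma bdry_translate_mem: "s \<in> p \<Longrightarrow> (\<lambda>i. g \<otimes> s i) \<in> bdry_translate F g p"
  unfolding bdry_translate_def by blast

end

context tree_with_action
begin

section \<open>Cylinders\<close>

lemma orb_one: "orb \<one> = b"
  using act_one b by simp

lemma agree_tree:
  "\<exists>r'. \<forall>s t. (\<forall>i. s i \<in> carrier F) \<longrightarrow> (\<forall>i. t i \<in> carrier F) \<longrightarrow> wd.agree \<one> r' s t \<longrightarrow>
    R.agree b r (\<lambda>i. orb (s i)) (\<lambda>i. orb (t i))"
proof -
  obtain K where K: "K > 0"
    "\<forall>g\<in>carrier F. \<forall>h\<in>carrier F. \<forall>k\<in>carrier F.
      wd.gp k g h \<le> K * om.gp k g h + K \<and> om.gp k g h \<le> K * wd.gp k g h + K"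
    using gp_comparable by blast
  have "R.agree b r (\<lambda>i. orb (s i)) (\<lambda>i. orb (t i))"
    if st: "\<forall>i. s i \<in> carrier F" "\<forall>i. t i \<in> carrier F" and ag: "wd.agree \<one> (K * r + K) s t" for s t
  proof -
    obtain N where N: "\<forall>i\<ge>N. \<forall>j\<ge>N. K * r + K \<le> wd.gp \<one> (s i) (t j)"
      using ag unfolding wd.agree_def by (rule exE)
    have "r \<le> R.gp b (orb (s i)) (orb (t j))" if "i \<ge> N" "j \<ge> N" for i j
    proof -
      have "K * r + K \<le> K * om.gp \<one> (s i) (t j) + K"
        using N[rule_format, OF that] K(2)[rule_format, of "s i" "t j" \<one>] st one_closed
        by (meson order_trans)
      then have "r \<le> om.gp \<one> (s i) (t j)" using K(1) by simp
      then show ?thesis unfolding gp_od orb_one .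
    qed
    then show ?thesis unfolding R.agree_def by blast
  qed
  then show ?thesis by blast
qed

lemma agree_tree_all:
  assumes "\<forall>i. s i \<in> carrier F" "\<forall>i. t i \<in> carrier F" "\<forall>r. wd.agree \<one> r s t"
  shows "R.agree b r (\<lambda>i. orb (s i)) (\<lambda>i. orb (t i))"
  using agree_tree[of r] assms by blast

text \<open>
  Large Gromov products in the group give large ones in the tree, so sequences that tend to infinity
  or are equivalent in the group remain so on the orbit; and orbits of different points stay at
  bounded distance from each other.
\<close>
lemma bdry_identification:
  assumes p: "p \<in> bdry" and s: "s \<in> p"
  shows "bdry_identification T p \<in> hyp_boundary (pts T) (tdist T)"
    "(\<lambda>i. orb (s i)) \<in> bdry_identification T p"
proof -
  have tF: "\<forall>i. t i \<in> carrier F" if "t \<in> p" for t by (rule wd.bdry_sub[OF p that])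
  define a where "a = (\<lambda>i. orb (s i))"
  have aT: "\<forall>i. a i \<in> pts T" using tF[OF s] orb_closed by (simp add: a_def)
  have "R.agree b r a a" for r
    unfolding a_def by (rule agree_tree_all) (use tF[OF s] wd.bdry_agree[OF p s s one_closed] in blast)+
  then have conv: "conv_to_infinity (pts T) (tdist T) a" using R.conv_iff[OF b] aT by blast
  have rel: "(a, \<lambda>i. act T (t i) x) \<in> bdry_rel (pts T) (tdist T)" if t: "t \<in> p" and x: "x \<in> pts T" for t x
  proof -
    define e where "e = (\<lambda>i. act T (t i) x)"
    define o' where "o' = (\<lambda>i. orb (t i))"
    have eT: "\<forall>i. e i \<in> pts T" "\<forall>i. o' i \<in> pts T" using tF[OF t] act_closed x b by (simp_all add: e_def o'_def)
    have ag: "R.agree b r a o'" for r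
      unfolding a_def o'_def by (rule agree_tree_all) (use tF[OF s] tF[OF t] wd.bdry_agree[OF p s t one_closed] in blast)+
    have ed: "tdist T (o' i) (e i) = tdist T b x" for i
      using act_isometry tF[OF t] b x by (simp add: e_def o'_def)
    have ae: "R.agree b r a e" for r
    proof -
      obtain N where N: "\<forall>i\<ge>N. \<forall>j\<ge>N. r + tdist T b x \<le> R.gp b (a i) (o' j)"
        using ag[of "r + tdist T b x"] unfolding R.agree_def by (rule exE)
      have "r \<le> R.gp b (a i) (e j)" if "i \<ge> N" "j \<ge> N" for i j
      proof -
        have M: "a i \<in> pts T" "e j \<in> pts T" "o' j \<in> pts T" using aT eT by blast+
        have "R.gp b (o' j) (a i) \<le> R.gp b (e j) (a i) + tdist T (o' j) (e j)"
          by (rule R.gp_move[OF b M(3,2,1)])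
        then show ?thesis
          using N[rule_format, OF that] ed[of j] R.gp_commute[OF M(1,3), of b] R.gp_commute[OF M(1,2), of b] by linarith
      qed
      then show ?thesis unfolding R.agree_def by blast
    qed
    have "R.agree b r e e" for r
      by (rule R.agree_trans[OF b eT(1) aT eT(1) R.agree_sym[OF aT eT(1) ae] ae])
    then have "conv_to_infinity (pts T) (tdist T) e" using R.conv_iff[OF b] eT by blast
    then show ?thesis using conv ae unfolding R.bdry_rel_iff[OF b] e_def by blast
  qed
  have "bdry_identification T p = bdry_rel (pts T) (tdist T) `` {a}"
  proof (intro equalityI subsetI)
    fix u assume "u \<in> bdry_identification T p"
    then obtain t x where t: "t \<in> p" "x \<in> pts T" "((\<lambda>i. act T (t i) x), u) \<in> bdry_rel (pts T) (tdist T)"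
      unfolding bdry_identification_def by blast
    have "(a, u) \<in> bdry_rel (pts T) (tdist T)"
      using rel[OF t(1,2)] t(3) R.equiv_bdry_rel by (meson equivE transD)
    then show "u \<in> bdry_rel (pts T) (tdist T) `` {a}" by blast
  next
    fix u assume "u \<in> bdry_rel (pts T) (tdist T) `` {a}"
    then show "u \<in> bdry_identification T p"
      unfolding bdry_identification_def a_def using s b by blast
  qed
  then show "bdry_identification T p \<in> hyp_boundary (pts T) (tdist T)"
    "(\<lambda>i. orb (s i)) \<in> bdry_identification T p"
    using R.bdry_class[OF conv] unfolding a_def by simp_all
qed

lemma cyl_iff:
  assumes pq: "p \<in> bdry" "q \<in> bdry" "p \<noteq> q" and st: "s \<in> p" "t \<in> q" and xy: "x \<in> pts T" "y \<in> pts T"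
  shows "(p, q) \<in> cyl F X T x y \<longleftrightarrow> R.through x y (\<lambda>i. orb (s i)) (\<lambda>i. orb (t i))"
  using R.line_iff_through[OF xy bdry_identification(1)[OF pq(1) st(1)] bdry_identification(1)[OF pq(2) st(2)]
      bdry_identification(2)[OF pq(1) st(1)] bdry_identification(2)[OF pq(2) st(2)]] pq
  unfolding cyl_def topspace_free_bdry2 by simp

text \<open>
  The lines with ends close to given ones run through the same segments. Openness makes cylinders
  measurable.
\<close>
lemma openin_cyl:
  assumes xy: "x \<in> pts T" "y \<in> pts T"
  shows "openin (free_bdry2 F X) (cyl F X T x y)"
proof (subst openin_subopen, intro ballI)
  fix z assume z: "z \<in> cyl F X T x y"
  obtain p q where zpq: "z = (p, q)" and pq: "p \<in> bdry" "q \<in> bdry" "p \<noteq> q"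
    using z unfolding cyl_def topspace_free_bdry2 by blast
  obtain s where s: "s \<in> p" using wd.bdry_nonempty[OF pq(1)] by blast
  obtain t where t: "t \<in> q" using wd.bdry_nonempty[OF pq(2)] by blast
  have th: "R.through x y (\<lambda>i. orb (s i)) (\<lambda>i. orb (t i))" using cyl_iff[OF pq s t xy] z zpq by blast
  define d where "d = max (tdist T b x) (tdist T b y) + 1"
  obtain r where r: "\<forall>s t. (\<forall>i. s i \<in> carrier F) \<longrightarrow> (\<forall>i. t i \<in> carrier F) \<longrightarrow> wd.agree \<one> r s t \<longrightarrow>
    R.agree b d (\<lambda>i. orb (s i)) (\<lambda>i. orb (t i))" using agree_tree[of d] by (rule exE)
  define U where "U = (wnbhd \<one> p (r + 1) \<times>
      wnbhd \<one> q (r + 1)) \<inter> {(p, q). p \<noteq> q}"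
  have "openin (free_bdry2 F X) U"
    unfolding U_def free_bdry2_def free_bdry_def openin_subtopology
    using wd.openin_bdry_nbhd[OF one_closed pq(1), of "r + 1"] wd.openin_bdry_nbhd[OF one_closed pq(2), of "r + 1"]
      openin_prod_Times_iff by blast
  moreover have "z \<in> U"
    unfolding U_def zpq using wd.bdry_nbhd_self[OF one_closed pq(1)] wd.bdry_nbhd_self[OF one_closed pq(2)] pq by blast
  moreover have "U \<subseteq> cyl F X T x y"
  proof
    fix w assume "w \<in> U"
    then obtain p' q' where w: "w = (p', q')" "p' \<noteq> q'"
      "p' \<in> wnbhd \<one> p (r + 1)"
      "q' \<in> wnbhd \<one> q (r + 1)" unfolding U_def by blast
    have pq': "p' \<in> bdry" "q' \<in> bdry" using w wd.bdry_nbhd_sub by blast+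
    obtain s' where s': "s' \<in> p'" using wd.bdry_nonempty[OF pq'(1)] by blast
    obtain t' where t': "t' \<in> q'" using wd.bdry_nonempty[OF pq'(2)] by blast
    have F: "\<forall>i. s i \<in> carrier F" "\<forall>i. t i \<in> carrier F" "\<forall>i. s' i \<in> carrier F" "\<forall>i. t' i \<in> carrier F"
      by (rule wd.bdry_sub[OF pq(1) s] wd.bdry_sub[OF pq(2) t] wd.bdry_sub[OF pq'(1) s'] wd.bdry_sub[OF pq'(2) t'])+
    have O: "\<forall>i. orb (s i) \<in> pts T" "\<forall>i. orb (t i) \<in> pts T" "\<forall>i. orb (s' i) \<in> pts T" "\<forall>i. orb (t' i) \<in> pts T"
      using F orb_closed by blast+
    have "wd.agree \<one> r s s'" "wd.agree \<one> r t t'"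
      using wd.bdry_nbhd_iff[OF one_closed pq(1) pq'(1) s s', of "r + 1"]
        wd.bdry_nbhd_iff[OF one_closed pq(2) pq'(2) t t', of "r + 1"] w(3,4) by auto
    then have ag: "R.agree b d (\<lambda>i. orb (s i)) (\<lambda>i. orb (s' i))" "R.agree b d (\<lambda>i. orb (t i)) (\<lambda>i. orb (t' i))"
      using r F by blast+
    have "R.agree x 1 (\<lambda>i. orb (s i)) (\<lambda>i. orb (s' i))"
      using R.agree_mono[OF R.agree_base[OF b xy(1) O(1,3) ag(1)], of 1] by (simp add: d_def)
    moreover have "R.agree y 1 (\<lambda>i. orb (t i)) (\<lambda>i. orb (t' i))"
      using R.agree_mono[OF R.agree_base[OF b xy(2) O(2,4) ag(2)], of 1] by (simp add: d_def)
    ultimately have "R.through x y (\<lambda>i. orb (s' i)) (\<lambda>i. orb (t' i))"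
      using R.through_agree[OF xy O(1,2,3,4) th] by simp
    then show "w \<in> cyl F X T x y" using cyl_iff[OF pq' w(2) s' t' xy] w(1) by blast
  qed
  ultimately show "\<exists>T'. openin (free_bdry2 F X) T' \<and> z \<in> T' \<and> T' \<subseteq> cyl F X T x y" by blast
qed

abbreviation passes :: "real \<Rightarrow> 'f \<Rightarrow> 'f \<Rightarrow> (nat \<Rightarrow> 'f) \<Rightarrow> (nat \<Rightarrow> 'f) \<Rightarrow> bool" where
  "passes c u v s t \<equiv> \<exists>N. \<forall>i\<ge>N. om.gp u (s i) v \<le> c \<and> om.gp v u (t i) \<le> c"

text \<open>
  All lines that run from near \<open>u b\<close> to near \<open>v b\<close> share the trimmed segment, so one cylinder
  contains them all.
\<close>
lemma trimmed_cylinder: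
  assumes uv: "u \<in> carrier F" "v \<in> carrier F" and c: "0 \<le> c" "2 * c < od u v"
  obtains x y where "x \<in> pts T" "y \<in> pts T" "tdist T x y = od u v - 2 * c"
    "\<And>p q s t. p \<in> bdry \<Longrightarrow> q \<in> bdry \<Longrightarrow> p \<noteq> q \<Longrightarrow> s \<in> p \<Longrightarrow> t \<in> q \<Longrightarrow>
      passes c u v s t \<Longrightarrow> (p, q) \<in> cyl F X T x y"
proof -
  have o: "orb u \<in> pts T" "orb v \<in> pts T" using uv orb_closed by auto
  define l where "l = od u v"
  have l: "l = tdist T (orb u) (orb v)" by (simp add: l_def od_def)
  from R.geodesic[OF o, folded l] obtain g where g: "g 0 = orb u \<and> g l = orb v \<and> g ` {0..l} \<subseteq> pts T \<and>
     (\<forall>s\<in>{0..l}. \<forall>t\<in>{0..l}. tdist T (g s) (g t) = \<bar>s - t\<bar>)" by (rule exE)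
  have I: "0 \<in> {0..l}" "l \<in> {0..l}" "c \<in> {0..l}" "l - c \<in> {0..l}" using c unfolding l_def by auto
  have dist: "tdist T (g s) (g t) = \<bar>s - t\<bar>" if "s \<in> {0..l}" "t \<in> {0..l}" for s t using g that by blast
  define x y where "x = g c" and "y = g (l - c)"
  have xy: "x \<in> pts T" "y \<in> pts T" using g I unfolding x_def y_def by blast+
  have ends: "orb u = g 0" "orb v = g l" using g by simp_all
  have d: "tdist T (orb u) x = c" "tdist T x (orb v) = l - c" "tdist T (orb u) y = l - c" "tdist T y (orb v) = c"
    "tdist T x y = l - 2 * c"
    unfolding ends x_def y_def using dist I c by (simp_all add: l_def abs_if)
  show ?thesis
  proof (rule that[OF xy])
    show "tdist T x y = od u v - 2 * c" using d by (simp add: l_def)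
    fix p q s t
    assume pq: "p \<in> bdry" "q \<in> bdry" "p \<noteq> q" and st: "s \<in> p" "t \<in> q"
      and ev: "passes c u v s t"
    obtain N where N: "\<forall>i\<ge>N. om.gp u (s i) v \<le> c \<and> om.gp v u (t i) \<le> c" using ev by (rule exE)
    have F: "\<forall>i. s i \<in> carrier F" "\<forall>i. t i \<in> carrier F"
      by (rule wd.bdry_sub[OF pq(1) st(1)] wd.bdry_sub[OF pq(2) st(2)])+
    have "tdist T (orb (s i)) x + tdist T x y + tdist T y (orb (t j)) = tdist T (orb (s i)) (orb (t j))"
      if "i \<ge> N" "j \<ge> N" for i j
    proof (rule R.trimmed_segment[OF o xy])
      show "orb (s i) \<in> pts T" "orb (t j) \<in> pts T" using F orb_closed by auto
      show "tdist T (orb u) x = c" "tdist T x (orb v) = tdist T (orb u) (orb v) - c"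
        "tdist T (orb u) y = tdist T (orb u) (orb v) - c" "tdist T y (orb v) = c"
        "tdist T x y = tdist T (orb u) (orb v) - 2 * c" using d l by simp_all
      show "0 < tdist T x y" using d c by (simp add: l_def)
      show "R.gp (orb u) (orb (s i)) (orb v) \<le> c" "R.gp (orb v) (orb u) (orb (t j)) \<le> c"
        using N that unfolding gp_od by blast+
    qed
    then have "R.through x y (\<lambda>i. orb (s i)) (\<lambda>i. orb (t i))" unfolding R.through_def by blast
    then show "(p, q) \<in> cyl F X T x y" using cyl_iff[OF pq st xy] by blast
  qed
qed

end

section \<open>Masses of cylinders\<close>

lemma space_current:
  assumes "\<mu> \<in> geodesic_currents F X"
  shows "space \<mu> = topspace (free_bdry2 F X)"
proof -
  have "sets \<mu> = sets (sigma (topspace (free_bdry2 F X)) {U. openin (free_bdry2 F X) U})"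
    using assms by (simp add: geodesic_currents_def)
  then have "space \<mu> = space (sigma (topspace (free_bdry2 F X)) {U. openin (free_bdry2 F X) U})"
    by (rule sets_eq_imp_space_eq)
  then show ?thesis by (simp add: space_measure_of_conv)
qed

lemma open_in_sets_current:
  assumes "\<mu> \<in> geodesic_currents F X" "openin (free_bdry2 F X) U"
  shows "U \<in> sets \<mu>"
proof -
  have "{U. openin (free_bdry2 F X) U} \<subseteq> Pow (topspace (free_bdry2 F X))"
    using openin_subset by blast
  moreover have "sets \<mu> = sets (sigma (topspace (free_bdry2 F X)) {U. openin (free_bdry2 F X) U})"
    using assms by (simp add: geodesic_currents_def)
  ultimately show ?thesis using assms(2) by (simp add: sigma_sets.Basic)
qed

lemma closed_in_sets_current:
  assumes "\<mu> \<in> geodesic_currents F X" "closedin (free_bdry2 F X) C"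
  shows "C \<in> sets \<mu>"
proof -
  have "topspace (free_bdry2 F X) - C \<in> sets \<mu>"
    using open_in_sets_current[OF assms(1)] assms(2) by (simp add: closedin_def)
  then have "space \<mu> - (topspace (free_bdry2 F X) - C) \<in> sets \<mu>" by (rule sets.compl_sets)
  moreover have "space \<mu> - (topspace (free_bdry2 F X) - C) = C"
    using closedin_subset[OF assms(2)] space_current[OF assms(1)] by auto
  ultimately show ?thesis by simp
qed

context tree_with_action
begin

text \<open>
  A line through \<open>x\<close> has a translate that passes near the base point, and the end points of such lines
  separate before a fixed depth: they form a compact set. Currents are invariant.
\<close>
lemma ex_cyl_bound:
  assumes \<mu>: "\<mu> \<in> geodesic_currents F X"
  shows "\<exists>M>0. \<forall>x\<in>pts T. \<forall>y\<in>pts T. emeasure \<mu> (cyl F X T x y) \<le> ennreal M"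
proof -
  obtain D where D: "net D {b}" using ex_net_base by blast
  obtain K where K: "K > 0"
    "\<forall>g\<in>carrier F. \<forall>h\<in>carrier F. \<forall>k\<in>carrier F.
      wd.gp k g h \<le> K * om.gp k g h + K \<and> om.gp k g h \<le> K * wd.gp k g h + K"
    using gp_comparable by blast
  define r where "r = K * D + K + 2"
  define C where "C = wd.apart \<one> r"
  have C: "emeasure \<mu> C < \<infinity>" using \<mu> compactin_apart unfolding C_def geodesic_currents_def by blast
  have Cs: "C \<in> sets \<mu>" unfolding C_def by (rule closed_in_sets_current[OF \<mu> closedin_apart2])
  have "emeasure \<mu> (cyl F X T x y) \<le> emeasure \<mu> C" if xy: "x \<in> pts T" "y \<in> pts T" for x y
  proof -
    obtain g where g: "g \<in> carrier F" "tdist T x (orb g) \<le> D" using D xy(1) unfolding net_def by blast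
    let ?tr = "map_prod (bdry_translate F (inv g)) (bdry_translate F (inv g))"
    have "?tr ` cyl F X T x y \<subseteq> C"
    proof
      fix w assume "w \<in> ?tr ` cyl F X T x y"
      then obtain z where z: "w = ?tr z" "z \<in> cyl F X T x y" by (rule imageE)
      obtain p q where zpq: "z = (p, q)" and pq: "p \<in> bdry" "q \<in> bdry" "p \<noteq> q"
        using z(2) unfolding cyl_def topspace_free_bdry2 by blast
      obtain s where s: "s \<in> p" using wd.bdry_nonempty[OF pq(1)] by blast
      obtain t where t: "t \<in> q" using wd.bdry_nonempty[OF pq(2)] by blast
      have F: "\<forall>i. s i \<in> carrier F" "\<forall>i. t i \<in> carrier F"
        by (rule wd.bdry_sub[OF pq(1) s] wd.bdry_sub[OF pq(2) t])+
      have "R.through x y (\<lambda>i. orb (s i)) (\<lambda>i. orb (t i))" using cyl_iff[OF pq s t xy] z(2) zpq by blast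
      then obtain N where N: "\<forall>i\<ge>N. \<forall>j\<ge>N. tdist T (orb (s i)) x + tdist T x y + tdist T y (orb (t j)) = tdist T (orb (s i)) (orb (t j))"
        unfolding R.through_def by (rule exE)
      have small: "wd.gp \<one> (inv g \<otimes> s i) (inv g \<otimes> t j) \<le> K * D + K" if "i \<ge> N" "j \<ge> N" for i j
      proof -
        have sF: "s i \<in> carrier F" and tF: "t j \<in> carrier F" using F by blast+
        have o: "orb (s i) \<in> pts T" "orb (t j) \<in> pts T" "orb g \<in> pts T" using sF tF g orb_closed by blast+
        have "tdist T (orb (s i)) x + tdist T x (orb (t j)) = tdist T (orb (s i)) (orb (t j))"
          using N[rule_format, OF that] R.d_triangle[OF o(1) xy(1) o(2)] R.d_triangle[OF xy o(2)] by linarith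
        then have "R.gp x (orb (s i)) (orb (t j)) = 0" using R.between_gp[OF o(1,2) xy(1)] by blast
        then have "R.gp (orb g) (orb (s i)) (orb (t j)) \<le> D"
          using R.gp_base[OF o(3) xy(1) o(1,2)] g(2) R.d_commute[OF xy(1) o(3)] by linarith
        then have "om.gp g (s i) (t j) \<le> D" unfolding gp_od .
        then have "K * om.gp g (s i) (t j) \<le> K * D" using K(1) by simp
        then have "wd.gp g (s i) (t j) \<le> K * D + K" using K(2)[rule_format, OF sF tF g(1)] by linarith
        moreover have "wd.gp \<one> (inv g \<otimes> s i) (inv g \<otimes> t j) = wd.gp g (s i) (t j)"
          using word_dist_translate[OF inv_closed[OF g(1)] g(1)] word_dist_translate[OF inv_closed[OF g(1)] sF tF] g(1) sF tF
          unfolding gromov_prod_def by simp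
        ultimately show ?thesis by simp
      qed
      have "\<not> wd.agree \<one> (r - 1) (\<lambda>i. inv g \<otimes> s i) (\<lambda>i. inv g \<otimes> t i)"
      proof
        assume "wd.agree \<one> (r - 1) (\<lambda>i. inv g \<otimes> s i) (\<lambda>i. inv g \<otimes> t i)"
        then obtain N' where "\<forall>i\<ge>N'. \<forall>j\<ge>N'. r - 1 \<le> wd.gp \<one> (inv g \<otimes> s i) (inv g \<otimes> t j)"
          unfolding wd.agree_def by (rule exE)
        then have "r - 1 \<le> wd.gp \<one> (inv g \<otimes> s (max N N')) (inv g \<otimes> t (max N N'))" by simp
        then show False using small[of "max N N'" "max N N'"] by (simp add: r_def)
      qed
      then have "\<not> (\<forall>r'<r. wd.agree \<one> r' (\<lambda>i. inv g \<otimes> s i) (\<lambda>i. inv g \<otimes> t i))"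
        by (meson diff_less zero_less_one minus_less_iff less_add_one diff_less_eq)
      then have "(bdry_translate F (inv g) p, bdry_translate F (inv g) q) \<in> C"
        unfolding C_def wd.apart_iff[OF one_closed bdry_translate_closed[OF inv_closed[OF g(1)] pq(1)]
            bdry_translate_closed[OF inv_closed[OF g(1)] pq(2)] bdry_translate_mem[OF s] bdry_translate_mem[OF t]] .
      then show "w \<in> C" using z(1) zpq by simp
    qed
    then have "emeasure \<mu> (?tr ` cyl F X T x y) \<le> emeasure \<mu> C" by (rule emeasure_mono[OF _ Cs])
    moreover have "emeasure \<mu> (?tr ` cyl F X T x y) = emeasure \<mu> (cyl F X T x y)"
      using \<mu> inv_closed[OF g(1)] open_in_sets_current[OF \<mu> openin_cyl[OF xy]]
      unfolding geodesic_currents_def by blast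
    ultimately show ?thesis by simp
  qed
  moreover have "emeasure \<mu> C \<le> ennreal (enn2real (emeasure \<mu> C) + 1)"
    using C by (metis ennreal_enn2real ennreal_leI infinity_ennreal_def le_add_same_cancel1 zero_le_one)
  moreover have "enn2real (emeasure \<mu> C) + 1 > 0" using enn2real_nonneg[of "emeasure \<mu> C"] by linarith
  ultimately show ?thesis by (meson order_trans)
qed

end

section \<open>Finiteness of the entropy\<close>

lemma rate_le_iff:
  assumes "0 < l"
  shows "- log_measure m / ereal l \<le> ereal r \<longleftrightarrow> ennreal (exp (- r * l)) \<le> m"
proof -
  consider "m = 0" | "m = \<infinity>" | x where "0 < x" "m = ennreal x"
    by (cases m) (auto simp: less_le)
  then show ?thesis
  proof cases
    case 1
    then have "- log_measure m / ereal l = \<infinity>" using assms by (simp add: log_measure_def)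
    then show ?thesis using 1 by simp
  next
    case 2
    then have "- log_measure m / ereal l = - \<infinity>" using assms by (simp add: log_measure_def)
    then show ?thesis using 2 by simp
  next
    case 3
    then have "- log_measure m / ereal l = ereal (- ln x / l)" using assms by (simp add: log_measure_def)
    then have "- log_measure m / ereal l \<le> ereal r \<longleftrightarrow> - ln x / l \<le> r" by simp
    also have "\<dots> \<longleftrightarrow> - ln x \<le> r * l" by (rule pos_divide_le_eq[OF assms])
    also have "\<dots> \<longleftrightarrow> - r * l \<le> ln x" by auto
    also have "\<dots> \<longleftrightarrow> exp (- r * l) \<le> x" using 3(1) by (simp add: ln_ge_iff)
    finally show ?thesis using 3 by simp
  qed
qed

lemma eventually_far_pairs:
  "eventually P (far_pairs T) \<longleftrightarrow>
    (\<exists>N. \<forall>x\<in>pts T. \<forall>y\<in>pts T. N \<le> tdist T x y \<longrightarrow> P (x, y))"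
  unfolding far_pairs_def eventually_inf_principal eventually_filtercomap_at_top_linorder by auto

lemma geometric_entropy_le:
  assumes "\<And>N. \<exists>x\<in>pts T. \<exists>y\<in>pts T. N \<le> tdist T x y \<and>
    ennreal (exp (- r * tdist T x y)) \<le> emeasure \<mu> (cyl F X T x y)"
  shows "geometric_entropy F X \<mu> T \<le> ereal r"
proof (rule ccontr)
  assume "\<not> ?thesis"
  then have "ereal r < Liminf (far_pairs T)
     (\<lambda>(x, y). - log_measure (emeasure \<mu> (cyl F X T x y)) / ereal (tdist T x y))"
    by (simp add: geometric_entropy_def)
  then have "\<forall>\<^sub>F z in far_pairs T. ereal r <
     (\<lambda>(x, y). - log_measure (emeasure \<mu> (cyl F X T x y)) / ereal (tdist T x y)) z"
    by (rule less_LiminfD)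
  then obtain N where N: "\<forall>x\<in>pts T. \<forall>y\<in>pts T. N \<le> tdist T x y \<longrightarrow>
     ereal r < - log_measure (emeasure \<mu> (cyl F X T x y)) / ereal (tdist T x y)"
    unfolding eventually_far_pairs by auto
  obtain x y where xy: "x \<in> pts T" "y \<in> pts T" "max N 1 \<le> tdist T x y"
    "ennreal (exp (- r * tdist T x y)) \<le> emeasure \<mu> (cyl F X T x y)" using assms[of "max N 1"] by blast
  have "0 < tdist T x y" using xy(3) by linarith
  then have "- log_measure (emeasure \<mu> (cyl F X T x y)) / ereal (tdist T x y) \<le> ereal r"
    using rate_le_iff xy(4) by blast
  moreover have "N \<le> tdist T x y" using xy(3) by simp
  ultimately show False using N xy(1,2) by (meson not_le)
qed

lemma geometric_entropy_less:
  assumes "geometric_entropy F X \<mu> T < ereal r"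
  shows "\<exists>x\<in>pts T. \<exists>y\<in>pts T. N \<le> tdist T x y \<and>
    ennreal (exp (- r * tdist T x y)) \<le> emeasure \<mu> (cyl F X T x y)"
proof (rule ccontr)
  assume no: "\<not> ?thesis"
  have "ereal r \<le> - log_measure (emeasure \<mu> (cyl F X T x y)) / ereal (tdist T x y)"
    if xy: "x \<in> pts T" "y \<in> pts T" "max N 1 \<le> tdist T x y" for x y
  proof -
    have "0 < tdist T x y" "N \<le> tdist T x y" using xy(3) by linarith+
    then have "\<not> - log_measure (emeasure \<mu> (cyl F X T x y)) / ereal (tdist T x y) \<le> ereal r"
      using rate_le_iff no xy(1,2) by blast
    then show ?thesis by (meson le_cases)
  qed
  then have "\<forall>\<^sub>F z in far_pairs T. ereal r \<le>
     (\<lambda>(x, y). - log_measure (emeasure \<mu> (cyl F X T x y)) / ereal (tdist T x y)) z"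
    unfolding eventually_far_pairs by (intro exI[of _ "max N 1"]) simp
  then have "ereal r \<le> geometric_entropy F X \<mu> T"
    unfolding geometric_entropy_def by (rule Liminf_bounded)
  then show False using assms by simp
qed

context tree_with_action
begin

text \<open>
  Masses of cylinders are bounded, so they do not grow exponentially with the length.
\<close>
lemma entropy_nonneg:
  assumes \<mu>: "\<mu> \<in> geodesic_currents F X"
  shows "0 \<le> geometric_entropy F X \<mu> T"
proof (rule ccontr)
  assume "\<not> ?thesis"
  then have "geometric_entropy F X \<mu> T < 0" by simp
  then obtain r where r: "geometric_entropy F X \<mu> T < ereal r" "ereal r < 0" using ereal_dense2 by blast
  then have r0: "r < 0" by simp
  obtain M where M: "M > 0" "\<forall>x\<in>pts T. \<forall>y\<in>pts T. emeasure \<mu> (cyl F X T x y) \<le> ennreal M"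
    using ex_cyl_bound[OF \<mu>] by blast
  obtain x y where xy: "x \<in> pts T" "y \<in> pts T" "(ln M + 1) / (- r) \<le> tdist T x y"
    "ennreal (exp (- r * tdist T x y)) \<le> emeasure \<mu> (cyl F X T x y)"
    using geometric_entropy_less[OF r(1)] by blast
  have "ennreal (exp (- r * tdist T x y)) \<le> ennreal M" using xy(4) M(2) xy(1,2) by (meson order_trans)
  then have "exp (- r * tdist T x y) \<le> M" using M(1) by (simp add: ennreal_le_iff)
  then have "- r * tdist T x y \<le> ln M" using M(1) by (simp add: ln_ge_iff)
  moreover have "ln M + 1 \<le> - r * tdist T x y"
  proof -
    have "0 < - r" using r0 by simp
    then have "ln M + 1 \<le> tdist T x y * (- r)" using xy(3) by (simp only: pos_divide_le_eq)
    then show ?thesis by (simp add: mult.commute)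
  qed
  ultimately show False by linarith
qed

lemma card_word_sphere:
  "card {g \<in> carrier F. length (nf g) = n} \<le> (card (X \<times> (UNIV :: bool set))) ^ n"
proof -
  define W where "W = {w. set w \<subseteq> X \<times> (UNIV :: bool set) \<and> length w = n}"
  have fin: "finite (X \<times> (UNIV :: bool set))" using finite_basis by simp
  have "{g \<in> carrier F. length (nf g) = n} \<subseteq> word_eval F ` W"
  proof
    fix g assume g: "g \<in> {g \<in> carrier F. length (nf g) = n}"
    then have "nf g \<in> W" "g = word_eval F (nf g)"
      using nf[of g] by (auto simp: words_def W_def)
    then show "g \<in> word_eval F ` W" by blast
  qed
  moreover have "finite W" unfolding W_def by (rule finite_lists_length_eq[OF fin])
  ultimately have "card {g \<in> carrier F. length (nf g) = n} \<le> card W"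
    by (meson card_image_le card_mono finite_imageI order_trans)
  then show ?thesis unfolding W_def card_lists_length_eq[OF fin] .
qed

text \<open>
  Seen from \<open>\<one>\<close>, the rays to \<open>p\<close> and \<open>q\<close> separate before depth \<open>n\<close> and then pass through \<open>u\<close> and
  \<open>v\<close>, which are deeper. The line from \<open>p\<close> to \<open>q\<close> passes through \<open>u\<close> and \<open>v\<close> in the word metric, up
  to \<open>n\<close>, and so it does in the tree, up to a constant that depends on \<open>n\<close> only.
\<close>
lemma shadow_pair_cylinder:
  "\<exists>c\<ge>0. \<forall>R. n \<le> R \<longrightarrow> (\<forall>u\<in>carrier F. \<forall>v\<in>carrier F. \<forall>p q.
      length (nf u) = R \<longrightarrow> length (nf v) = R \<longrightarrow> (p, q) \<in> wd.apart \<one> (real n) \<longrightarrow>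
      p \<in> shadow u \<longrightarrow> q \<in> shadow v \<longrightarrow>
      2 * real R - 2 * real n \<le> word_dist F X u v \<and>
      (\<forall>s\<in>p. \<forall>t\<in>q. passes c u v s t))"
proof -
  obtain K where K: "K > 0"
    "\<forall>g\<in>carrier F. \<forall>h\<in>carrier F. \<forall>k\<in>carrier F.
      wd.gp k g h \<le> K * om.gp k g h + K \<and> om.gp k g h \<le> K * wd.gp k g h + K"
    using gp_comparable by blast
  define c where "c = K * real n + K"
  have c: "c \<ge> 0" using K by (simp add: c_def)
  have side: "om.gp u s v \<le> c"
    if F: "u \<in> carrier F" "v \<in> carrier F" "s \<in> carrier F" and len: "length (nf u) = R" "length (nf v) = R"
      and su: "real R \<le> wd.gp \<one> s u" and sv: "wd.gp \<one> s v \<le> real n" for u v s R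
  proof -
    have "wd.gp \<one> s u \<le> real R" using wd.gp_le'[OF one_closed F(3,1)] word_dist_one[OF F(1)] len by simp
    then have su': "wd.gp \<one> s u = real R" using su by simp
    have "wd.gp u s v \<le> wd.gp \<one> s v - wd.gp \<one> u v"
      using su' wd.d_commute[OF F(1,3)] word_dist_one[OF F(1)] word_dist_one[OF F(2)] len
      by (simp add: gromov_prod_def field_simps)
    then have "wd.gp u s v \<le> real n" using sv wd.gp_nonneg[OF one_closed F(1,2)] by linarith
    then have "K * wd.gp u s v \<le> K * real n" using K(1) by simp
    moreover have "om.gp u s v \<le> K * wd.gp u s v + K" using K(2) F by blast
    ultimately show ?thesis by (simp add: c_def)
  qed
  have main: "2 * real R - 2 * real n \<le> word_dist F X u v \<and>
      (\<forall>s\<in>p. \<forall>t\<in>q. passes c u v s t)"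
    if R: "n \<le> R" and uv: "u \<in> carrier F" "v \<in> carrier F" and len: "length (nf u) = R" "length (nf v) = R"
      and ap: "(p, q) \<in> wd.apart \<one> (real n)" and sh: "p \<in> shadow u" "q \<in> shadow v" for R u v p q
  proof -
    have pq: "p \<in> bdry" "q \<in> bdry" using sh by (auto simp: shadow_def)
    have key: "wd.gp \<one> u v \<le> real n \<and> (passes c u v s t)"
      if s: "s \<in> p" and t: "t \<in> q" for s t
    proof -
      have F: "\<forall>i. s i \<in> carrier F" "\<forall>i. t i \<in> carrier F"
        by (rule wd.bdry_sub[OF pq(1) s] wd.bdry_sub[OF pq(2) t])+
      have "wd.agree \<one> (real (length (nf u))) s (\<lambda>_. u)" "wd.agree \<one> (real (length (nf v))) t (\<lambda>_. v)"
        using sh(1) s sh(2) t unfolding shadow_def by blast+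
      then obtain N1 N2 where N12: "\<forall>i\<ge>N1. \<forall>j\<ge>N1. real R \<le> wd.gp \<one> (s i) u"
        "\<forall>i\<ge>N2. \<forall>j\<ge>N2. real R \<le> wd.gp \<one> (t i) v" unfolding wd.agree_def len by blast
      obtain r where r: "r < real n" "\<not> wd.agree \<one> r s t"
        using wd.apart_iff[OF one_closed pq s t] ap by blast
      obtain N3 where N3: "\<forall>i\<ge>N3. \<forall>j\<ge>N3. wd.gp \<one> (s i) (t j) < r"
        using wd.not_agree[OF one_closed pq s t r(2)] by (rule exE)
      define N where "N = max N1 (max N2 N3)"
      have su: "real R \<le> wd.gp \<one> (s i) u" and tv: "real R \<le> wd.gp \<one> (t i) v" if "i \<ge> N" for i
        using N12 that unfolding N_def by auto
      have st: "wd.gp \<one> (s i) (t j) < real n" if "i \<ge> N" "j \<ge> N" for i j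
        using N3[rule_format, of i j] that r(1) unfolding N_def by auto
      have sv: "wd.gp \<one> (s i) v < real n" if i: "i \<ge> N" for i
      proof -
        have "min (wd.gp \<one> (s i) v) (wd.gp \<one> v (t i)) \<le> wd.gp \<one> (s i) (t i)"
          using wd.gp_min[OF one_closed _ uv(2)] F by blast
        moreover have "wd.gp \<one> v (t i) = wd.gp \<one> (t i) v" using wd.gp_commute uv(2) F(2) by blast
        ultimately show ?thesis using st[OF i i] tv[OF i] R by (simp add: min_def split: if_splits)
      qed
      have tu: "wd.gp \<one> (t i) u < real n" if i: "i \<ge> N" for i
      proof -
        have "min (wd.gp \<one> (s i) u) (wd.gp \<one> u (t i)) \<le> wd.gp \<one> (s i) (t i)"
          using wd.gp_min[OF one_closed _ uv(1)] F by blast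
        moreover have "wd.gp \<one> u (t i) = wd.gp \<one> (t i) u" using wd.gp_commute uv(1) F(2) by blast
        ultimately show ?thesis using st[OF i i] su[OF i] R by (simp add: min_def split: if_splits)
      qed
      have "min (wd.gp \<one> (s N) u) (wd.gp \<one> u v) \<le> wd.gp \<one> (s N) v"
        using wd.gp_min[OF one_closed _ uv(1) uv(2)] F(1) by blast
      then have uv_n: "wd.gp \<one> u v \<le> real n"
        using sv[of N] su[of N] R by (simp add: min_def split: if_splits)
      have "om.gp u (s i) v \<le> c \<and> om.gp v u (t i) \<le> c" if i: "i \<ge> N" for i
      proof
        have sF: "s i \<in> carrier F" and tF: "t i \<in> carrier F" using F by blast+
        show "om.gp u (s i) v \<le> c" by (rule side[OF uv sF len su[OF i] less_imp_le[OF sv[OF i]]])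
        have "om.gp v (t i) u \<le> c"
          by (rule side[OF uv(2,1) tF len(2,1) tv[OF i] less_imp_le[OF tu[OF i]]])
        then show "om.gp v u (t i) \<le> c" using om.gp_commute[OF uv(1) tF] by simp
      qed
      then show ?thesis using uv_n by blast
    qed
    obtain s where s: "s \<in> p" using wd.bdry_nonempty[OF pq(1)] by blast
    obtain t where t: "t \<in> q" using wd.bdry_nonempty[OF pq(2)] by blast
    have "2 * real R - 2 * real n \<le> word_dist F X u v"
      using key[OF s t] word_dist_one[OF uv(1)] word_dist_one[OF uv(2)] len by (simp add: gromov_prod_def)
    then show ?thesis using key by blast
  qed
  show ?thesis by (rule exI[of _ c]) (use c main in blast)
qed

text \<open>
  Some compact set of lines that separate before depth \<open>n\<close> has positive mass \<open>m\<close>. It is shared among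
  the pairs of words of length \<open>R\<close>, whose number grows exponentially in \<open>R\<close>, while the lengths of the
  corresponding cylinders grow linearly in \<open>R\<close>. The rate \<open>r\<close> is the quotient of the two growth rates,
  with a margin for the additive constants.
\<close>
lemma heavy_cylinders:
  assumes \<mu>: "\<mu> \<in> geodesic_currents F X" and nz: "emeasure \<mu> (space \<mu>) \<noteq> 0"
  shows "\<exists>r. \<forall>L. \<exists>x\<in>pts T. \<exists>y\<in>pts T. L \<le> tdist T x y \<and>
    ennreal (exp (- r * tdist T x y)) \<le> emeasure \<mu> (cyl F X T x y)"
proof -
  have ap_sets: "wd.apart \<one> (real n) \<in> sets \<mu>" for n
    by (rule closed_in_sets_current[OF \<mu> closedin_apart2])
  have "\<exists>n. emeasure \<mu> (wd.apart \<one> (real n)) \<noteq> 0"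
  proof (rule ccontr)
    assume "\<not> ?thesis"
    then have "range (\<lambda>n. wd.apart \<one> (real n)) \<subseteq> null_sets \<mu>" using ap_sets by auto
    then have "(\<Union>n. wd.apart \<one> (real n)) \<in> null_sets \<mu>" by (intro null_sets_UN) auto
    then show False using nz space_current[OF \<mu>] topspace_free_bdry2_Union by auto
  qed
  then obtain n where n: "emeasure \<mu> (wd.apart \<one> (real n)) \<noteq> 0" by blast
  have fin: "emeasure \<mu> (wd.apart \<one> (real n)) < \<infinity>"
    using \<mu> compactin_apart unfolding geodesic_currents_def by blast
  define m where "m = enn2real (emeasure \<mu> (wd.apart \<one> (real n)))"
  have m: "emeasure \<mu> (wd.apart \<one> (real n)) = ennreal m" using fin by (simp add: m_def)
  have m0: "m > 0" using n m by (metis ennreal_0 ennreal_neg linorder_not_less)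
  obtain c where c: "c \<ge> 0" and sp: "\<forall>R. n \<le> R \<longrightarrow> (\<forall>u\<in>carrier F. \<forall>v\<in>carrier F. \<forall>p q.
      length (nf u) = R \<longrightarrow> length (nf v) = R \<longrightarrow> (p, q) \<in> wd.apart \<one> (real n) \<longrightarrow>
      p \<in> shadow u \<longrightarrow> q \<in> shadow v \<longrightarrow>
      2 * real R - 2 * real n \<le> word_dist F X u v \<and>
      (\<forall>s\<in>p. \<forall>t\<in>q. passes c u v s t))"
    using shadow_pair_cylinder[of n] by blast
  obtain K where K: "K > 0" "\<forall>g\<in>carrier F. real (length (nf g)) \<le> K * od \<one> g + K"
    using ex_word_length_le_od by blast
  (* The number of letters, plus 1 so that its logarithm is not negative. *)
  define Q where "Q = real (card (X \<times> (UNIV :: bool set))) + 1"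
  have Q: "Q \<ge> 1" by (simp add: Q_def)
  have card_Q: "real (card {g \<in> carrier F. length (nf g) = R}) \<le> Q ^ R" for R
  proof -
    have "real (card {g \<in> carrier F. length (nf g) = R}) \<le> real (card (X \<times> (UNIV :: bool set)) ^ R)"
      using card_word_sphere[of R] by (rule of_nat_mono)
    also have "\<dots> \<le> Q ^ R" unfolding Q_def of_nat_power by (intro power_mono) auto
    finally show ?thesis .
  qed
  have heavy: "\<exists>x\<in>pts T. \<exists>y\<in>pts T. (2 * real R - 2 * real n) / K - 1 - 2 * c \<le> tdist T x y \<and>
      ennreal (m / (2 * Q ^ R * Q ^ R)) \<le> emeasure \<mu> (cyl F X T x y)"
    if R: "n \<le> R" "2 * c < (2 * real R - 2 * real n) / K - 1" for R
  proof (rule ccontr)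
    assume no: "\<not> ?thesis"
    define S where "S = {g \<in> carrier F. length (nf g) = R}"
    have finS: "finite S"
      by (rule finite_subset[OF _ finite_word_ball[of R]]) (auto simp: S_def)
    define P where "P = {(u, v). u \<in> S \<and> v \<in> S \<and> (\<exists>p q. (p, q) \<in> wd.apart \<one> (real n) \<and> p \<in> shadow u \<and> q \<in> shadow v)}"
    have PS: "P \<subseteq> S \<times> S" unfolding P_def by blast
    then have finP: "finite P" using finS finite_subset by blast
    (* If every cylinder were light, then the cylinders of all pairs of words together would cover at
       most half of the mass m. *)
    define light where "light w xy \<longleftrightarrow> fst xy \<in> pts T \<and> snd xy \<in> pts T \<and>
       emeasure \<mu> (cyl F X T (fst xy) (snd xy)) \<le> ennreal (m / (2 * Q ^ R * Q ^ R)) \<and>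
       wd.apart \<one> (real n) \<inter> (shadow (fst w) \<times> shadow (snd w)) \<subseteq> cyl F X T (fst xy) (snd xy)" for w xy
    have cylP: "\<exists>xy. light w xy" if w: "w \<in> P" for w
    proof -
      obtain u v p0 q0 where uv: "w = (u, v)" "u \<in> S" "v \<in> S" "(p0, q0) \<in> wd.apart \<one> (real n)"
        "p0 \<in> shadow u" "q0 \<in> shadow v" using w unfolding P_def by blast
      have uF: "u \<in> carrier F" "length (nf u) = R" and vF: "v \<in> carrier F" "length (nf v) = R"
        using uv(2,3) by (auto simp: S_def)
      have wd: "2 * real R - 2 * real n \<le> word_dist F X u v"
        using sp R(1) uF vF uv(4-6) by blast
      have "word_dist F X u v \<le> K * od u v + K"
        using K(2)[rule_format, of "inv u \<otimes> v"] od_inv[OF uF(1) vF(1)] uF(1) vF(1)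
        by (simp add: word_dist_def word_length_nf)
      then have "(2 * real R - 2 * real n) / K \<le> od u v + 1"
        using wd K(1) by (simp add: pos_divide_le_eq algebra_simps)
      then have od: "(2 * real R - 2 * real n) / K - 1 \<le> od u v" by linarith
      then have od': "2 * c < od u v" using R(2) by linarith
      obtain x y where x: "x \<in> pts T" and y: "y \<in> pts T" and dxy: "tdist T x y = od u v - 2 * c" and
        cy: "\<And>p q s t. p \<in> bdry \<Longrightarrow> q \<in> bdry \<Longrightarrow> p \<noteq> q \<Longrightarrow> s \<in> p \<Longrightarrow> t \<in> q \<Longrightarrow>
          passes c u v s t \<Longrightarrow> (p, q) \<in> cyl F X T x y"
        using trimmed_cylinder[OF uF(1) vF(1) c od'] by metis
      have "wd.apart \<one> (real n) \<inter> (shadow u \<times> shadow v) \<subseteq> cyl F X T x y"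
      proof
        fix z assume "z \<in> wd.apart \<one> (real n) \<inter> (shadow u \<times> shadow v)"
        then obtain p q where z: "z = (p, q)" "(p, q) \<in> wd.apart \<one> (real n)" "p \<in> shadow u" "q \<in> shadow v" by blast
        have pq: "p \<in> bdry" "q \<in> bdry" using z by (auto simp: shadow_def)
        have ne: "p \<noteq> q" by (rule wd.apart_distinct[OF one_closed z(2)])
        obtain s where s: "s \<in> p" using wd.bdry_nonempty[OF pq(1)] by blast
        obtain t where t: "t \<in> q" using wd.bdry_nonempty[OF pq(2)] by blast
        have "\<forall>s\<in>p. \<forall>t\<in>q. passes c u v s t"
          using sp[rule_format, OF R(1) uF(1) vF(1) uF(2) vF(2) z(2-4)] by (rule conjunct2)
        then have "passes c u v s t" using s t by blast
        from cy[OF pq ne s t this] show "z \<in> cyl F X T x y" using z(1) by simp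
      qed
      moreover have "emeasure \<mu> (cyl F X T x y) \<le> ennreal (m / (2 * Q ^ R * Q ^ R))"
      proof -
        have "(2 * real R - 2 * real n) / K - 1 - 2 * c \<le> tdist T x y" using dxy od by linarith
        then have "\<not> ennreal (m / (2 * Q ^ R * Q ^ R)) \<le> emeasure \<mu> (cyl F X T x y)" using no x y by blast
        then show ?thesis by (meson le_cases)
      qed
      ultimately show ?thesis using x y uv(1) by (intro exI[of _ "(x, y)"]) (simp add: light_def)
    qed
    then have "\<forall>w\<in>P. \<exists>xy. light w xy" by blast
    from bchoice[OF this] obtain f where f: "\<forall>w\<in>P. light w (f w)" by (rule exE)
    define B where "B w = cyl F X T (fst (f w)) (snd (f w))" for w
    have B: "B w \<in> sets \<mu>" "emeasure \<mu> (B w) \<le> ennreal (m / (2 * Q ^ R * Q ^ R))"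
       "wd.apart \<one> (real n) \<inter> (shadow (fst w) \<times> shadow (snd w)) \<subseteq> B w" if "w \<in> P" for w
    proof -
      note fw = bspec[OF f that, unfolded light_def]
      show "B w \<in> sets \<mu>" unfolding B_def using open_in_sets_current[OF \<mu> openin_cyl] fw by blast
      show "emeasure \<mu> (B w) \<le> ennreal (m / (2 * Q ^ R * Q ^ R))" unfolding B_def using fw by blast
      show "wd.apart \<one> (real n) \<inter> (shadow (fst w) \<times> shadow (snd w)) \<subseteq> B w"
        unfolding B_def by (rule fw[THEN conjunct2, THEN conjunct2, THEN conjunct2])
    qed
    have cover: "wd.apart \<one> (real n) \<subseteq> (\<Union>w\<in>P. B w)"
    proof
      fix z assume z: "z \<in> wd.apart \<one> (real n)"
      obtain p q where zpq: "z = (p, q)" by (cases z)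
      have pq: "p \<in> bdry" "q \<in> bdry" using z unfolding zpq wd.apart_def by blast+
      obtain u where u: "u \<in> carrier F" "length (nf u) = R" "p \<in> shadow u" by (rule shadow_exists[OF pq(1)])
      obtain v where v: "v \<in> carrier F" "length (nf v) = R" "q \<in> shadow v" by (rule shadow_exists[OF pq(2)])
      have w: "(u, v) \<in> P" using u v z unfolding zpq P_def S_def by blast
      have "z \<in> B (u, v)" using B(3)[OF w] z u(3) v(3) unfolding zpq by auto
      then show "z \<in> (\<Union>w\<in>P. B w)" using w by blast
    qed
    have "ennreal m \<le> emeasure \<mu> (\<Union>w\<in>P. B w)"
      unfolding m[symmetric] using B(1) finP by (intro emeasure_mono[OF cover] sets.finite_UN) auto
    also have "\<dots> \<le> (\<Sum>w\<in>P. emeasure \<mu> (B w))"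
      using B(1) finP by (intro emeasure_subadditive_finite) auto
    also have "\<dots> \<le> of_nat (card P) * ennreal (m / (2 * Q ^ R * Q ^ R))"
      by (rule sum_bounded_above) (rule B(2))
    also have "\<dots> = ennreal (real (card P) * (m / (2 * Q ^ R * Q ^ R)))"
      using m0 Q by (subst ennreal_mult) (auto simp: ennreal_of_nat_eq_real_of_nat)
    finally have "m \<le> real (card P) * (m / (2 * Q ^ R * Q ^ R))"
      using m0 Q by (subst (asm) ennreal_le_iff) auto
    moreover have "real (card P) \<le> Q ^ R * Q ^ R"
    proof -
      have "card P \<le> card (S \<times> S)" using PS finS by (intro card_mono) auto
      then have "real (card P) \<le> real (card S) * real (card S)"
        unfolding card_cartesian_product by (metis of_nat_le_iff of_nat_mult)
      also have "\<dots> \<le> Q ^ R * Q ^ R" using card_Q[of R] Q unfolding S_def by (intro mult_mono) auto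
      finally show ?thesis .
    qed
    then have "real (card P) * (m / (2 * Q ^ R * Q ^ R)) \<le> Q ^ R * Q ^ R * (m / (2 * Q ^ R * Q ^ R))"
      using m0 Q by (intro mult_right_mono) auto
    moreover have "Q ^ R * Q ^ R * (m / (2 * Q ^ R * Q ^ R)) = m / 2" using Q by (simp add: field_simps)
    ultimately show False using m0 by linarith
  qed
  define r where "r = (2 * ln Q + 1) * K"
  have r0: "r \<ge> 0" using Q K(1) by (simp add: r_def)
  have "\<exists>x\<in>pts T. \<exists>y\<in>pts T. L \<le> tdist T x y \<and> ennreal (exp (- r * tdist T x y)) \<le> emeasure \<mu> (cyl F X T x y)" for L
  proof -
    define B where "B = 2 * real n / K + 1 + 2 * c"
    have "0 \<le> 2 * real n / K" using K(1) by simp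
    then have B: "B > 0" using c unfolding B_def by linarith
    (* Large enough for the additive constant B, for the required length L and for the factor 2 / m. *)
    define R where "R = n + nat \<lceil>K * B\<rceil> + nat \<lceil>K * L\<rceil> + nat \<lceil>ln (2 / m)\<rceil> + 1"
    have R: "n \<le> R" "K * B < real R" "K * L \<le> real R" "ln (2 / m) \<le> real R" unfolding R_def by linarith+
    define l where "l = (2 * real R - 2 * real n) / K - 1 - 2 * c"
    have l: "l = real R / K + (real R / K - B)"
      using K(1) by (simp add: l_def B_def field_simps)
    have "B < real R / K" using R(2) K(1) by (simp add: pos_less_divide_eq mult.commute)
    then have l1: "real R / K \<le> l" unfolding l by linarith
    have "0 \<le> real R / K" using K(1) by simp
    then have "2 * c < (2 * real R - 2 * real n) / K - 1"
      using l B \<open>B < real R / K\<close> unfolding l_def by linarith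
    from heavy[OF R(1) this] obtain x y where xy: "x \<in> pts T" "y \<in> pts T" "l \<le> tdist T x y"
      "ennreal (m / (2 * Q ^ R * Q ^ R)) \<le> emeasure \<mu> (cyl F X T x y)" unfolding l_def by blast
    have lT: "real R / K \<le> tdist T x y" using l1 xy(3) by linarith
    have "L \<le> real R / K" using R(3) K(1) by (simp add: pos_le_divide_eq mult.commute)
    then have "L \<le> tdist T x y" using lT by linarith
    moreover have "exp (- r * tdist T x y) \<le> m / (2 * Q ^ R * Q ^ R)"
    proof -
      have "r * (real R / K) \<le> r * tdist T x y" using lT r0 by (rule mult_left_mono)
      moreover have "r * (real R / K) = (2 * ln Q + 1) * real R" using K(1) by (simp add: r_def)
      ultimately have "2 * real R * ln Q + ln (2 / m) \<le> r * tdist T x y" using R(4) by (simp add: algebra_simps)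
      then have "- r * tdist T x y \<le> - (2 * real R * ln Q + ln (2 / m))" by simp
      also have "\<dots> = ln (m / (2 * Q ^ R * Q ^ R))"
        using m0 Q by (simp add: ln_div ln_mult ln_realpow)
      finally show ?thesis using m0 Q by (subst ln_ge_iff[symmetric]) simp_all
    qed
    then have "ennreal (exp (- r * tdist T x y)) \<le> emeasure \<mu> (cyl F X T x y)"
      using xy(4) by (meson ennreal_leI order_trans)
    ultimately show ?thesis using xy(1,2) by blast
  qed
  then show ?thesis by blast
qed

lemma entropy_finite:
  assumes "\<mu> \<in> geodesic_currents F X" "emeasure \<mu> (space \<mu>) \<noteq> 0"
  obtains h where "0 \<le> h" "geometric_entropy F X \<mu> T = ereal h"
proof -
  obtain r where "geometric_entropy F X \<mu> T \<le> ereal r"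
    using heavy_cylinders[OF assms] geometric_entropy_le by blast
  then show ?thesis using entropy_nonneg[OF assms(1)] that
    by (cases "geometric_entropy F X \<mu> T") auto
qed

end

section \<open>Comparing the entropies of two trees\<close>

text \<open>
  The additive constant is left unspecified, since it has no influence on the entropy.
\<close>
definition orbit_dominated ::
  "('f, 'b) monoid_scheme \<Rightarrow> real \<Rightarrow> ('f, 'a) tree_action \<Rightarrow> 'a \<Rightarrow> ('f, 'c) tree_action \<Rightarrow> 'c \<Rightarrow> bool" where
  "orbit_dominated F \<kappa> T b T' b' \<longleftrightarrow>
     (\<exists>C. \<forall>g\<in>carrier F. tdist T' b' (act T' g b') \<le> \<kappa> * tdist T b (act T g b) + C)"

text \<open>
  A long cylinder of \<open>T'\<close> with a mass of at least \<open>exp (- r d')\<close> is contained in a cylinder of \<open>T\<close> whose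
  length \<open>l\<close> satisfies \<open>d' \<le> \<kappa> l + E\<close>. So the masses of long cylinders of \<open>T\<close> decay at most at the rate
  \<open>\<kappa> r\<close>, up to an error that vanishes as the lengths grow.
\<close>
lemma entropy_compare:
  assumes T: "tree_with_action F X T b" and T': "tree_with_action F X T' b'"
    and \<mu>: "\<mu> \<in> geodesic_currents F X"
    and dominated: "orbit_dominated F \<kappa> T b T' b'"
    and \<kappa>: "0 < \<kappa>"
    and h: "geometric_entropy F X \<mu> T = ereal h" and h': "geometric_entropy F X \<mu> T' = ereal h'"
  shows "h \<le> \<kappa> * h'"
proof (rule field_le_epsilon)
  fix e :: real assume e: "0 < e"
  interpret A: tree_with_action F X T b by (fact T)
  interpret B: tree_with_action F X T' b' by (fact T')
  obtain C where le: "\<forall>g\<in>carrier F. tdist T' b' (act T' g b') \<le> \<kappa> * tdist T b (act T g b) + C"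
    using dominated unfolding orbit_dominated_def by blast
  have h'0: "0 \<le> h'" using B.entropy_nonneg[OF \<mu>] h' by simp
  obtain K where K: "K > 0"
    "\<forall>g\<in>carrier F. \<forall>h\<in>carrier F. \<forall>k\<in>carrier F.
      A.wd.gp k g h \<le> K * A.om.gp k g h + K \<and> A.om.gp k g h \<le> K * A.wd.gp k g h + K"
    using A.gp_comparable by blast
  obtain K' where K': "K' > 0"
    "\<forall>g\<in>carrier F. \<forall>h\<in>carrier F. \<forall>k\<in>carrier F.
      A.wd.gp k g h \<le> K' * B.om.gp k g h + K' \<and> B.om.gp k g h \<le> K' * A.wd.gp k g h + K'"
    using B.gp_comparable by blast
  obtain D where D: "B.net D {b'}" using B.ex_net_base by blast
  have D0: "0 \<le> D" using D by (simp add: B.net_def)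
  (* The bound 2 D for a Gromov product in T', carried to the word metric and from there to T. *)
  define c where "c = K * (K' * (2 * D) + K') + K"
  have c: "0 \<le> c" using K K' D0 by (simp add: c_def)
  have transfer: "A.om.gp u s v \<le> c" if F: "u \<in> carrier F" "s \<in> carrier F" "v \<in> carrier F"
    and small: "B.om.gp u s v \<le> 2 * D" for u s v
  proof -
    have "K' * B.om.gp u s v \<le> K' * (2 * D)" using small K'(1) by simp
    then have "A.wd.gp u s v \<le> K' * (2 * D) + K'" using K'(2)[rule_format, OF F(2,3,1)] by linarith
    then have "K * A.wd.gp u s v \<le> K * (K' * (2 * D) + K')" using K(1) by simp
    then show ?thesis using K(2)[rule_format, OF F(2,3,1)] unfolding c_def by linarith
  qed
  define E where "E = 2 * c * \<kappa> + \<bar>C\<bar> + 2 * D"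
  have E: "E \<ge> 0" using c \<kappa> D0 by (simp add: E_def)
  (* Half of the error e is spent on a rate above the limit inferior, the other half on the additive
     constant E. *)
  define r where "r = h' + e / (2 * \<kappa>)"
  have r: "r \<ge> 0" "h' < r" using h'0 e \<kappa> by (simp_all add: r_def)
  define r2 where "r2 = \<kappa> * h' + e"
  have r2: "r2 = \<kappa> * r + e / 2" using \<kappa> by (simp add: r2_def r_def field_simps)
  have "geometric_entropy F X \<mu> T \<le> ereal r2"
  proof (rule geometric_entropy_le)
    fix L :: real
    define L' where "L' = 1 + \<bar>L\<bar> + 2 * r * E / e"
    have L': "L' > 0" "L \<le> L'" "2 * r * E / e \<le> L'"
    proof -
      have "0 \<le> 2 * r * E / e" using r(1) E e by simp
      then show "L' > 0" "L \<le> L'" "2 * r * E / e \<le> L'" unfolding L'_def by linarith+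
    qed
    have "geometric_entropy F X \<mu> T' < ereal r" using h' r by simp
    from geometric_entropy_less[OF this, of "\<kappa> * L' + E"] obtain x' y' where
      x': "x' \<in> pts T'" and y': "y' \<in> pts T'" and far: "\<kappa> * L' + E \<le> tdist T' x' y'"
      and mass: "ennreal (exp (- r * tdist T' x' y')) \<le> emeasure \<mu> (cyl F X T' x' y')" by blast
    obtain u where u: "u \<in> carrier F" "tdist T' x' (B.orb u) \<le> D" using D x' unfolding B.net_def by blast
    obtain v where v: "v \<in> carrier F" "tdist T' y' (B.orb v) \<le> D" using D y' unfolding B.net_def by blast
    have o: "B.orb u \<in> pts T'" "B.orb v \<in> pts T'" using B.orb_closed u v by auto
    define l where "l = A.od u v - 2 * c"
    have uv: "inv\<^bsub>F\<^esub> u \<otimes>\<^bsub>F\<^esub> v \<in> carrier F" using u v by simp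
    have "B.od u v \<le> \<kappa> * A.od u v + C"
      using bspec[OF le uv] A.od_inv[OF u(1) v(1)] B.od_inv[OF u(1) v(1)]
      unfolding A.od_def B.od_def A.orb_one B.orb_one by simp
    moreover have "tdist T' x' y' \<le> B.od u v + 2 * D"
      using B.R.d_triangle[OF x' o(1) y'] B.R.d_triangle[OF o y'] B.R.d_commute[OF o(2) y'] u(2) v(2)
      unfolding B.od_def by linarith
    ultimately have d': "tdist T' x' y' \<le> \<kappa> * l + E"
      unfolding l_def E_def by (simp add: algebra_simps)
    then have "\<kappa> * L' \<le> \<kappa> * l" using far by linarith
    then have l: "L' \<le> l" using \<kappa> by simp
    have c': "2 * c < A.od u v" using l L'(1) unfolding l_def by linarith
    obtain x y where x: "x \<in> pts T" and y: "y \<in> pts T" and dxy: "tdist T x y = A.od u v - 2 * c" and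
      cy: "\<And>p q s t. p \<in> A.bdry \<Longrightarrow> q \<in> A.bdry \<Longrightarrow> p \<noteq> q \<Longrightarrow> s \<in> p \<Longrightarrow> t \<in> q \<Longrightarrow>
        A.passes c u v s t \<Longrightarrow> (p, q) \<in> cyl F X T x y"
      using A.trimmed_cylinder[OF u(1) v(1) c c'] by metis
    have "cyl F X T' x' y' \<subseteq> cyl F X T x y"
    proof
      fix z assume z: "z \<in> cyl F X T' x' y'"
      obtain p q where zpq: "z = (p, q)" and pq: "p \<in> A.bdry" "q \<in> A.bdry" "p \<noteq> q"
        using z unfolding cyl_def A.topspace_free_bdry2 by blast
      obtain s where s: "s \<in> p" using A.wd.bdry_nonempty[OF pq(1)] by blast
      obtain t where t: "t \<in> q" using A.wd.bdry_nonempty[OF pq(2)] by blast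
      have F: "\<forall>i. s i \<in> carrier F" "\<forall>i. t i \<in> carrier F"
        by (rule A.wd.bdry_sub[OF pq(1) s] A.wd.bdry_sub[OF pq(2) t])+
      have "B.R.through x' y' (\<lambda>i. B.orb (s i)) (\<lambda>i. B.orb (t i))"
        using B.cyl_iff[OF pq s t x' y'] z zpq by blast
      then obtain N where N: "\<forall>i\<ge>N. \<forall>j\<ge>N. tdist T' (B.orb (s i)) x' + tdist T' x' y' + tdist T' y' (B.orb (t j))
          = tdist T' (B.orb (s i)) (B.orb (t j))" unfolding B.R.through_def by (rule exE)
      have "A.om.gp u (s i) v \<le> c \<and> A.om.gp v u (t i) \<le> c" if i: "i \<ge> N" for i
      proof
        have sF: "s i \<in> carrier F" and tF: "t i \<in> carrier F" using F by blast+
        have so: "B.orb (s i) \<in> pts T'" and to: "B.orb (t i) \<in> pts T'" using sF tF B.orb_closed by auto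
        have seg: "tdist T' (B.orb (s i)) x' + tdist T' x' y' = tdist T' (B.orb (s i)) y'"
          "tdist T' x' y' + tdist T' y' (B.orb (t i)) = tdist T' x' (B.orb (t i))"
          using N[rule_format, OF i i] B.R.d_triangle[OF so x' y'] B.R.d_triangle[OF so y' to]
            B.R.d_triangle[OF so x' to] B.R.d_triangle[OF x' y' to] by linarith+
        have g1: "B.R.gp x' y' (B.orb (s i)) = 0"
          using seg(1) B.R.between_gp[OF so y' x'] B.R.gp_commute[OF so y', of x'] by simp
        have g2: "B.R.gp y' x' (B.orb (t i)) = 0"
          using seg(2) B.R.between_gp[OF x' to y'] by simp
        have "B.R.gp (B.orb u) (B.orb v) (B.orb (s i)) \<le> B.R.gp x' (B.orb v) (B.orb (s i)) + D"
          using B.R.gp_base[OF o(1) x' o(2) so] B.R.d_commute[OF x' o(1)] u(2) by linarith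
        moreover have "B.R.gp x' (B.orb v) (B.orb (s i)) \<le> 0 + D"
          using B.R.gp_move[OF x' o(2) y' so] B.R.d_commute[OF y' o(2)] g1 v(2) by linarith
        ultimately have "B.om.gp u v (s i) \<le> 2 * D" unfolding B.gp_od by linarith
        then show "A.om.gp u (s i) v \<le> c"
          using transfer[OF u(1) sF v(1)] B.om.gp_commute[OF sF v(1), of u] by simp
        have "B.R.gp (B.orb v) (B.orb u) (B.orb (t i)) \<le> B.R.gp y' (B.orb u) (B.orb (t i)) + D"
          using B.R.gp_base[OF o(2) y' o(1) to] B.R.d_commute[OF y' o(2)] v(2) by linarith
        moreover have "B.R.gp y' (B.orb u) (B.orb (t i)) \<le> 0 + D"
          using B.R.gp_move[OF y' o(1) x' to] B.R.d_commute[OF x' o(1)] g2 u(2) by linarith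
        ultimately have "B.om.gp v u (t i) \<le> 2 * D" unfolding B.gp_od by linarith
        then show "A.om.gp v u (t i) \<le> c" using transfer[OF v(1) u(1) tF] by simp
      qed
      then have "A.passes c u v s t" by blast
      from cy[OF pq s t this] show "z \<in> cyl F X T x y" using zpq by simp
    qed
    then have "emeasure \<mu> (cyl F X T' x' y') \<le> emeasure \<mu> (cyl F X T x y)"
      by (rule emeasure_mono) (rule open_in_sets_current[OF \<mu> A.openin_cyl[OF x y]])
    moreover have "exp (- r2 * l) \<le> exp (- r * tdist T' x' y')"
    proof -
      have "2 * r * E / e \<le> l" using L'(3) l by linarith
      then have "r * E \<le> e / 2 * l" using e by (simp add: field_simps)
      moreover have "r * tdist T' x' y' \<le> r * (\<kappa> * l + E)" using d' r(1) by (rule mult_left_mono)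
      ultimately have "r * tdist T' x' y' \<le> r2 * l" unfolding r2 by (simp add: algebra_simps)
      then show ?thesis by simp
    qed
    ultimately have "ennreal (exp (- r2 * l)) \<le> emeasure \<mu> (cyl F X T x y)"
      using mass by (meson ennreal_leI order_trans)
    moreover have "tdist T x y = l" using dxy by (simp add: l_def)
    moreover have "L \<le> l" using l L'(2) by linarith
    ultimately show "\<exists>x\<in>pts T. \<exists>y\<in>pts T. L \<le> tdist T x y \<and>
        ennreal (exp (- r2 * tdist T x y)) \<le> emeasure \<mu> (cyl F X T x y)"
      using x y by auto
  qed
  then show "h \<le> \<kappa> * h' + e" using h by (simp add: r2_def)
qed

text \<open>
  Isomorphic trees have the same orbit metrics, so the comparison applies in both directions with the
  factor 1.
\<close>
lemma tree_iso_entropy: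
  assumes F: "free_group F X" and \<mu>: "\<mu> \<in> geodesic_currents F X" "emeasure \<mu> (space \<mu>) \<noteq> 0"
    and iso: "(T, T') \<in> tree_iso F"
  shows "geometric_entropy F X \<mu> T' = geometric_entropy F X \<mu> T"
proof -
  obtain \<phi> where cv: "T \<in> cv_trees F" "T' \<in> cv_trees F" and \<phi>: "bij_betw \<phi> (pts T) (pts T')"
    "\<forall>x\<in>pts T. \<forall>y\<in>pts T. tdist T' (\<phi> x) (\<phi> y) = tdist T x y"
    "\<forall>g\<in>carrier F. \<forall>x\<in>pts T. \<phi> (act T g x) = act T' g (\<phi> x)"
    using iso unfolding tree_iso_def by blast
  obtain b where b: "b \<in> pts T" using cv(1) unfolding cv_trees_def real_tree_def by blast
  have b': "\<phi> b \<in> pts T'" using \<phi>(1) b by (simp add: bij_betwE)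
  interpret free_group F X by (fact F)
  interpret A: tree_with_action F X T b by unfold_locales (use cv b in auto)
  interpret B: tree_with_action F X T' "\<phi> b" by unfold_locales (use cv b' in auto)
  have eq: "tdist T' (\<phi> b) (act T' g (\<phi> b)) = tdist T b (act T g b)" if g: "g \<in> carrier F" for g
  proof -
    have "tdist T' (\<phi> b) (\<phi> (act T g b)) = tdist T b (act T g b)"
      using \<phi>(2) b A.act_closed[OF g b] by blast
    then show ?thesis using \<phi>(3) g b by simp
  qed
  obtain h where h: "geometric_entropy F X \<mu> T = ereal h" by (rule A.entropy_finite[OF \<mu>])
  obtain h' where h': "geometric_entropy F X \<mu> T' = ereal h'" by (rule B.entropy_finite[OF \<mu>])
  have "orbit_dominated F 1 T b T' (\<phi> b)" "orbit_dominated F 1 T' (\<phi> b) T b"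
    unfolding orbit_dominated_def using eq by (auto intro!: exI[of _ 0])
  then have "h \<le> 1 * h'" "h' \<le> 1 * h"
    using entropy_compare[OF A.tree_with_action_axioms B.tree_with_action_axioms \<mu>(1) _ zero_less_one h h']
      entropy_compare[OF B.tree_with_action_axioms A.tree_with_action_axioms \<mu>(1) _ zero_less_one h' h]
    by blast+
  then show ?thesis using h h' by simp
qed

text \<open>
  The finite set consists of the elements that move the base point by at most two steps of length \<open>\<sigma>\<close>
  and the error of the chain. In \<open>T'\<close> a step has a length between \<open>\<sigma> - 2 D - 1\<close> and \<open>\<sigma> + 2 D + 1\<close>, and
  two consecutive steps overlap in at most \<open>3 D + 3 / 2\<close>. This gives factors \<open>(\<sigma> + 2 D + 1) / \<sigma>\<close> and
  \<open>\<sigma> / (\<sigma> - 8 D - 4)\<close>, which tend to 1 as \<open>\<sigma>\<close> grows.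
\<close>
lemma (in tree_with_action) nearby_orbit_metrics:
  assumes \<kappa>: "1 < \<kappa>"
  shows "\<exists>P. finite P \<and> P \<subseteq> carrier F \<and>
    (\<forall>T' b'. tree_with_action F X (T' :: ('f, 'a) tree_action) b' \<longrightarrow>
      (\<forall>g\<in>P. \<bar>tdist T' b' (act T' g b') - tdist T b (act T g b)\<bar> < 1) \<longrightarrow>
      orbit_dominated F \<kappa> T b T' b' \<and> orbit_dominated F \<kappa> T' b' T b)"
proof -
  obtain D where D: "net D {b}" using ex_net_base by blast
  have D0: "0 \<le> D" using D by (simp add: net_def)
  (* The solution of \<sigma> = \<kappa> (\<sigma> - 8 D - 4), plus 1. *)
  define \<sigma> where "\<sigma> = \<kappa> * (8 * D + 4) / (\<kappa> - 1) + 1"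
  have "(\<kappa> - 1) * \<sigma> = \<kappa> * (8 * D + 4) + (\<kappa> - 1)"
    using \<kappa> unfolding \<sigma>_def distrib_left by simp
  then have \<sigma>1: "\<kappa> * (8 * D + 4) \<le> (\<kappa> - 1) * \<sigma>" using \<kappa> by linarith
  have "8 * D + 4 \<le> \<kappa> * (8 * D + 4) / (\<kappa> - 1)"
    using \<kappa> D0 by (simp add: pos_le_divide_eq algebra_simps)
  then have \<sigma>2: "8 * D + 4 < \<sigma>" by (simp add: \<sigma>_def)
  have \<sigma>0: "0 < \<sigma>" using \<sigma>2 D0 by linarith
  define P where "P = {g \<in> carrier F. od \<one> g \<le> 2 * \<sigma> + 2 * D}"
  show ?thesis
  proof (intro exI[of _ P] conjI allI impI)
    show "finite P" unfolding P_def by (rule finite_od_ball)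
    show "P \<subseteq> carrier F" unfolding P_def by blast
    fix T' :: "('f, 'a) tree_action" and b'
    assume T': "tree_with_action F X T' b'"
      and close: "\<forall>g\<in>P. \<bar>tdist T' b' (act T' g b') - tdist T b (act T g b)\<bar> < 1"
    interpret B: tree_with_action F X T' b' by (fact T')
    have close': "\<bar>B.od u v - od u v\<bar> < 1" if uv: "u \<in> carrier F" "v \<in> carrier F" "od u v \<le> 2 * \<sigma> + 2 * D" for u v
    proof -
      have "inv u \<otimes> v \<in> P" using uv od_inv[OF uv(1,2)] by (simp add: P_def)
      then have "\<bar>B.od \<one> (inv u \<otimes> v) - od \<one> (inv u \<otimes> v)\<bar> < 1"
        using close unfolding B.od_def od_def B.orb_one orb_one by blast
      then show ?thesis using od_inv[OF uv(1,2)] B.od_inv[OF uv(1,2)] by simp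
    qed
    define C where "C = (\<kappa> + 1) * (\<sigma> + D + 1) + \<sigma>"
    have main: "B.od \<one> g \<le> \<kappa> * od \<one> g + C \<and> od \<one> g \<le> \<kappa> * B.od \<one> g + C" if g: "g \<in> carrier F" for g
    proof -
      define l where "l = od \<one> g"
      have l0: "0 \<le> l" using om.d_nonneg g by (simp add: l_def)
      define m where "m = nat \<lfloor>od \<one> g / \<sigma>\<rfloor>"
      have m: "real m \<le> l / \<sigma>" "l / \<sigma> \<le> real m + 1"
        using l0 \<sigma>0 unfolding m_def l_def[symmetric] by (simp_all add: of_nat_floor)
      have m1: "real m * \<sigma> \<le> l" "l \<le> real m * \<sigma> + \<sigma>" using m \<sigma>0 by (simp_all add: field_simps)
      obtain k y where k: "k 0 = \<one>" "\<forall>i\<le>m. k i \<in> carrier F \<and> y i \<in> {b}"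
        "\<forall>i\<le>m. \<forall>j\<le>m. \<bar>tdist T (act T (k i) (y i)) (act T (k j) (y j)) - \<sigma> * \<bar>real i - real j\<bar>\<bar> \<le> 2 * D"
        "\<forall>i\<le>m. \<bar>tdist T (act T (k i) (y i)) (orb g) - (od \<one> g - \<sigma> * real i)\<bar> \<le> D"
        using net_path[OF D one_closed g \<sigma>0] unfolding m_def by blast
      have kF: "k i \<in> carrier F" and yb: "y i = b" if "i \<le> m" for i using k(2) that by blast+
      have kk: "\<bar>od (k i) (k j) - \<sigma> * \<bar>real i - real j\<bar>\<bar> \<le> 2 * D" if "i \<le> m" "j \<le> m" for i j
        using k(3)[rule_format, OF that] yb[OF that(1)] yb[OF that(2)] unfolding od_def by simp
      have "\<bar>od (k m) g - (l - \<sigma> * real m)\<bar> \<le> D"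
        using k(4)[rule_format, of m] yb[of m] unfolding od_def l_def by simp
      then have kg: "od (k m) g \<le> \<sigma> + D" using m1 by (simp add: mult.commute)
      have kg': "B.od (k m) g \<le> \<sigma> + D + 1"
        using close'[OF kF[of m] g] kg \<sigma>0 D0 by simp
      have jump: "\<bar>B.od (k i) (k (Suc i)) - \<sigma>\<bar> \<le> 2 * D + 1" if i: "i < m" for i
      proof -
        have 1: "\<bar>od (k i) (k (Suc i)) - \<sigma>\<bar> \<le> 2 * D" using kk[of i "Suc i"] i by simp
        then have "\<bar>B.od (k i) (k (Suc i)) - od (k i) (k (Suc i))\<bar> < 1"
          using i \<sigma>0 by (intro close' kF) auto
        then show ?thesis using 1 by linarith
      qed
      have double: "2 * \<sigma> - 2 * D - 1 \<le> B.od (k i) (k (Suc (Suc i)))" if i: "Suc i < m" for i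
      proof -
        have 1: "\<bar>od (k i) (k (Suc (Suc i))) - \<sigma> * 2\<bar> \<le> 2 * D" using kk[of i "Suc (Suc i)"] i by simp
        then have "\<bar>B.od (k i) (k (Suc (Suc i))) - od (k i) (k (Suc (Suc i)))\<bar> < 1"
          using i by (intro close' kF) auto
        then show ?thesis using 1 by linarith
      qed
      have "B.od (k 0) (k m) \<le> real m * (\<sigma> + 2 * D + 1)"
      proof (rule B.om.chain_upper)
        show "k i \<in> carrier F" if "i \<le> m" for i using kF that by blast
        show "B.od (k i) (k (Suc i)) \<le> \<sigma> + 2 * D + 1" if "i < m" for i using jump[OF that] by linarith
      qed
      then have "B.od \<one> g \<le> real m * (\<sigma> + 2 * D + 1) + (\<sigma> + D + 1)"
        using B.om.d_triangle[OF one_closed kF[of m] g] kg' k(1) by simp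
      moreover have "real m * (\<sigma> + 2 * D + 1) \<le> \<kappa> * l"
      proof -
        have "2 * D + 1 \<le> 1 * (8 * D + 4)" using D0 by simp
        also have "\<dots> \<le> \<kappa> * (8 * D + 4)" using \<kappa> D0 by (intro mult_right_mono) auto
        finally have "\<sigma> + 2 * D + 1 \<le> \<kappa> * \<sigma>" using \<sigma>1 by (simp add: algebra_simps)
        then have "real m * (\<sigma> + 2 * D + 1) \<le> real m * (\<kappa> * \<sigma>)" by (rule mult_left_mono) simp
        also have "\<dots> = \<kappa> * (real m * \<sigma>)" by simp
        also have "\<dots> \<le> \<kappa> * l" using m1(1) \<kappa> by (intro mult_left_mono) auto
        finally show ?thesis .
      qed
      moreover have "\<sigma> + D + 1 \<le> C"
      proof -
        have "1 * (\<sigma> + D + 1) \<le> (\<kappa> + 1) * (\<sigma> + D + 1)" using \<kappa> \<sigma>0 D0 by (intro mult_right_mono) auto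
        also have "\<dots> \<le> C" using \<sigma>0 unfolding C_def by simp
        finally show ?thesis by simp
      qed
      ultimately have upper: "B.od \<one> g \<le> \<kappa> * l + C" by linarith
      have "real m * ((\<sigma> - 2 * D - 1) - 2 * (3 * D + 3 / 2)) \<le> B.od (k 0) (k m)"
      proof (rule B.om.long_chain)
        show "k i \<in> carrier F" if "i \<le> m" for i using kF that by blast
        show "\<sigma> - 2 * D - 1 \<le> B.od (k i) (k (Suc i))" if "i < m" for i
          using jump[OF that] by linarith
        show "B.om.gp (k (Suc i)) (k i) (k (Suc (Suc i))) \<le> 3 * D + 3 / 2" if i: "Suc i < m" for i
        proof -
          have "B.od (k (Suc i)) (k i) = B.od (k i) (k (Suc i))"
            using B.om.d_commute kF i by simp
          moreover have "B.od (k i) (k (Suc i)) \<le> \<sigma> + 2 * D + 1" using jump[of i] i by simp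
          moreover have "B.od (k (Suc i)) (k (Suc (Suc i))) \<le> \<sigma> + 2 * D + 1" using jump[of "Suc i"] i by simp
          ultimately show ?thesis using double[OF i] unfolding gromov_prod_def by (simp add: field_simps)
        qed
        show "0 \<le> 3 * D + 3 / 2" using D0 by simp
        show "2 * (3 * D + 3 / 2) < \<sigma> - 2 * D - 1" using \<sigma>2 by simp
      qed
      moreover have "(\<sigma> - 2 * D - 1) - 2 * (3 * D + 3 / 2) = \<sigma> - 8 * D - 4" by simp
      ultimately have "real m * (\<sigma> - 8 * D - 4) \<le> B.od \<one> (k m)" using k(1) by metis
      moreover have "B.od \<one> (k m) \<le> B.od \<one> g + (\<sigma> + D + 1)"
        using B.om.d_triangle[OF one_closed g kF[of m]] B.om.d_commute[OF g kF[of m]] kg' by simp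
      ultimately have low: "real m * (\<sigma> - 8 * D - 4) \<le> B.od \<one> g + (\<sigma> + D + 1)" by linarith
      have "\<sigma> \<le> \<kappa> * (\<sigma> - 8 * D - 4)" using \<sigma>1 by (simp add: algebra_simps)
      then have "real m * \<sigma> \<le> real m * (\<kappa> * (\<sigma> - 8 * D - 4))" by (rule mult_left_mono) simp
      also have "\<dots> = \<kappa> * (real m * (\<sigma> - 8 * D - 4))" by simp
      also have "\<dots> \<le> \<kappa> * (B.od \<one> g + (\<sigma> + D + 1))" using low \<kappa> by (intro mult_left_mono) auto
      finally have "l \<le> \<kappa> * B.od \<one> g + \<kappa> * (\<sigma> + D + 1) + \<sigma>" using m1(2) by (simp add: algebra_simps)
      moreover have "\<kappa> * (\<sigma> + D + 1) + \<sigma> \<le> C" using \<sigma>0 D0 by (simp add: C_def algebra_simps)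
      ultimately show ?thesis using upper unfolding l_def by linarith
    qed
    show "orbit_dominated F \<kappa> T b T' b'" "orbit_dominated F \<kappa> T' b' T b"
      using main unfolding orbit_dominated_def B.od_def od_def B.orb_one orb_one by blast+
  qed
qed

lemma free_groupI:
  assumes "group F" "free_basis F X" "finite X"
  shows "free_group F X"
  using assms by (simp add: free_group_def free_group_axioms_def)

lemma tree_iso_refl: "T \<in> cv_trees F \<Longrightarrow> (T, T) \<in> tree_iso F"
  unfolding tree_iso_def by (auto intro!: exI[of _ id] bij_betw_id)

lemma geometric_entropy_eq_entropy_map:
  assumes F: "free_group F X" and \<mu>: "\<mu> \<in> geodesic_currents F X" "emeasure \<mu> (space \<mu>) \<noteq> 0"
    and T: "T \<in> cv_trees F"
  shows "geometric_entropy F X \<mu> T = ereal (entropy_map F X \<mu> (tree_class F T))"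
proof -
  obtain b where b: "b \<in> pts T" using T unfolding cv_trees_def real_tree_def by blast
  interpret free_group F X by (fact F)
  interpret A: tree_with_action F X T b by unfold_locales (use T b in auto)
  obtain h where h: "geometric_entropy F X \<mu> T = ereal h" by (rule A.entropy_finite[OF \<mu>])
  have "T \<in> tree_class F T" unfolding tree_class_def using tree_iso_refl[OF T] by blast
  then have "(SOME T'. T' \<in> tree_class F T) \<in> tree_class F T" by (rule someI)
  then have "(T, SOME T'. T' \<in> tree_class F T) \<in> tree_iso F" unfolding tree_class_def by blast
  from tree_iso_entropy[OF F \<mu> this] show ?thesis using h by (simp add: entropy_map_def)
qed

text \<open>
  The trees that move a single point of \<open>T\<close> by finitely many group elements almost as \<open>T\<close> does form
  one of the basic open sets.
\<close>
lemma continuous_entropy_map: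
  fixes F :: "('f, 'b) monoid_scheme"
  assumes F: "free_group F X" and \<mu>: "\<mu> \<in> geodesic_currents F X" "emeasure \<mu> (space \<mu>) \<noteq> 0"
  shows "continuous_map (cv_topology F :: ('f, 'a) tree_action set topology) euclideanreal (entropy_map F X \<mu>)"
  unfolding continuous_map_def
proof (intro conjI allI impI)
  interpret free_group F X by (fact F)
  let ?S = "{gh_nbhd F T K P \<epsilon> | (T :: ('f, 'a) tree_action) K P \<epsilon>.
     T \<in> cv_trees F \<and> finite K \<and> K \<subseteq> pts T \<and> finite P \<and> P \<subseteq> carrier F \<and> 0 < \<epsilon>}"
  let ?X = "cv_topology F :: ('f, 'a) tree_action set topology"
  have top_cv: "topspace ?X \<subseteq> cv F"
  proof -
    have "topspace ?X = \<Union> ?S" unfolding cv_topology_def by (rule topology_generated_by_topspace)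
    then show ?thesis unfolding gh_nbhd_def by blast
  qed
  show "entropy_map F X \<mu> \<in> topspace ?X \<rightarrow> topspace euclideanreal" by simp
  fix U :: "real set" assume "openin euclideanreal U"
  then have U: "open U" by simp
  show "openin ?X {C \<in> topspace ?X. entropy_map F X \<mu> C \<in> U}"
  proof (subst openin_subopen, intro ballI)
    fix C0 assume C0: "C0 \<in> {C \<in> topspace ?X. entropy_map F X \<mu> C \<in> U}"
    then have "C0 \<in> cv F" using top_cv by blast
    then obtain T where T: "T \<in> cv_trees F" and C0T: "C0 = tree_class F T"
      unfolding cv_def tree_class_def by (rule quotientE)
    obtain b where b: "b \<in> pts T" using T unfolding cv_trees_def real_tree_def by blast
    interpret A: tree_with_action F X T b by unfold_locales (use T b in auto)
    define h where "h = entropy_map F X \<mu> C0"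
    have h: "geometric_entropy F X \<mu> T = ereal h"
      using geometric_entropy_eq_entropy_map[OF F \<mu> T] by (simp add: h_def C0T)
    have h0: "0 \<le> h" using A.entropy_nonneg[OF \<mu>(1)] h by simp
    obtain e where e: "e > 0" "ball h e \<subseteq> U" using U C0 unfolding open_contains_ball h_def by blast
    (* With this factor both (\<kappa> - 1) h < e, which bounds h' from above, and \<kappa> (h - e) < h, which bounds
       it from below. *)
    define \<kappa> where "\<kappa> = 1 + e / (h + 1)"
    have \<kappa>: "1 < \<kappa>" using e h0 by (simp add: \<kappa>_def)
    obtain P where P: "finite P" "P \<subseteq> carrier F" and near: "\<forall>T' b'. tree_with_action F X (T' :: ('f, 'a) tree_action) b' \<longrightarrow>
      (\<forall>g\<in>P. \<bar>tdist T' b' (act T' g b') - tdist T b (act T g b)\<bar> < 1) \<longrightarrow>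
      orbit_dominated F \<kappa> T b T' b' \<and> orbit_dominated F \<kappa> T' b' T b"
      using A.nearby_orbit_metrics[OF \<kappa>] by blast
    define W where "W = gh_nbhd F T {b} P 1"
    have "W \<in> ?S" unfolding W_def using T b P by (intro CollectI exI[of _ T] exI[of _ "{b}"] exI[of _ P] exI[of _ 1]) auto
    then have W: "openin ?X W" unfolding cv_topology_def by (rule topology_generated_by_Basis)
    have "C0 \<in> W"
      unfolding W_def gh_nbhd_def
    proof (intro CollectI conjI bexI[of _ T] bexI[of _ id])
      show "C0 \<in> cv F" by (fact \<open>C0 \<in> cv F\<close>)
      show "T \<in> C0" unfolding C0T tree_class_def using tree_iso_refl[OF T] by blast
      show "id \<in> {b} \<rightarrow> pts T" using b by simp
    qed simp
    moreover have "W \<subseteq> {C \<in> topspace ?X. entropy_map F X \<mu> C \<in> U}"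
    proof
      fix C assume C: "C \<in> W"
      have Ctop: "C \<in> topspace ?X" using openin_subset[OF W] C by blast
      then have "C \<in> cv F" using top_cv by blast
      then obtain T1 where T1: "T1 \<in> cv_trees F" and CT1: "C = tree_class F T1"
        unfolding cv_def tree_class_def by (rule quotientE)
      obtain T' \<phi> where T': "T' \<in> C" and \<phi>: "\<phi> b \<in> pts T'"
        "\<forall>g\<in>P. \<bar>tdist T' (\<phi> b) (act T' g (\<phi> b)) - tdist T b (act T g b)\<bar> < 1"
        using C unfolding W_def gh_nbhd_def by auto
      have iso: "(T1, T') \<in> tree_iso F" using T' unfolding CT1 tree_class_def by blast
      then have cv': "T' \<in> cv_trees F" unfolding tree_iso_def by blast
      interpret B: tree_with_action F X T' "\<phi> b" by unfold_locales (use cv' \<phi> in auto)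
      define h' where "h' = entropy_map F X \<mu> C"
      have h': "geometric_entropy F X \<mu> T' = ereal h'"
        using tree_iso_entropy[OF F \<mu> iso] geometric_entropy_eq_entropy_map[OF F \<mu> T1] by (simp add: h'_def CT1)
      have dom: "orbit_dominated F \<kappa> T b T' (\<phi> b)" "orbit_dominated F \<kappa> T' (\<phi> b) T b"
        using near B.tree_with_action_axioms \<phi>(2) by blast+
      have \<kappa>0: "0 < \<kappa>" using \<kappa> by simp
      have "h \<le> \<kappa> * h'"
        by (rule entropy_compare[OF A.tree_with_action_axioms B.tree_with_action_axioms \<mu>(1) dom(1) \<kappa>0 h h'])
      moreover have "h' \<le> \<kappa> * h"
        by (rule entropy_compare[OF B.tree_with_action_axioms A.tree_with_action_axioms \<mu>(1) dom(2) \<kappa>0 h' h])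
      moreover have small: "(\<kappa> - 1) * h < e"
      proof -
        have "(\<kappa> - 1) * h = e * (h / (h + 1))" by (simp add: \<kappa>_def)
        also have "\<dots> < e * 1" using e h0 by (intro mult_strict_left_mono) simp_all
        finally show ?thesis by simp
      qed
      moreover have "h - e < h'"
      proof -
        have "0 < (\<kappa> - 1) * e" using \<kappa> e by simp
        then have "\<kappa> * (h - e) < h" using small by (simp add: algebra_simps)
        then have "\<kappa> * (h - e) < \<kappa> * h'" using \<open>h \<le> \<kappa> * h'\<close> by linarith
        then show ?thesis using \<kappa>0 by simp
      qed
      ultimately have "h' \<in> ball h e" by (simp add: dist_real_def abs_less_iff algebra_simps)
      then show "C \<in> {C \<in> topspace ?X. entropy_map F X \<mu> C \<in> U}" using e(2) Ctop by (auto simp: h'_def)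
    qed
    ultimately show "\<exists>V. openin ?X V \<and> C0 \<in> V \<and> V \<subseteq> {C \<in> topspace ?X. entropy_map F X \<mu> C \<in> U}"
      using W by blast
  qed
qed

theorem proposition3p7:
  fixes F :: "('f, 'b) monoid_scheme" and X :: "'f set"
    and \<mu> :: "('f bdry_point \<times> 'f bdry_point) measure"
  assumes "group F"
    and "free_basis F X" and "finite X" and "card X \<ge> 2"
    and "\<mu> \<in> geodesic_currents F X"
    and "emeasure \<mu> (space \<mu>) \<noteq> 0"
  shows "(\<forall>T \<in> (cv_trees F :: ('f, 'a) tree_action set).
            geometric_entropy F X \<mu> T = ereal (entropy_map F X \<mu> (tree_class F T))) \<and>
         continuous_map (cv_topology F :: ('f, 'a) tree_action set topology) euclideanreal
           (entropy_map F X \<mu>)"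
proof -
  have F: "free_group F X" using assms(1-3) by (rule free_groupI)
  show ?thesis
    using geometric_entropy_eq_entropy_map[OF F assms(5,6)] continuous_entropy_map[OF F assms(5,6)] by blast
qed

end
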